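(* Fix a round $t$ and any one-step admissible upper state $(U_t,Q_t)$, and put $U_t^\sharp:=\min\{U_t,\bar f\}$. For every predictable (i.e. $\mathcal F_t$-measurable) feasible pair $(w,\theta)$ with $w\in\Delta_{S_t}$ and $\theta\in[\underline\theta,\bar\theta]^{S_t}$, if round $t$ of the algorithm is run with weights $w$ and amplitudes $\theta$, then almost surely $$\mathbb E[F(x_{t+1})-F_\star\mid \mathcal F_t,w,\theta]\le \mathcal J_t^{\mathrm{id}}(w,\theta),$$ where $$\mathcal J_t^{\mathrm{id}}(w,\theta):=U_t^\sharp-\sum_{i\in\mathcal S_t}w_i\,\mu_i(\theta_i;U_t,Q_t)+\frac L2\sum_{i\in\mathcal S_t}w_i^2\,\kappa_i(\theta_i;U_t,Q_t),$$ with $A_i(\theta_i):=\frac{\theta_i}{2LR^2}$, $s_i(U_t^\sharp;\theta_i):=U_t^\sharp-T_{A_i(\theta_i)}(U_t^\sharp)$, where $T_a(u):=\frac{u}{1+au}$, $$\rho_i(\theta_i;U_t,Q_t):=32e^{2\theta_i}\theta_i^3U_t+\frac{16\theta_i+64e^{2\theta_i}\theta_i^3}{L}Q_t+8e^{2\theta_i}\frac{\theta_i^3v_i^2}{LH_ib_i},$$ $$\kappa_i(\theta_i;U_t,Q_t):=16e^{2\theta_i}\frac{\theta_i^4}{L}U_t+32e^{2\theta_i}\frac{\theta_i^4}{L^2}Q_t+\bigl(2\theta_i^2+4e^{2\theta_i}\theta_i^4\bigr)\frac{v_i^2}{L^2H_ib_i},$$ $$\mu_i(\theta_i;U_t,Q_t):=s_i(U_t^\sharp;\theta_i)-\rho_i(\theta_i;U_t,Q_t).$$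 Moreover, if executable variance proxies $\widehat v_{i,t}^2\ge v_i^2$ are used, then for every feasible $(w,\theta)$, $$\mathcal J_t^{\mathrm{id}}(w,\theta)\le\mathcal J_t^{\mathrm{ex}}(w,\theta),$$ where $\mathcal J_t^{\mathrm{ex}}$ is obtained from $\mathcal J_t^{\mathrm{id}}$ by replacing every occurrence of $v_i^2$ in the formulas for $\rho_i$ and $\kappa_i$ by $\widehat v_{i,t}^2$.
   Context: Problem: $F(x)=\frac1n\sum_{i=1}^nF_i(x)$, $F_i(x)=\frac1{m_i}\sum_{j=1}^{m_i}\phi_{ij}(x)$, each $\phi_{ij}:\mathbb R^d\to\mathbb R$ convex and $L$-smooth ($\|\nabla\phi_{ij}(x)-\nabla\phi_{ij}(y)\|\le L\|x-y\|$). There are $x_\star\in\arg\min F$ and $R>0$; $B(x_\star,R)=\{x:\|x-x_\star\|\le R\}$, $F_\star:=F(x_\star)$, $f_t:=F(x_t)-F_\star$, $\bar f:=LR^2/2$. Node $i$ has a local horizon $H_i\in\{1,2,\dots\}$, minibatch size $b_i$, and variance level $v_i^2:=\sup_{x\in B(x_\star,R)}\frac1{m_i}\sum_j\|\nabla\phi_{ij}(x)-\nabla F_i(x)\|^2$. Algorithm (HEW-Local SGD). Local controls $c_{i,0}$ are given and $c_0=\frac1n\sum_ic_{i,0}$. At round $t$, with nonempty active set $\mathcal S_t\subseteq[n]$, weights $w_t\in\Delta_{S_t}:=\{w\in\mathbb R_+^{S_t}:\sum_{i\in\mathcal S_t}w_i=1\}$ and amplitudes $\theta_{i,t}\in[\underline\theta,\bar\theta]$,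 $0<\underline\theta\le\bar\theta\le1$: each $i\in\mathcal S_t$ sets $\eta_{i,t}=\theta_{i,t}/(LH_i)$, $y_{i,t}^{(0)}=x_t$, and for $\ell=0,\dots,H_i-1$ draws a minibatch $\mathcal B_{i,t,\ell}\subseteq[m_i]$ of size $b_i$, computes $g_{i,t,\ell}=\frac1{b_i}\sum_{j\in\mathcal B_{i,t,\ell}}\nabla\phi_{ij}(y_{i,t}^{(\ell)})$ and sets $y_{i,t}^{(\ell+1)}=y_{i,t}^{(\ell)}-\eta_{i,t}(g_{i,t,\ell}-c_{i,t}+c_t)$; then $\Delta_{i,t}=y_{i,t}^{(H_i)}-x_t$ and $c_{i,t+1}=c_{i,t}-c_t+\frac1{H_i\eta_{i,t}}(x_t-y_{i,t}^{(H_i)})$. For $i\notin\mathcal S_t$, $c_{i,t+1}=c_{i,t}$. The server sets $x_{t+1}=x_t+\sum_{i\in\mathcal S_t}w_{i,t}\Delta_{i,t}$ and $c_{t+1}=c_t+\frac1n\sum_{i\in\mathcal S_t}(c_{i,t+1}-c_{i,t})$. Standing assumptions: almost surely $x_t,y_{i,t}^{(\ell)}\in B(x_\star,R)$ for all rounds $t$, active $i$ and $0\le\ell\le H_i$. $\mathcal F_t$ is the sigma-field generated by the initial state and all minibatches drawn strictly before round $t$; $\mathcal S_t$ and control pairs $(w_t,\theta_t)$ are $\mathcal F_t$-measurable. $\mathcal G_{i,t,\ell}$ is generated by $\mathcal F_t$ and all minibatches of node $i$ drawn strictly before local step $\ell$ of round $t$; conditionally on $\mathcal G_{i,t,\ell}$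 the minibatches are independent across active nodes and local steps, $\mathbb E[g_{i,t,\ell}\mid\mathcal G_{i,t,\ell}]=\nabla F_i(y_{i,t}^{(\ell)})$ and $\mathbb E[\|g_{i,t,\ell}-\nabla F_i(y_{i,t}^{(\ell)})\|^2\mid\mathcal G_{i,t,\ell}]\le v_i^2/b_i$. A one-step admissible upper state at round $t$ is an $\mathcal F_t$-measurable pair $(U_t,Q_t)$ with $f_t\le U_t$ and $\max_{1\le i\le n}\|c_{i,t}-\nabla F_i(x_t)\|^2\le Q_t$ almost surely. *)

theory Defs
  imports "HOL-Probability.Probability"
begin

definition gradient :: "('a::real_inner \<Rightarrow> real) \<Rightarrow> 'a \<Rightarrow> 'a" where
  "gradient f x = (THE D. GDERIV f x :> D)"

definition L_smooth :: "real \<Rightarrow> ('a::real_inner \<Rightarrow> real) \<Rightarrow> bool" where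
  "L_smooth L f \<longleftrightarrow> (\<forall>x. f differentiable at x) \<and> L-lipschitz_on UNIV (gradient f)"

text \<open>Nodes are numbered by \<open>{1..n}\<close>, the components of node \<open>i\<close> by \<open>{1..m i}\<close>.\<close>

definition node_obj :: "(nat \<Rightarrow> nat) \<Rightarrow> (nat \<Rightarrow> nat \<Rightarrow> 'a \<Rightarrow> real) \<Rightarrow> nat \<Rightarrow> 'a \<Rightarrow> real" where
  "node_obj m \<phi> i x = (1 / real (m i)) * (\<Sum>j\<in>{1..m i}. \<phi> i j x)"

definition global_obj :: "nat \<Rightarrow> (nat \<Rightarrow> nat) \<Rightarrow> (nat \<Rightarrow> nat \<Rightarrow> 'a \<Rightarrow> real) \<Rightarrow> 'a \<Rightarrow> real" where
  "global_obj n m \<phi> x = (1 / real n) * (\<Sum>i\<in>{1..n}. node_obj m \<phi> i x)"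

definition variance_level ::
    "(nat \<Rightarrow> nat) \<Rightarrow> (nat \<Rightarrow> nat \<Rightarrow> 'a::euclidean_space \<Rightarrow> real) \<Rightarrow> 'a \<Rightarrow> real \<Rightarrow> nat \<Rightarrow> real" where
  "variance_level m \<phi> xstar R i =
     (SUP x\<in>cball xstar R. (1 / real (m i)) *
        (\<Sum>j\<in>{1..m i}. (norm (gradient (\<phi> i j) x - gradient (node_obj m \<phi> i) x))\<^sup>2))"

text \<open>\<^const>\<open>variance_level\<close> is the squared quantity $v_i^2$.\<close>


definition vec_cond_exp :: "'w measure \<Rightarrow> 'w measure \<Rightarrow> ('w \<Rightarrow> real ^ 'd) \<Rightarrow> 'w \<Rightarrow> real ^ 'd" where
  "vec_cond_exp M G X \<omega> = (\<chi> k. real_cond_exp M G (\<lambda>\<omega>'. X \<omega>' $ k) \<omega>)"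

definition cond_indep_vars ::
    "'w measure \<Rightarrow> 'w measure \<Rightarrow> ('i \<Rightarrow> 'b measure) \<Rightarrow> ('i \<Rightarrow> 'w \<Rightarrow> 'b) \<Rightarrow> 'i set \<Rightarrow> bool" where
  "cond_indep_vars M G N X I \<longleftrightarrow>
     (\<forall>i\<in>I. X i \<in> measurable M (N i)) \<and>
     (\<forall>J A. J \<subseteq> I \<longrightarrow> finite J \<longrightarrow> J \<noteq> {} \<longrightarrow> A \<in> (\<Pi> j\<in>J. sets (N j)) \<longrightarrow>
        (AE \<omega> in M.
           real_cond_exp M G (indicat_real (\<Inter>j\<in>J. X j -` A j \<inter> space M)) \<omega> =
           (\<Prod>j\<in>J. real_cond_exp M G (indicat_real (X j -` A j \<inter> space M)) \<omega>)))"


text \<open>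
  \<open>B t i l \<omega>\<close> is the minibatch drawn by node \<open>i\<close> at local step \<open>l\<close> of round \<open>t\<close>. A node that is
  inactive in round \<open>t\<close> draws nothing, which is encoded by the value \<open>{}\<close>; minibatch sizes
  being positive, this cannot be confused with an actual draw.
\<close>

definition past_field ::
    "'w measure \<Rightarrow> nat \<Rightarrow> (nat \<Rightarrow> nat) \<Rightarrow> ('w \<Rightarrow> 'a::topological_space) \<Rightarrow> (nat \<Rightarrow> 'w \<Rightarrow> 'a) \<Rightarrow>
     (nat \<Rightarrow> nat \<Rightarrow> nat \<Rightarrow> 'w \<Rightarrow> nat set) \<Rightarrow> nat \<Rightarrow> 'w measure" where
  "past_field M n H x0 c0 B t = sigma (space M)
     ({x0 -` A \<inter> space M | A. A \<in> sets borel} \<union>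
      {c0 i -` A \<inter> space M | i A. i \<in> {1..n} \<and> A \<in> sets borel} \<union>
      {B s i l -` A \<inter> space M | s i l A. s < t \<and> i \<in> {1..n} \<and> l < H i})"

definition local_field ::
    "'w measure \<Rightarrow> 'w measure \<Rightarrow> (nat \<Rightarrow> 'w \<Rightarrow> nat set) \<Rightarrow> nat \<Rightarrow> 'w measure" where
  "local_field M F Bi l = sigma (space M)
     (sets F \<union> {Bi k -` A \<inter> space M | k A. k < l})"

definition control_field ::
    "'w measure \<Rightarrow> nat \<Rightarrow> 'w measure \<Rightarrow> (nat \<Rightarrow> 'w \<Rightarrow> real) \<Rightarrow> (nat \<Rightarrow> 'w \<Rightarrow> real) \<Rightarrow> 'w measure" where
  "control_field M n F w \<theta> = sigma (space M)
     (sets F \<union> {w i -` A \<inter> space M | i A. i \<in> {1..n} \<and> A \<in> sets borel} \<union>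
      {\<theta> i -` A \<inter> space M | i A. i \<in> {1..n} \<and> A \<in> sets borel})"

definition feasible :: "real \<Rightarrow> real \<Rightarrow> nat set \<Rightarrow> (nat \<Rightarrow> real) \<Rightarrow> (nat \<Rightarrow> real) \<Rightarrow> bool" where
  "feasible \<theta>lo \<theta>hi A w \<theta> \<longleftrightarrow>
     (\<forall>i\<in>A. 0 \<le> w i) \<and> (\<Sum>i\<in>A. w i) = 1 \<and> (\<forall>i\<in>A. \<theta> i \<in> {\<theta>lo..\<theta>hi})"

text \<open>
  Only the entries at active nodes carry meaning; a control defined on the active nodes alone is
  extended, e.g. by zero, to a control whose entries are all measurable.
\<close>

definition predictable_feasible ::
    "'w measure \<Rightarrow> nat \<Rightarrow> real \<Rightarrow> real \<Rightarrow> 'w measure \<Rightarrow> ('w \<Rightarrow> nat set) \<Rightarrow>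
     (nat \<Rightarrow> 'w \<Rightarrow> real) \<Rightarrow> (nat \<Rightarrow> 'w \<Rightarrow> real) \<Rightarrow> bool" where
  "predictable_feasible M n \<theta>lo \<theta>hi F A w \<theta> \<longleftrightarrow>
     (\<forall>i\<in>{1..n}. w i \<in> borel_measurable F \<and> \<theta> i \<in> borel_measurable F) \<and>
     (\<forall>\<omega>\<in>space M. feasible \<theta>lo \<theta>hi (A \<omega>) (\<lambda>i. w i \<omega>) (\<lambda>i. \<theta> i \<omega>))"

definition step_size :: "real \<Rightarrow> nat \<Rightarrow> real \<Rightarrow> real" where
  "step_size L h \<theta> = \<theta> / (L * real h)"

definition minibatch_grad ::
    "(nat \<Rightarrow> nat \<Rightarrow> 'a::real_inner \<Rightarrow> real) \<Rightarrow> nat \<Rightarrow> nat \<Rightarrow> nat set \<Rightarrow> 'a \<Rightarrow> 'a" where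
  "minibatch_grad \<phi> k i \<beta> x = (1 / real k) *\<^sub>R (\<Sum>j\<in>\<beta>. gradient (\<phi> i j) x)"

text \<open>
  The state of a run: server iterates \<open>x t\<close>, local iterates \<open>y t i l\<close> (meaningful for active \<open>i\<close>),
  local controls \<open>c t i\<close> and server controls \<open>cs t\<close>.
\<close>

locale hew_local_sgd = prob_space M
  for M :: "'w measure" +
  fixes n :: nat and m :: "nat \<Rightarrow> nat"
    and \<phi> :: "nat \<Rightarrow> nat \<Rightarrow> real ^ 'd \<Rightarrow> real"
    and L R :: real and xstar :: "real ^ 'd"
    and H b :: "nat \<Rightarrow> nat" and \<theta>lo \<theta>hi :: real
    and S :: "nat \<Rightarrow> 'w \<Rightarrow> nat set"
    and B :: "nat \<Rightarrow> nat \<Rightarrow> nat \<Rightarrow> 'w \<Rightarrow> nat set"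
    and w \<theta> :: "nat \<Rightarrow> nat \<Rightarrow> 'w \<Rightarrow> real"
    and x :: "nat \<Rightarrow> 'w \<Rightarrow> real ^ 'd"
    and y :: "nat \<Rightarrow> nat \<Rightarrow> nat \<Rightarrow> 'w \<Rightarrow> real ^ 'd"
    and c :: "nat \<Rightarrow> nat \<Rightarrow> 'w \<Rightarrow> real ^ 'd"
    and cs :: "nat \<Rightarrow> 'w \<Rightarrow> real ^ 'd"
  assumes n_pos: "1 \<le> n"
    and m_pos: "\<And>i. i \<in> {1..n} \<Longrightarrow> 1 \<le> m i"
    and H_pos: "\<And>i. i \<in> {1..n} \<Longrightarrow> 1 \<le> H i"
    and b_pos: "\<And>i. i \<in> {1..n} \<Longrightarrow> 1 \<le> b i"
    and L_pos: "0 < L" and R_pos: "0 < R"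
    and theta_bounds: "0 < \<theta>lo" "\<theta>lo \<le> \<theta>hi" "\<theta>hi \<le> 1"
    and component_convex: "\<And>i j. i \<in> {1..n} \<Longrightarrow> j \<in> {1..m i} \<Longrightarrow> convex_on UNIV (\<phi> i j)"
    and component_smooth: "\<And>i j. i \<in> {1..n} \<Longrightarrow> j \<in> {1..m i} \<Longrightarrow> L_smooth L (\<phi> i j)"
    and minimizer: "is_arg_min (global_obj n m \<phi>) (\<lambda>_. True) xstar"
    and init_measurable: "x 0 \<in> borel_measurable M"
      "\<And>i. i \<in> {1..n} \<Longrightarrow> c 0 i \<in> borel_measurable M"
    and active_nonempty: "\<And>t \<omega>. \<omega> \<in> space M \<Longrightarrow> S t \<omega> \<subseteq> {1..n} \<and> S t \<omega> \<noteq> {}"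
    and active_measurable:
      "\<And>t. S t \<in> measurable (past_field M n H (x 0) (c 0) B t) (count_space UNIV)"
    and controls:
      "\<And>t. predictable_feasible M n \<theta>lo \<theta>hi (past_field M n H (x 0) (c 0) B t) (S t) (w t) (\<theta> t)"
    and batch_measurable:
      "\<And>t i l. i \<in> {1..n} \<Longrightarrow> l < H i \<Longrightarrow> B t i l \<in> measurable M (count_space UNIV)"
    and batch_active:
      "\<And>t i l \<omega>. \<omega> \<in> space M \<Longrightarrow> i \<in> S t \<omega> \<Longrightarrow> l < H i \<Longrightarrow>
         B t i l \<omega> \<subseteq> {1..m i} \<and> card (B t i l \<omega>) = b i"
    and batch_inactive:
      "\<And>t i l \<omega>. \<omega> \<in> space M \<Longrightarrow> i \<in> {1..n} - S t \<omega> \<Longrightarrow> l < H i \<Longrightarrow> B t i l \<omega> = {}"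
    and local_init: "\<And>t i \<omega>. \<omega> \<in> space M \<Longrightarrow> i \<in> S t \<omega> \<Longrightarrow> y t i 0 \<omega> = x t \<omega>"
    and local_step:
      "\<And>t i l \<omega>. \<omega> \<in> space M \<Longrightarrow> i \<in> S t \<omega> \<Longrightarrow> l < H i \<Longrightarrow>
         y t i (Suc l) \<omega> = y t i l \<omega> - step_size L (H i) (\<theta> t i \<omega>) *\<^sub>R
           (minibatch_grad \<phi> (b i) i (B t i l \<omega>) (y t i l \<omega>) - c t i \<omega> + cs t \<omega>)"
    and local_control_active:
      "\<And>t i \<omega>. \<omega> \<in> space M \<Longrightarrow> i \<in> S t \<omega> \<Longrightarrow>
         c (Suc t) i \<omega> = c t i \<omega> - cs t \<omega> +
           (1 / (real (H i) * step_size L (H i) (\<theta> t i \<omega>))) *\<^sub>R (x t \<omega> - y t i (H i) \<omega>)"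
    and local_control_inactive:
      "\<And>t i \<omega>. \<omega> \<in> space M \<Longrightarrow> i \<in> {1..n} - S t \<omega> \<Longrightarrow> c (Suc t) i \<omega> = c t i \<omega>"
    and server_step:
      "\<And>t \<omega>. \<omega> \<in> space M \<Longrightarrow>
         x (Suc t) \<omega> = x t \<omega> + (\<Sum>i\<in>S t \<omega>. w t i \<omega> *\<^sub>R (y t i (H i) \<omega> - x t \<omega>))"
    and server_control_init:
      "\<And>\<omega>. \<omega> \<in> space M \<Longrightarrow> cs 0 \<omega> = (1 / real n) *\<^sub>R (\<Sum>i\<in>{1..n}. c 0 i \<omega>)"
    and server_control_step:
      "\<And>t \<omega>. \<omega> \<in> space M \<Longrightarrow>
         cs (Suc t) \<omega> = cs t \<omega> + (1 / real n) *\<^sub>R (\<Sum>i\<in>S t \<omega>. c (Suc t) i \<omega> - c t i \<omega>)"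
    and iterates_in_ball:
      "AE \<omega> in M. \<forall>t. x t \<omega> \<in> cball xstar R \<and>
         (\<forall>i\<in>S t \<omega>. \<forall>l\<le>H i. y t i l \<omega> \<in> cball xstar R)"
    and batches_cond_indep:
      "\<And>t i l. i \<in> {1..n} \<Longrightarrow> l < H i \<Longrightarrow>
         cond_indep_vars M (local_field M (past_field M n H (x 0) (c 0) B t) (B t i) l)
           (\<lambda>_. count_space UNIV) (\<lambda>(j, k). B t j k) (SIGMA j:{1..n}. {..<H j})"
    and batch_unbiased:
      "\<And>t i l. i \<in> {1..n} \<Longrightarrow> l < H i \<Longrightarrow>
         AE \<omega> in M. i \<in> S t \<omega> \<longrightarrow>
           vec_cond_exp M (local_field M (past_field M n H (x 0) (c 0) B t) (B t i) l)
             (\<lambda>\<omega>'. if i \<in> S t \<omega>' then minibatch_grad \<phi> (b i) i (B t i l \<omega>') (y t i l \<omega>') else 0) \<omega>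
           = gradient (node_obj m \<phi> i) (y t i l \<omega>)"
    and batch_variance:
      "\<And>t i l. i \<in> {1..n} \<Longrightarrow> l < H i \<Longrightarrow>
         AE \<omega> in M. i \<in> S t \<omega> \<longrightarrow>
           real_cond_exp M (local_field M (past_field M n H (x 0) (c 0) B t) (B t i) l)
             (\<lambda>\<omega>'. if i \<in> S t \<omega>'
                then (norm (minibatch_grad \<phi> (b i) i (B t i l \<omega>') (y t i l \<omega>')
                        - gradient (node_obj m \<phi> i) (y t i l \<omega>')))\<^sup>2
                else 0) \<omega>
           \<le> variance_level m \<phi> xstar R i / real (b i)"

text \<open>
  The truncations \<open>if i \<in> S t \<omega>' \<dots>\<close> only discard the undefined local iterates of inactive nodes:
  the event \<open>i \<in> S t\<close> belongs to the conditioning sigma-field. Likewise, inactive nodes contribute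
  only variables that are known given the past to the family in \<open>batches_cond_indep\<close>.
\<close>


definition one_step_admissible ::
    "'w measure \<Rightarrow> nat \<Rightarrow> (nat \<Rightarrow> nat) \<Rightarrow> (nat \<Rightarrow> nat \<Rightarrow> 'a::euclidean_space \<Rightarrow> real) \<Rightarrow> 'a \<Rightarrow>
     'w measure \<Rightarrow> ('w \<Rightarrow> 'a) \<Rightarrow> (nat \<Rightarrow> 'w \<Rightarrow> 'a) \<Rightarrow> ('w \<Rightarrow> real) \<Rightarrow> ('w \<Rightarrow> real) \<Rightarrow> bool" where
  "one_step_admissible M n m \<phi> xstar F xt ct U Q \<longleftrightarrow>
     U \<in> borel_measurable F \<and> Q \<in> borel_measurable F \<and>
     (AE \<omega> in M. global_obj n m \<phi> (xt \<omega>) - global_obj n m \<phi> xstar \<le> U \<omega>) \<and>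
     (AE \<omega> in M. (MAX i\<in>{1..n}. (norm (ct i \<omega> - gradient (node_obj m \<phi> i) (xt \<omega>)))\<^sup>2) \<le> Q \<omega>)"

definition U_sharp :: "real \<Rightarrow> real \<Rightarrow> real \<Rightarrow> real" where
  "U_sharp L R U = min U (L * R\<^sup>2 / 2)"

definition T_map :: "real \<Rightarrow> real \<Rightarrow> real" where
  "T_map a u = u / (1 + a * u)"

definition A_coef :: "real \<Rightarrow> real \<Rightarrow> real \<Rightarrow> real" where
  "A_coef L R \<theta> = \<theta> / (2 * L * R\<^sup>2)"

definition s_gain :: "real \<Rightarrow> real \<Rightarrow> real \<Rightarrow> real \<Rightarrow> real" where
  "s_gain L R u \<theta> = u - T_map (A_coef L R \<theta>) u"

text \<open>Below \<open>V\<close> is a squared variance level, \<open>h\<close> a local horizon and \<open>k\<close> a minibatch size.\<close>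

definition rho_loss ::
    "real \<Rightarrow> real \<Rightarrow> nat \<Rightarrow> nat \<Rightarrow> real \<Rightarrow> real \<Rightarrow> real \<Rightarrow> real" where
  "rho_loss L V h k \<theta> U Q =
     32 * exp (2 * \<theta>) * \<theta> ^ 3 * U
     + (16 * \<theta> + 64 * exp (2 * \<theta>) * \<theta> ^ 3) / L * Q
     + 8 * exp (2 * \<theta>) * (\<theta> ^ 3 * V / (L * real h * real k))"

definition kappa_var ::
    "real \<Rightarrow> real \<Rightarrow> nat \<Rightarrow> nat \<Rightarrow> real \<Rightarrow> real \<Rightarrow> real \<Rightarrow> real" where
  "kappa_var L V h k \<theta> U Q =
     16 * exp (2 * \<theta>) * (\<theta> ^ 4 / L) * U
     + 32 * exp (2 * \<theta>) * (\<theta> ^ 4 / L\<^sup>2) * Q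
     + (2 * \<theta>\<^sup>2 + 4 * exp (2 * \<theta>) * \<theta> ^ 4) * (V / (L\<^sup>2 * real h * real k))"

definition mu_gain ::
    "real \<Rightarrow> real \<Rightarrow> real \<Rightarrow> nat \<Rightarrow> nat \<Rightarrow> real \<Rightarrow> real \<Rightarrow> real \<Rightarrow> real" where
  "mu_gain L R V h k \<theta> U Q = s_gain L R (U_sharp L R U) \<theta> - rho_loss L V h k \<theta> U Q"

text \<open>
  The ideal cost is the instance \<open>V i = \<close> \<^term>\<open>variance_level m \<phi> xstar R i\<close>; the executable cost
  the instance where \<open>V i\<close> is the squared variance proxy.
\<close>

definition J_cost ::
    "real \<Rightarrow> real \<Rightarrow> (nat \<Rightarrow> nat) \<Rightarrow> (nat \<Rightarrow> nat) \<Rightarrow> (nat \<Rightarrow> real) \<Rightarrow> nat set \<Rightarrow>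
     real \<Rightarrow> real \<Rightarrow> (nat \<Rightarrow> real) \<Rightarrow> (nat \<Rightarrow> real) \<Rightarrow> real" where
  "J_cost L R H b V A U Q w \<theta> =
     U_sharp L R U
     - (\<Sum>i\<in>A. w i * mu_gain L R (V i) (H i) (b i) (\<theta> i) U Q)
     + L / 2 * (\<Sum>i\<in>A. (w i)\<^sup>2 * kappa_var L (V i) (H i) (b i) (\<theta> i) U Q)"

end

theory Submission
  imports Defs
begin

text \<open>
  Fix a round and write \<open>x\<close> for the server iterate, \<open>f\<close> for its objective gap and \<open>g\<close> for the full
  gradient there. The local path of an active node \<open>i\<close> with amplitude \<open>\<theta>\<close> moves by
  \<open>- (\<theta> / L) (d + G + N)\<close> (lemma \<open>local_displacement\<close>): the first noise-free direction \<open>d\<close>, which is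
  known given the past, the average change \<open>G\<close> of the node gradient along the path, and the average
  stochastic gradient error \<open>N\<close>. Put into the descent inequality of the smooth objective, this gives
  \<open>weighted_step_le\<close>. The part without noise costs, by convexity of the squared norm, the weighted
  mean of \<open>\<theta> / (2 L) (|d + G - g|^2 - |g|^2)\<close>. Of the quadratic noise terms only those of a single
  node survive, which is why the variances \<open>\<kappa>\<close> enter with squared weights: noise has zero mean given the
  earlier steps of its node, and by conditional independence this remains true given all minibatches
  of any other node (\<open>noise_orthogonal\<close>, \<open>noise_orthogonal_other\<close>). The product of the noise with the
  change \<open>G\<close> of the same node has no sign and no zero mean; it is split by Young's inequality, and
  this puts the drift into \<open>\<kappa>\<close> as well.

  The drift is controlled by comparing the local path with the path that follows the full
  gradients of the node. That path is known given the past and stays within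
  \<open>e^\<theta> (\<theta> / L) |d|\<close> of \<open>x\<close>, and the mean square deviation from it grows per step by the factor
  \<open>(1 + \<theta> / H)^2\<close> and by the variance of one step (\<open>mean_path_drift\<close>, \<open>dev_second_moment\<close>). Together
  they bound the mean square of \<open>G\<close> by \<open>L^2\<close> times \<open>drift_level\<close>.

  It remains to insert the upper state. The server control is the mean of the local ones, so
  \<open>|d - g|^2 \<le> 4 Q\<close>; smoothness gives \<open>|g|^2 \<le> 2 L f\<close>; and convexity gives \<open>|g| \<ge> f / R\<close>, so that the
  gain \<open>\<theta> / (2 L) |g|^2\<close> is at least \<open>A f^2\<close>, while \<open>f - A f^2 \<le> T f\<close> for the increasing map \<open>T\<close> with
  parameter \<open>A\<close>. With these bounds the remaining terms are dominated by \<open>\<rho>\<close> and \<open>\<kappa>\<close>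
  (\<open>node_losses_le\<close>, \<open>level_le_J_cost\<close>).

  Up to the last step everything is an inequality between integrals over an arbitrary event of the
  past. Weights, amplitudes and such indicators are then bounded multipliers that
  are known given the past. The upper state, which need not be integrable, is only inserted pointwise.
\<close>

section \<open>Gradients of smooth and convex functions\<close>

lemma gradient_eqI:
  assumes "GDERIV f x :> D"
  shows "gradient f x = D"
  unfolding gradient_def
proof (rule the_equality)
  fix D' assume "GDERIV f x :> D'"
  with assms have "(\<lambda>h. inner h D) = (\<lambda>h. inner h D')"
    unfolding gderiv_def by (rule has_derivative_unique)
  then have "inner (D - D') D = inner (D - D') D'" by metis
  then have "inner (D - D') (D - D') = 0" by (simp add: inner_diff_right)
  then show "D' = D" by simp
qed (rule assms)

lemma differentiable_imp_GDERIV: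
  fixes f :: "'a::euclidean_space \<Rightarrow> real"
  assumes "f differentiable at x"
  shows "GDERIV f x :> gradient f x"
proof -
  obtain f' where f': "(f has_derivative f') (at x)"
    using assms unfolding differentiable_def by auto
  then interpret bounded_linear f' by (rule has_derivative_bounded_linear)
  define D where "D = (\<Sum>b\<in>Basis. f' b *\<^sub>R b)"
  have "f' h = inner h D" for h
  proof -
    have "f' h = f' (\<Sum>b\<in>Basis. inner h b *\<^sub>R b)" by (simp add: euclidean_representation)
    also have "\<dots> = inner h D"
      by (simp add: sum scaleR D_def inner_sum_right mult.commute)
    finally show ?thesis .
  qed
  then have "f' = (\<lambda>h. inner h D)" by auto
  then have D: "GDERIV f x :> D" using f' by (simp add: gderiv_def)
  with gradient_eqI[OF D] show ?thesis by simp
qed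

lemma L_smoothD:
  fixes f :: "'a::euclidean_space \<Rightarrow> real"
  assumes "L_smooth L f"
  shows "GDERIV f x :> gradient f x"
    and "norm (gradient f x - gradient f y) \<le> L * norm (x - y)"
proof -
  show "GDERIV f x :> gradient f x"
    using assms by (intro differentiable_imp_GDERIV) (auto simp: L_smooth_def)
  show "norm (gradient f x - gradient f y) \<le> L * norm (x - y)"
    using assms by (auto simp: L_smooth_def intro: lipschitz_on_normD)
qed

lemma L_smoothI:
  assumes "\<And>x. GDERIV f x :> G x" "L-lipschitz_on UNIV G"
  shows "L_smooth L f" "gradient f = G"
proof -
  show eq: "gradient f = G" using gradient_eqI[OF assms(1)] by auto
  show "L_smooth L f"
    using assms unfolding L_smooth_def eq gderiv_def differentiable_def by auto
qed

lemma L_smooth_continuous: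
  assumes "L_smooth L f"
  shows "continuous_on UNIV f" "continuous_on UNIV (gradient f)"
proof -
  show "continuous_on UNIV f"
    using assms by (auto simp: L_smooth_def continuous_on_eq_continuous_at
        intro: differentiable_imp_continuous_within)
  show "continuous_on UNIV (gradient f)"
    using assms unfolding L_smooth_def by (blast intro: lipschitz_on_continuous_on)
qed

lemma GDERIV_mean:
  assumes "\<And>i. i \<in> I \<Longrightarrow> GDERIV (f i) x :> D i"
  shows "GDERIV (\<lambda>x. a * (\<Sum>i\<in>I. f i x)) x :> a *\<^sub>R (\<Sum>i\<in>I. D i)"
proof -
  have "((\<lambda>x. a * (\<Sum>i\<in>I. f i x)) has_derivative (\<lambda>h. a * (\<Sum>i\<in>I. inner h (D i)))) (at x)"
    using assms unfolding gderiv_def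
    by (intro has_derivative_mult_right has_derivative_sum) auto
  then show ?thesis
    unfolding gderiv_def by (simp add: inner_sum_right)
qed

lemma L_smooth_mean:
  fixes f :: "'i \<Rightarrow> 'a::euclidean_space \<Rightarrow> real"
  assumes I: "finite I" "I \<noteq> {}"
    and f: "\<And>i. i \<in> I \<Longrightarrow> L_smooth L (f i)" and L: "0 \<le> L"
  shows "L_smooth L (\<lambda>x. (1 / real (card I)) * (\<Sum>i\<in>I. f i x))"
    and "gradient (\<lambda>x. (1 / real (card I)) * (\<Sum>i\<in>I. f i x))
           = (\<lambda>x. (1 / real (card I)) *\<^sub>R (\<Sum>i\<in>I. gradient (f i) x))"
proof -
  let ?G = "\<lambda>x. (1 / real (card I)) *\<^sub>R (\<Sum>i\<in>I. gradient (f i) x)"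
  have card: "real (card I) > 0" using I by (simp add: card_gt_0_iff)
  have lip: "L-lipschitz_on UNIV ?G"
  proof (rule lipschitz_onI)
    fix x y :: 'a
    have "norm (?G x - ?G y) = (1 / real (card I)) * norm (\<Sum>i\<in>I. gradient (f i) x - gradient (f i) y)"
      by (simp add: scaleR_diff_right[symmetric] sum_subtractf)
    also have "\<dots> \<le> (1 / real (card I)) * (\<Sum>i\<in>I. L * norm (x - y))"
      by (intro mult_left_mono order_trans[OF norm_sum] sum_mono L_smoothD(2) f) auto
    also have "\<dots> = L * norm (x - y)" using card by simp
    finally show "dist (?G x) (?G y) \<le> L * dist x y" by (simp add: dist_norm)
  qed (rule L)
  have "GDERIV (\<lambda>x. (1 / real (card I)) * (\<Sum>i\<in>I. f i x)) x :> ?G x" for x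
    by (intro GDERIV_mean L_smoothD(1)[OF f])
  from L_smoothI[OF this lip]
  show "L_smooth L (\<lambda>x. (1 / real (card I)) * (\<Sum>i\<in>I. f i x))"
    "gradient (\<lambda>x. (1 / real (card I)) * (\<Sum>i\<in>I. f i x)) = ?G" by auto
qed

lemma GDERIV_along_line:
  fixes f :: "'a::real_inner \<Rightarrow> real"
  assumes "GDERIV f (x + s *\<^sub>R d) :> D"
  shows "((\<lambda>s. f (x + s *\<^sub>R d)) has_real_derivative inner D d) (at s)"
proof -
  have line: "((\<lambda>s. x + s *\<^sub>R d) has_derivative (\<lambda>h. h *\<^sub>R d)) (at s)"
    by (auto intro!: derivative_eq_intros)
  have "((\<lambda>s. f (x + s *\<^sub>R d)) has_derivative (\<lambda>h. inner (h *\<^sub>R d) D)) (at s)"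
    using has_derivative_compose[OF line assms[unfolded gderiv_def]] .
  moreover have "(\<lambda>h. inner (h *\<^sub>R d) D) = (*) (inner D d)"
    by (auto simp: inner_commute)
  ultimately show ?thesis by (simp add: has_field_derivative_def)
qed

lemma L_smooth_descent:
  fixes f :: "'a::euclidean_space \<Rightarrow> real"
  assumes f: "L_smooth L f"
  shows "f (x + d) \<le> f x + inner (gradient f x) d + L / 2 * (norm d)\<^sup>2"
proof -
  let ?g = "\<lambda>s. f (x + s *\<^sub>R d) - s * inner (gradient f x) d - L / 2 * s\<^sup>2 * (norm d)\<^sup>2"
  have "?g 1 \<le> ?g 0"
  proof (rule DERIV_nonpos_imp_nonincreasing[where f = ?g])
    fix s :: real assume s: "0 \<le> s" "s \<le> 1"
    let ?D = "inner (gradient f (x + s *\<^sub>R d)) d - inner (gradient f x) d - L * s * (norm d)\<^sup>2"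
    have "(?g has_real_derivative ?D) (at s)"
      by (auto intro!: derivative_eq_intros GDERIV_along_line L_smoothD(1)[OF f])
    moreover have "?D \<le> 0"
    proof -
      have "inner (gradient f (x + s *\<^sub>R d) - gradient f x) d
          \<le> norm (gradient f (x + s *\<^sub>R d) - gradient f x) * norm d"
        by (rule norm_cauchy_schwarz)
      also have "\<dots> \<le> L * norm (s *\<^sub>R d) * norm d"
        using L_smoothD(2)[OF f, of "x + s *\<^sub>R d" x] by (intro mult_right_mono) auto
      also have "\<dots> = L * s * (norm d)\<^sup>2" using s by (simp add: power2_eq_square)
      finally show ?thesis by (simp add: inner_diff_left)
    qed
    ultimately show "\<exists>D. (?g has_real_derivative D) (at s) \<and> D \<le> 0" by blast
  qed simp
  then show ?thesis by simp
qed

lemma convex_on_mean: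
  fixes f :: "'i \<Rightarrow> 'a::real_vector \<Rightarrow> real"
  assumes "\<And>i. i \<in> I \<Longrightarrow> convex_on UNIV (f i)" "0 \<le> a"
  shows "convex_on UNIV (\<lambda>z. a * (\<Sum>i\<in>I. f i z))"
proof -
  have "convex_on UNIV (\<lambda>z. \<Sum>i\<in>I. f i z)"
    using assms(1)
    by (induction I rule: infinite_finite_induct) (auto intro: convex_on_add simp: convex_on_const)
  then show ?thesis using assms(2) by (rule convex_on_cmul[rotated])
qed

lemma convex_above_gradient:
  fixes f :: "'a::real_inner \<Rightarrow> real"
  assumes cvx: "convex_on UNIV f" and f: "GDERIV f x :> D"
  shows "f x + inner D (z - x) \<le> f z"
proof -
  let ?g = "\<lambda>s. f (x + s *\<^sub>R (z - x))"
  have "convex_on UNIV ?g"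
  proof (rule convex_onI)
    fix r s t :: real assume "0 < r" "r < 1"
    have "x + ((1 - r) *\<^sub>R s + r *\<^sub>R t) *\<^sub>R (z - x)
        = (1 - r) *\<^sub>R (x + s *\<^sub>R (z - x)) + r *\<^sub>R (x + t *\<^sub>R (z - x))"
      by (simp add: algebra_simps)
    then show "?g ((1 - r) *\<^sub>R s + r *\<^sub>R t) \<le> (1 - r) * ?g s + r * ?g t"
      using convex_onD[OF cvx, of r] \<open>0 < r\<close> \<open>r < 1\<close> by simp
  qed simp
  moreover have "(?g has_real_derivative inner D (z - x)) (at 0 within UNIV)"
    using GDERIV_along_line[of f x 0 "z - x" D] f by simp
  ultimately have "inner D (z - x) * (1 - 0) \<le> ?g 1 - ?g 0"
    by (intro convex_on_imp_above_tangent[where A = UNIV]) auto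
  then show ?thesis by simp
qed

lemma gradient_at_minimum:
  fixes f :: "'a::euclidean_space \<Rightarrow> real"
  assumes f: "L_smooth L f" and min: "\<And>z. f x \<le> f z"
  shows "gradient f x = 0"
proof (rule ccontr)
  assume nz: "gradient f x \<noteq> 0"
  have L: "0 \<le> L" using f lipschitz_on_nonneg unfolding L_smooth_def by blast
  \<comment> \<open>A step of length \<open>1 / (L + 1)\<close> along the negative gradient would decrease \<open>f\<close>; the
    denominator also covers \<open>L = 0\<close>.\<close>
  define s where "s = 1 / (L + 1)"
  have s: "s > 0" "L * s < 2" using L by (auto simp: s_def field_simps)
  have "f x \<le> f (x + (- s) *\<^sub>R gradient f x)" by (rule min)
  also have "\<dots> \<le> f x - s * (norm (gradient f x))\<^sup>2 + L / 2 * (s\<^sup>2 * (norm (gradient f x))\<^sup>2)"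
    using L_smooth_descent[OF f, of x "(- s) *\<^sub>R gradient f x"] s
    by (simp add: power_mult_distrib power2_norm_eq_inner)
  also have "\<dots> = f x - s * (1 - L * s / 2) * (norm (gradient f x))\<^sup>2"
    by (simp add: algebra_simps power2_eq_square)
  also have "\<dots> < f x" using s nz by simp
  finally show False by simp
qed

section \<open>Essentially bounded random variables and conditional expectations\<close>

text \<open>Measurable and almost surely bounded by a constant. This class of random variables is closed
  under the algebraic operations and integrable on a finite measure space.\<close>

definition ess_bdd :: "'w measure \<Rightarrow> ('w \<Rightarrow> 'b::{real_normed_vector, second_countable_topology}) \<Rightarrow> bool" where
  "ess_bdd M X \<longleftrightarrow> X \<in> borel_measurable M \<and> (\<exists>K. AE \<omega> in M. norm (X \<omega>) \<le> K)"

lemma ess_bddI: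
  assumes "X \<in> borel_measurable M" "AE \<omega> in M. norm (X \<omega>) \<le> K"
  shows "ess_bdd M X"
  using assms unfolding ess_bdd_def by blast

lemma ess_bdd_measurable: "ess_bdd M X \<Longrightarrow> X \<in> borel_measurable M"
  by (simp add: ess_bdd_def)

lemma ess_bdd_dominated:
  assumes "X \<in> borel_measurable M" "ess_bdd M Y" "AE \<omega> in M. norm (X \<omega>) \<le> norm (Y \<omega>)"
  shows "ess_bdd M X"
proof -
  obtain K where "AE \<omega> in M. norm (Y \<omega>) \<le> K" using assms(2) unfolding ess_bdd_def by blast
  with assms(3) have "AE \<omega> in M. norm (X \<omega>) \<le> K" by eventually_elim auto
  then show ?thesis by (rule ess_bddI[OF assms(1)])
qed

lemma ess_bdd_const: "ess_bdd M (\<lambda>_. c)"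
  unfolding ess_bdd_def by auto

lemma ess_bdd_add:
  assumes "ess_bdd M X" "ess_bdd M Y"
  shows "ess_bdd M (\<lambda>\<omega>. X \<omega> + Y \<omega>)"
proof -
  obtain K K' where "AE \<omega> in M. norm (X \<omega>) \<le> K" "AE \<omega> in M. norm (Y \<omega>) \<le> K'"
    using assms unfolding ess_bdd_def by blast
  then have "AE \<omega> in M. norm (X \<omega> + Y \<omega>) \<le> K + K'"
    by eventually_elim (rule norm_triangle_mono)
  with assms show ?thesis by (intro ess_bddI) (auto simp: ess_bdd_def)
qed

lemma ess_bdd_scaleR:
  assumes "ess_bdd M X" "ess_bdd M Y"
  shows "ess_bdd M (\<lambda>\<omega>. X \<omega> *\<^sub>R Y \<omega>)"
proof -
  obtain K K' where "AE \<omega> in M. norm (X \<omega>) \<le> K" "AE \<omega> in M. norm (Y \<omega>) \<le> K'"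
    using assms unfolding ess_bdd_def by blast
  then have "AE \<omega> in M. norm (X \<omega> *\<^sub>R Y \<omega>) \<le> K * K'"
  proof eventually_elim
    fix \<omega> assume "norm (X \<omega>) \<le> K" "norm (Y \<omega>) \<le> K'"
    moreover from this have "0 \<le> K" by (meson norm_ge_zero order_trans)
    ultimately show "norm (X \<omega> *\<^sub>R Y \<omega>) \<le> K * K'" by (simp add: mult_mono)
  qed
  with assms show ?thesis by (intro ess_bddI) (auto simp: ess_bdd_def)
qed

lemma ess_bdd_mult:
  fixes X Y :: "'w \<Rightarrow> real"
  assumes "ess_bdd M X" "ess_bdd M Y"
  shows "ess_bdd M (\<lambda>\<omega>. X \<omega> * Y \<omega>)"
  using ess_bdd_scaleR[OF assms] by simp

lemma ess_bdd_diff: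
  assumes "ess_bdd M X" "ess_bdd M Y"
  shows "ess_bdd M (\<lambda>\<omega>. X \<omega> - Y \<omega>)"
  using ess_bdd_add[OF assms(1) ess_bdd_scaleR[OF ess_bdd_const assms(2)], of "-1"] by simp

lemma ess_bdd_norm: "ess_bdd M X \<Longrightarrow> ess_bdd M (\<lambda>\<omega>. norm (X \<omega>))"
  unfolding ess_bdd_def by auto

lemma ess_bdd_inner:
  fixes X Y :: "'w \<Rightarrow> 'b::{real_inner, second_countable_topology}"
  assumes "ess_bdd M X" "ess_bdd M Y"
  shows "ess_bdd M (\<lambda>\<omega>. inner (X \<omega>) (Y \<omega>))"
proof (rule ess_bdd_dominated[OF _ ess_bdd_mult[OF ess_bdd_norm[OF assms(1)] ess_bdd_norm[OF assms(2)]]])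
  show "(\<lambda>\<omega>. inner (X \<omega>) (Y \<omega>)) \<in> borel_measurable M"
    using assms by (auto simp: ess_bdd_def)
  show "AE \<omega> in M. norm (inner (X \<omega>) (Y \<omega>)) \<le> norm (norm (X \<omega>) * norm (Y \<omega>))"
    by (simp add: Cauchy_Schwarz_ineq2)
qed

lemma ess_bdd_power2:
  fixes X :: "'w \<Rightarrow> real"
  shows "ess_bdd M X \<Longrightarrow> ess_bdd M (\<lambda>\<omega>. (X \<omega>)\<^sup>2)"
  unfolding power2_eq_square by (rule ess_bdd_mult)

lemma ess_bdd_sum:
  assumes "\<And>i. i \<in> I \<Longrightarrow> ess_bdd M (X i)"
  shows "ess_bdd M (\<lambda>\<omega>. \<Sum>i\<in>I. X i \<omega>)"
  using assms by (induction I rule: infinite_finite_induct) (auto intro: ess_bdd_const ess_bdd_add)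

lemma ess_bdd_component:
  fixes X :: "'w \<Rightarrow> real ^ 'd"
  assumes "ess_bdd M X" shows "ess_bdd M (\<lambda>\<omega>. X \<omega> $ k)"
  using ess_bdd_inner[OF assms ess_bdd_const[of M "axis k 1"]] by (simp add: inner_axis)

lemmas ess_bdd_intros = ess_bdd_const ess_bdd_add ess_bdd_diff ess_bdd_scaleR ess_bdd_mult
  ess_bdd_norm ess_bdd_inner ess_bdd_power2 ess_bdd_sum ess_bdd_component

lemma (in finite_measure) integrable_ess_bdd:
  fixes X :: "'a \<Rightarrow> 'b::{banach, second_countable_topology}"
  assumes "ess_bdd M X" shows "integrable M X"
  using assms unfolding ess_bdd_def by (auto intro: integrable_const_bound)

text \<open>A conditional expectation is bounded by an integrable function as soon as the
  corresponding integrals over all conditioning events are.\<close>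

lemma (in sigma_finite_subalgebra) real_cond_exp_le_if_integrals_le:
  assumes X: "integrable M X" and Y: "integrable M Y" "Y \<in> borel_measurable F"
    and le: "\<And>C. C \<in> sets F \<Longrightarrow> (\<integral>\<omega>. indicator C \<omega> * X \<omega> \<partial>M) \<le> (\<integral>\<omega>. indicator C \<omega> * Y \<omega> \<partial>M)"
  shows "AE \<omega> in M. real_cond_exp M F X \<omega> \<le> Y \<omega>"
proof -
  let ?E = "real_cond_exp M F X"
  have space: "space F = space M" using subalg by (simp add: subalgebra_def)
  have meas [measurable]: "?E \<in> borel_measurable F" "Y \<in> borel_measurable F"
    by (auto simp: Y)
  \<comment> \<open>The event on which the claim fails is itself a conditioning event.\<close>
  define C where "C = {\<omega> \<in> space F. Y \<omega> < ?E \<omega>}"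
  have C: "C \<in> sets F" unfolding C_def by measurable
  then have CM: "C \<in> sets M" using subalg by (auto simp: subalgebra_def)
  have XM: "X \<in> borel_measurable M" using X by auto
  have iX: "integrable M (\<lambda>\<omega>. indicator C \<omega> * X \<omega>)"
    using integrable_mult_indicator[OF CM X] by simp
  have iY: "integrable M (\<lambda>\<omega>. indicator C \<omega> * Y \<omega>)"
    using integrable_mult_indicator[OF CM Y(1)] by simp
  have iE: "integrable M (\<lambda>\<omega>. indicator C \<omega> * ?E \<omega>)"
    "(\<integral>\<omega>. indicator C \<omega> * ?E \<omega> \<partial>M) = (\<integral>\<omega>. indicator C \<omega> * X \<omega> \<partial>M)"
    using real_cond_exp_intg[OF iX _ XM] C by auto
  have int: "integrable M (\<lambda>\<omega>. indicator C \<omega> * ?E \<omega> - indicator C \<omega> * Y \<omega>)"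
    using iE(1) iY by (rule Bochner_Integration.integrable_diff)
  have nonneg: "0 \<le> indicator C \<omega> * ?E \<omega> - indicator C \<omega> * Y \<omega>" for \<omega>
    by (auto simp: indicator_def C_def)
  have "(\<integral>\<omega>. indicator C \<omega> * ?E \<omega> - indicator C \<omega> * Y \<omega> \<partial>M) \<le> 0"
    using le[OF C] iE iY by simp
  moreover have "(\<integral>\<omega>. indicator C \<omega> * ?E \<omega> - indicator C \<omega> * Y \<omega> \<partial>M) \<ge> 0"
    using nonneg by (intro integral_nonneg_AE) auto
  ultimately have "(\<integral>\<omega>. indicator C \<omega> * ?E \<omega> - indicator C \<omega> * Y \<omega> \<partial>M) = 0" by simp
  then have "AE \<omega> in M. indicator C \<omega> * ?E \<omega> - indicator C \<omega> * Y \<omega> = 0"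
    using integral_nonneg_eq_0_iff_AE[OF int] nonneg by auto
  with AE_space show ?thesis
    by eventually_elim (auto simp: C_def indicator_def space split: if_splits)
qed

section \<open>Measurability of the state of a run\<close>

lemma space_past_field [simp]: "space (past_field M n H x0 c0 B t) = space M"
  unfolding past_field_def by (intro space_measure_of) auto

lemma sets_past_field:
  "sets (past_field M n H x0 c0 B t) = sigma_sets (space M)
     ({x0 -` A \<inter> space M | A. A \<in> sets borel} \<union>
      {c0 i -` A \<inter> space M | i A. i \<in> {1..n} \<and> A \<in> sets borel} \<union>
      {B s i l -` A \<inter> space M | s i l A. s < t \<and> i \<in> {1..n} \<and> l < H i})"
  unfolding past_field_def by (intro sets_measure_of) auto

lemma space_local_field [simp]: "space (local_field M F Bi l) = space M"
  if "space F = space M"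
  unfolding local_field_def using sets.sets_into_space[of _ F] that
  by (intro space_measure_of) auto

lemma sets_local_field:
  assumes "space F = space M"
  shows "sets (local_field M F Bi l) =
    sigma_sets (space M) (sets F \<union> {Bi k -` A \<inter> space M | k A. k < l})"
  unfolding local_field_def using sets.sets_into_space[of _ F] assms
  by (intro sets_measure_of) auto

text \<open>Conditioning on predictable controls as well does not enlarge the past.\<close>

lemma control_field_eq_past:
  assumes F: "F = sigma (space M) G" "G \<subseteq> Pow (space M)"
    and meas: "\<And>i. i \<in> {1..n} \<Longrightarrow> w i \<in> borel_measurable F"
      "\<And>i. i \<in> {1..n} \<Longrightarrow> \<theta> i \<in> borel_measurable F"
  shows "control_field M n F w \<theta> = F"
proof -
  have space: "space F = space M" unfolding F by (rule space_measure_of) (rule F(2))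
  have sets: "sets F = sigma_sets (space M) G" unfolding F by (rule sets_measure_of) (rule F(2))
  let ?G = "sets F \<union> {w i -` A \<inter> space M | i A. i \<in> {1..n} \<and> A \<in> sets borel} \<union>
      {\<theta> i -` A \<inter> space M | i A. i \<in> {1..n} \<and> A \<in> sets borel}"
  have "?G \<subseteq> sets F"
    using measurable_sets[OF meas(1)] measurable_sets[OF meas(2)] space by auto
  then have G: "?G = sets F" by blast
  have "sigma (space M) (sets F) = F"
  proof (rule measure_eqI)
    show "sets (sigma (space M) (sets F)) = sets F"
      using sets.sets_measure_of_eq[of F] space by simp
    show "emeasure (sigma (space M) (sets F)) A = emeasure F A" for A
      unfolding F by (simp add: emeasure_sigma)
  qed
  then show ?thesis unfolding control_field_def G .
qed

context hew_local_sgd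
begin

abbreviation past :: "nat \<Rightarrow> 'w measure" where
  "past t \<equiv> past_field M n H (x 0) (c 0) B t"

abbreviation loc :: "nat \<Rightarrow> nat \<Rightarrow> nat \<Rightarrow> 'w measure" where
  "loc t i l \<equiv> local_field M (past t) (B t i) l"

abbreviation "grad_node i \<equiv> gradient (node_obj m \<phi> i)"
abbreviation "grad_glob \<equiv> gradient (global_obj n m \<phi>)"
abbreviation "grad_batch i \<equiv> minibatch_grad \<phi> (b i) i"

lemma subalgebra_past: "subalgebra M (past t)"
proof -
  have "sets (past t) \<subseteq> sets M"
    unfolding sets_past_field
    using measurable_sets[OF init_measurable(1)] measurable_sets[OF init_measurable(2)]
      measurable_sets[OF batch_measurable]
    by (intro sets.sigma_sets_subset) auto
  then show ?thesis by (simp add: subalgebra_def)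
qed

lemma subalgebra_loc:
  assumes "i \<in> {1..n}" "l \<le> H i"
  shows "subalgebra M (loc t i l)"
proof -
  have "sets (loc t i l) \<subseteq> sets M"
    using assms measurable_sets[OF batch_measurable[OF assms(1)]]
      subalgebra_past[of t, unfolded subalgebra_def]
    by (subst sets_local_field) (auto intro!: sets.sigma_sets_subset)
  then show ?thesis by (simp add: subalgebra_def)
qed

lemma subalgebra_loc_past: "subalgebra (loc t i l) (past t)"
  unfolding subalgebra_def by (auto simp: sets_local_field intro: sigma_sets.Basic)

lemma subalgebra_past_mono:
  assumes "s \<le> t" shows "subalgebra (past t) (past s)"
  unfolding subalgebra_def sets_past_field
proof (intro conjI sigma_sets_mono' Un_mono order_refl)
  show "{B u i l -` A \<inter> space M | u i l A. u < s \<and> i \<in> {1..n} \<and> l < H i}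
      \<subseteq> {B u i l -` A \<inter> space M | u i l A. u < t \<and> i \<in> {1..n} \<and> l < H i}"
    using assms less_le_trans by blast
qed simp

lemma measurable_past_mono:
  assumes "f \<in> measurable (past s) N" "s \<le> t" shows "f \<in> measurable (past t) N"
  using measurable_from_subalg[OF subalgebra_past_mono[OF assms(2)] assms(1)] .

lemma measurable_past_loc: "f \<in> measurable (past t) N \<Longrightarrow> f \<in> measurable (loc t i l) N"
  using measurable_from_subalg[OF subalgebra_loc_past] .

lemma measurable_past_M: "f \<in> measurable (past t) N \<Longrightarrow> f \<in> measurable M N"
  using measurable_from_subalg[OF subalgebra_past] .

lemma measurable_loc_M:
  "f \<in> measurable (loc t i l) N \<Longrightarrow> i \<in> {1..n} \<Longrightarrow> l \<le> H i \<Longrightarrow> f \<in> measurable M N"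
  using measurable_from_subalg[OF subalgebra_loc] .

lemma batch_measurable_past:
  assumes "s < t" "i \<in> {1..n}" "l < H i"
  shows "B s i l \<in> measurable (past t) (count_space UNIV)"
proof (rule measurableI)
  fix A :: "nat set set"
  have "B s i l -` A \<inter> space M \<in> {B s i l -` A \<inter> space M | s i l A. s < t \<and> i \<in> {1..n} \<and> l < H i}"
    using assms by blast
  then show "B s i l -` A \<inter> space (past t) \<in> sets (past t)"
    unfolding sets_past_field space_past_field by (intro sigma_sets.Basic UnI2)
qed simp

lemma batch_measurable_loc:
  assumes "k < l"
  shows "B t i k \<in> measurable (loc t i l) (count_space UNIV)"
  using assms by (intro measurableI) (auto simp: sets_local_field intro!: sigma_sets.Basic)

lemma batch_subset:
  assumes "\<omega> \<in> space M" "i \<in> {1..n}" "l < H i"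
  shows "B t i l \<omega> \<subseteq> {1..m i}"
  using assms batch_active batch_inactive by (cases "i \<in> S t \<omega>") auto

lemma L_smooth_node: "i \<in> {1..n} \<Longrightarrow> L_smooth L (node_obj m \<phi> i)"
  and gradient_node: "i \<in> {1..n} \<Longrightarrow>
    grad_node i = (\<lambda>z. (1 / real (m i)) *\<^sub>R (\<Sum>j\<in>{1..m i}. gradient (\<phi> i j) z))"
  using L_smooth_mean[of "{1..m i}" L "\<phi> i"] m_pos[of i] component_smooth[of i] L_pos
  unfolding node_obj_def[abs_def] by auto

lemma L_smooth_global: "L_smooth L (global_obj n m \<phi>)"
  and gradient_global: "grad_glob = (\<lambda>z. (1 / real n) *\<^sub>R (\<Sum>i\<in>{1..n}. grad_node i z))"
  using L_smooth_mean[of "{1..n}" L "node_obj m \<phi>"] n_pos L_smooth_node L_pos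
  unfolding global_obj_def[abs_def] by auto

lemma borel_measurable_grad_node [measurable]:
  "i \<in> {1..n} \<Longrightarrow> grad_node i \<in> borel_measurable borel"
  using L_smooth_continuous(2)[OF L_smooth_node] by (rule borel_measurable_continuous_onI)

lemma borel_measurable_grad_glob [measurable]: "grad_glob \<in> borel_measurable borel"
  using L_smooth_continuous(2)[OF L_smooth_global] by (rule borel_measurable_continuous_onI)

lemma borel_measurable_global_obj [measurable]: "global_obj n m \<phi> \<in> borel_measurable borel"
  using L_smooth_continuous(1)[OF L_smooth_global] by (rule borel_measurable_continuous_onI)

lemma borel_measurable_grad_batch:
  "i \<in> {1..n} \<Longrightarrow> \<beta> \<subseteq> {1..m i} \<Longrightarrow> grad_batch i \<beta> \<in> borel_measurable borel"
  unfolding minibatch_grad_def using L_smooth_continuous(2)[OF component_smooth]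
  by (intro borel_measurable_continuous_onI continuous_intros) auto

text \<open>The local path driven by a prescribed sequence of minibatches. Unlike the iterates of the
  run it is defined for every node, so it needs no case distinction between active and
  inactive nodes.\<close>

primrec local_path :: "nat \<Rightarrow> nat \<Rightarrow> (nat \<Rightarrow> nat set) \<Rightarrow> nat \<Rightarrow> 'w \<Rightarrow> real ^ 'd" where
  "local_path t i \<beta> 0 \<omega> = x t \<omega>"
| "local_path t i \<beta> (Suc l) \<omega> = local_path t i \<beta> l \<omega> - step_size L (H i) (\<theta> t i \<omega>) *\<^sub>R
     (grad_batch i (\<beta> l) (local_path t i \<beta> l \<omega>) - c t i \<omega> + cs t \<omega>)"

text \<open>The local path of the run; for an active node it consists of the local iterates.\<close>

definition iterate :: "nat \<Rightarrow> nat \<Rightarrow> nat \<Rightarrow> 'w \<Rightarrow> real ^ 'd" where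
  "iterate t i l \<omega> = local_path t i (\<lambda>k. B t i k \<omega>) l \<omega>"

lemma iterate_0 [simp]: "iterate t i 0 \<omega> = x t \<omega>"
  by (simp add: iterate_def)

lemma iterate_Suc:
  "iterate t i (Suc l) \<omega> = iterate t i l \<omega> - step_size L (H i) (\<theta> t i \<omega>) *\<^sub>R
     (grad_batch i (B t i l \<omega>) (iterate t i l \<omega>) - c t i \<omega> + cs t \<omega>)"
  by (simp add: iterate_def)

lemma iterate_eq_y:
  assumes "\<omega> \<in> space M" "i \<in> S t \<omega>" "l \<le> H i"
  shows "y t i l \<omega> = iterate t i l \<omega>"
  using assms(3)
  by (induction l) (simp_all add: local_init[OF assms(1,2)] local_step[OF assms(1,2)] iterate_Suc)

lemma local_path_cong:
  "(\<And>k. k < l \<Longrightarrow> \<beta> k = \<beta>' k) \<Longrightarrow> local_path t i \<beta> l \<omega> = local_path t i \<beta>' l \<omega>"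
  by (induction l) auto

text \<open>The possible values of the minibatches of node \<open>i\<close> at the local steps before \<open>l\<close>, as functions
  that are undefined from \<open>l\<close> on; an inactive node contributes empty sets.\<close>

definition tables :: "nat \<Rightarrow> nat \<Rightarrow> (nat \<Rightarrow> nat set) set" where
  "tables i l = ({..<l} \<rightarrow>\<^sub>E Pow {1..m i})"

definition batch_table :: "nat \<Rightarrow> nat \<Rightarrow> nat \<Rightarrow> 'w \<Rightarrow> nat \<Rightarrow> nat set" where
  "batch_table t i l \<omega> = (\<lambda>k\<in>{..<l}. B t i k \<omega>)"

lemma finite_tables: "finite (tables i l)"
  unfolding tables_def by (intro finite_PiE) auto

lemma tables_subset: "\<beta> \<in> tables i l \<Longrightarrow> k < l \<Longrightarrow> \<beta> k \<subseteq> {1..m i}"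
  unfolding tables_def by auto

lemma batch_table_in_tables:
  "\<omega> \<in> space M \<Longrightarrow> i \<in> {1..n} \<Longrightarrow> l \<le> H i \<Longrightarrow> batch_table t i l \<omega> \<in> tables i l"
  unfolding tables_def batch_table_def by (intro restrict_PiE_iff[THEN iffD2] ballI PowI batch_subset) auto

lemma batch_table_eq_iff:
  assumes "\<beta> \<in> tables i l"
  shows "batch_table t i l \<omega> = \<beta> \<longleftrightarrow> (\<forall>k\<in>{..<l}. B t i k \<omega> = \<beta> k)"
  using assms unfolding tables_def batch_table_def
  by (auto simp: PiE_def extensional_def fun_eq_iff)

lemma iterate_eq_local_path:
  "l \<le> k \<Longrightarrow> iterate t i l \<omega> = local_path t i (batch_table t i k \<omega>) l \<omega>"
  unfolding iterate_def batch_table_def by (intro local_path_cong) auto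

lemma measurable_batch_table:
  assumes N: "space N = space M" and i: "i \<in> {1..n}" "l \<le> H i"
    and B: "\<And>k. k < l \<Longrightarrow> B t i k \<in> measurable N (count_space UNIV)"
  shows "batch_table t i l \<in> measurable N (count_space (tables i l))"
  unfolding measurable_count_space_eq2[OF finite_tables]
proof (intro conjI ballI)
  show "batch_table t i l \<in> space N \<rightarrow> tables i l"
    using batch_table_in_tables i N by auto
  fix \<beta> assume "\<beta> \<in> tables i l"
  then have "batch_table t i l -` {\<beta>} \<inter> space N = {\<omega> \<in> space N. \<forall>k\<in>{..<l}. B t i k \<omega> = \<beta> k}"
    using batch_table_eq_iff[of \<beta> i l t] by (simp add: vimage_def Int_def conj_commute)
  also have "\<dots> \<in> sets N"
  proof (rule sets.sets_Collect_finite_All)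
    fix k assume "k \<in> {..<l}"
    then have "B t i k -` {\<beta> k} \<inter> space N \<in> sets N" by (intro measurable_sets[OF B]) auto
    moreover have "B t i k -` {\<beta> k} \<inter> space N = {\<omega> \<in> space N. B t i k \<omega> = \<beta> k}" by auto
    ultimately show "{\<omega> \<in> space N. B t i k \<omega> = \<beta> k} \<in> sets N" by simp
  qed auto
  finally show "batch_table t i l -` {\<beta>} \<inter> space N \<in> sets N" .
qed

lemma batch_table_event:
  assumes j: "j \<in> {1..n}" and \<beta>: "\<beta> \<in> tables j (H j)"
  shows "{\<omega> \<in> space M. batch_table t j (H j) \<omega> = \<beta>} \<in> sets M"
proof -
  have "batch_table t j (H j) \<in> measurable M (count_space (tables j (H j)))"
    using j batch_measurable by (intro measurable_batch_table) auto
  from measurable_sets[OF this, of "{\<beta>}"] \<beta> show ?thesis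
    by (simp add: vimage_def Int_def conj_commute)
qed

text \<open>Functions of the minibatches of a node are handled by conditioning on the finitely many
  values of the table of these minibatches.\<close>

lemma measurable_of_batch_table:
  fixes f :: "(nat \<Rightarrow> nat set) \<Rightarrow> 'w \<Rightarrow> 'c::topological_space"
  assumes N: "space N = space M" and i: "i \<in> {1..n}" "l \<le> H i"
    and B: "\<And>k. k < l \<Longrightarrow> B t i k \<in> measurable N (count_space UNIV)"
    and f: "\<And>\<beta>. \<beta> \<in> tables i l \<Longrightarrow> f \<beta> \<in> borel_measurable N"
  shows "(\<lambda>\<omega>. f (batch_table t i l \<omega>) \<omega>) \<in> borel_measurable N"
  by (rule measurable_compose_countable'[where I = "tables i l", OF f measurable_batch_table[OF N i B]])
    (auto intro: countable_finite finite_tables)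

lemma measurable_local_path:
  assumes i: "i \<in> {1..n}" and \<beta>: "\<beta> \<in> tables i k" "l \<le> k"
    and meas: "x t \<in> borel_measurable N" "\<theta> t i \<in> borel_measurable N"
      "c t i \<in> borel_measurable N" "cs t \<in> borel_measurable N"
  shows "local_path t i \<beta> l \<in> borel_measurable N"
  using \<beta>(2)
proof (induction l)
  case 0
  then show ?case using meas by (simp add: local_path.simps(1)[abs_def])
next
  case (Suc l)
  then have [measurable]: "local_path t i \<beta> l \<in> borel_measurable N"
    "grad_batch i (\<beta> l) \<in> borel_measurable borel"
    using borel_measurable_grad_batch[OF i tables_subset[OF \<beta>(1)]] by auto
  note [measurable] = meas
  show ?case unfolding step_size_def local_path.simps(2)[abs_def] by measurable
qed

lemma measurable_iterate:
  assumes N: "space N = space M" and i: "i \<in> {1..n}" "l \<le> H i"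
    and B: "\<And>k. k < l \<Longrightarrow> B t i k \<in> measurable N (count_space UNIV)"
    and meas: "x t \<in> borel_measurable N" "\<theta> t i \<in> borel_measurable N"
      "c t i \<in> borel_measurable N" "cs t \<in> borel_measurable N"
  shows "iterate t i l \<in> borel_measurable N"
proof -
  have "(\<lambda>\<omega>. local_path t i (batch_table t i l \<omega>) l \<omega>) \<in> borel_measurable N"
    by (rule measurable_of_batch_table[OF N i B])
      (auto intro: measurable_local_path[OF i(1) _ order_refl meas])
  moreover have "iterate t i l = (\<lambda>\<omega>. local_path t i (batch_table t i l \<omega>) l \<omega>)"
    using iterate_eq_local_path[OF order_refl] by auto
  ultimately show ?thesis by simp
qed

text \<open>The indicator of the event that node \<open>i\<close> is active.\<close>

definition act :: "nat \<Rightarrow> nat \<Rightarrow> 'w \<Rightarrow> real" where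
  "act t i \<omega> = (if i \<in> S t \<omega> then 1 else 0)"

lemma act_measurable [measurable]: "act t i \<in> borel_measurable (past t)"
proof -
  have "(\<lambda>A. if i \<in> A then 1 else 0 :: real) \<in> measurable (count_space UNIV) borel" by simp
  from measurable_compose[OF active_measurable this, of t] show ?thesis
    by (simp add: act_def[abs_def])
qed

lemma control_measurable:
  assumes "i \<in> {1..n}"
  shows "w t i \<in> borel_measurable (past t)" "\<theta> t i \<in> borel_measurable (past t)"
  using controls[of t] assms unfolding predictable_feasible_def by auto

lemma sum_active:
  fixes f :: "nat \<Rightarrow> 'c::real_vector"
  shows "\<omega> \<in> space M \<Longrightarrow> (\<Sum>i\<in>S t \<omega>. f i) = (\<Sum>i\<in>{1..n}. act t i \<omega> *\<^sub>R f i)"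
  using active_nonempty[of \<omega> t]
  by (auto simp: act_def intro!: sum.mono_neutral_cong_left)

lemma state_measurable:
  shows "x t \<in> borel_measurable (past t)" "cs t \<in> borel_measurable (past t)"
    "i \<in> {1..n} \<Longrightarrow> c t i \<in> borel_measurable (past t)"
proof -
  have "x t \<in> borel_measurable (past t) \<and> cs t \<in> borel_measurable (past t) \<and>
    (\<forall>i\<in>{1..n}. c t i \<in> borel_measurable (past t))"
  proof (induction t)
    case 0
    have x: "x 0 \<in> borel_measurable (past 0)"
      by (intro measurableI) (auto simp: sets_past_field intro!: sigma_sets.Basic)
    have c: "c 0 i \<in> borel_measurable (past 0)" if "i \<in> {1..n}" for i
      using that by (intro measurableI) (auto simp: sets_past_field intro!: sigma_sets.Basic)
    have "(\<lambda>\<omega>. (1 / real n) *\<^sub>R (\<Sum>i\<in>{1..n}. c 0 i \<omega>)) \<in> borel_measurable (past 0)"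
      using c by measurable
    then have "cs 0 \<in> borel_measurable (past 0)"
      by (subst measurable_cong[where g = "\<lambda>\<omega>. (1 / real n) *\<^sub>R (\<Sum>i\<in>{1..n}. c 0 i \<omega>)"])
        (auto simp: server_control_init)
    with x c show ?case by auto
  next
    case (Suc t)
    let ?N = "past (Suc t)"
    have up: "f \<in> borel_measurable ?N" if "f \<in> borel_measurable (past t)"
      for f :: "'w \<Rightarrow> 'c::topological_space"
      using measurable_past_mono[OF that] by simp
    have [measurable]: "x t \<in> borel_measurable ?N" "cs t \<in> borel_measurable ?N"
      "\<And>i. i \<in> {1..n} \<Longrightarrow> c t i \<in> borel_measurable ?N"
      "\<And>i. act t i \<in> borel_measurable ?N"
      "\<And>i. i \<in> {1..n} \<Longrightarrow> w t i \<in> borel_measurable ?N"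
      "\<And>i. i \<in> {1..n} \<Longrightarrow> \<theta> t i \<in> borel_measurable ?N"
      using Suc.IH control_measurable by (auto intro!: up)
    have it [measurable]: "iterate t i (H i) \<in> borel_measurable ?N" if "i \<in> {1..n}" for i
      using that by (intro measurable_iterate) (auto intro: batch_measurable_past)
    let ?x = "\<lambda>\<omega>. x t \<omega> + (\<Sum>i\<in>{1..n}. act t i \<omega> *\<^sub>R w t i \<omega> *\<^sub>R (iterate t i (H i) \<omega> - x t \<omega>))"
    have x: "x (Suc t) \<omega> = ?x \<omega>" if "\<omega> \<in> space M" for \<omega>
      using that active_nonempty[OF that, of t]
      by (auto simp: server_step sum_active act_def iterate_eq_y intro!: sum.cong)
    have "?x \<in> borel_measurable ?N" by measurable
    then have xm: "x (Suc t) \<in> borel_measurable ?N"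
      by (subst measurable_cong[where g = ?x]) (auto simp: x)
    let ?c = "\<lambda>i \<omega>. c t i \<omega> + act t i \<omega> *\<^sub>R (- cs t \<omega> +
           (1 / (real (H i) * step_size L (H i) (\<theta> t i \<omega>))) *\<^sub>R (x t \<omega> - iterate t i (H i) \<omega>))"
    have c: "c (Suc t) i \<omega> = ?c i \<omega>" if "\<omega> \<in> space M" "i \<in> {1..n}" for i \<omega>
      using that
      by (cases "i \<in> S t \<omega>")
        (auto simp: act_def local_control_active local_control_inactive iterate_eq_y)
    have "?c i \<in> borel_measurable ?N" if "i \<in> {1..n}" for i
      unfolding step_size_def using that by measurable
    then have cm [measurable]: "c (Suc t) i \<in> borel_measurable ?N" if "i \<in> {1..n}" for i
      using that by (subst measurable_cong[where g = "?c i"]) (auto simp: c)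
    let ?cs = "\<lambda>\<omega>. cs t \<omega> + (1 / real n) *\<^sub>R (\<Sum>i\<in>{1..n}. act t i \<omega> *\<^sub>R (c (Suc t) i \<omega> - c t i \<omega>))"
    have "?cs \<in> borel_measurable ?N" by measurable
    then have "cs (Suc t) \<in> borel_measurable ?N"
      by (subst measurable_cong[where g = ?cs]) (auto simp: server_control_step sum_active)
    with xm cm show ?case by auto
  qed
  then show "x t \<in> borel_measurable (past t)" "cs t \<in> borel_measurable (past t)"
    "i \<in> {1..n} \<Longrightarrow> c t i \<in> borel_measurable (past t)" by auto
qed

text \<open>The update of the server control preserves that it is the mean of the local controls, because
  inactive nodes keep theirs.\<close>

lemma server_control_eq_mean:
  assumes "\<omega> \<in> space M"
  shows "cs t \<omega> = (1 / real n) *\<^sub>R (\<Sum>i\<in>{1..n}. c t i \<omega>)"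
proof (induction t)
  case 0
  then show ?case using server_control_init[OF assms] by simp
next
  case (Suc t)
  have "(\<Sum>i\<in>S t \<omega>. c (Suc t) i \<omega> - c t i \<omega>) = (\<Sum>i\<in>{1..n}. c (Suc t) i \<omega> - c t i \<omega>)"
    using active_nonempty[OF assms, of t] local_control_inactive[OF assms]
    by (intro sum.mono_neutral_left) auto
  then show ?case
    using Suc server_control_step[OF assms, of t]
    by (simp add: sum_subtractf scaleR_diff_right)
qed

lemma iterate_measurable_loc:
  assumes "i \<in> {1..n}" "l \<le> H i"
  shows "iterate t i l \<in> borel_measurable (loc t i l)"
  using assms
  by (intro measurable_iterate batch_measurable_loc measurable_past_loc state_measurable
      control_measurable) auto

end

section \<open>Gradient noise and the noise-free local path\<close>

context hew_local_sgd
begin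

text \<open>A bound on all component gradients in the ball around the minimizer.\<close>

definition grad_bound :: real where
  "grad_bound = L * R + (\<Sum>i\<in>{1..n}. \<Sum>j\<in>{1..m i}. norm (gradient (\<phi> i j) xstar))"

lemma grad_bound_nonneg: "0 \<le> grad_bound"
  unfolding grad_bound_def using L_pos R_pos by (intro add_nonneg_nonneg sum_nonneg) auto

lemma norm_gradient_component:
  assumes "i \<in> {1..n}" "j \<in> {1..m i}" "z \<in> cball xstar R"
  shows "norm (gradient (\<phi> i j) z) \<le> grad_bound"
proof -
  have "norm (gradient (\<phi> i j) z) \<le> norm (gradient (\<phi> i j) z - gradient (\<phi> i j) xstar)
      + norm (gradient (\<phi> i j) xstar)"
    using norm_triangle_sub by (metis add.commute)
  also have "norm (gradient (\<phi> i j) z - gradient (\<phi> i j) xstar) \<le> L * norm (z - xstar)"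
    by (rule L_smoothD(2)[OF component_smooth[OF assms(1,2)]])
  also have "L * norm (z - xstar) \<le> L * R"
    using assms(3) L_pos by (intro mult_left_mono) (auto simp: dist_norm norm_minus_commute)
  also have "norm (gradient (\<phi> i j) xstar) \<le> (\<Sum>j\<in>{1..m i}. norm (gradient (\<phi> i j) xstar))"
    using assms(2) by (intro member_le_sum) auto
  also have "\<dots> \<le> (\<Sum>i\<in>{1..n}. \<Sum>j\<in>{1..m i}. norm (gradient (\<phi> i j) xstar))"
    using assms(1) by (intro member_le_sum sum_nonneg) auto
  finally show ?thesis by (simp add: grad_bound_def)
qed

lemma norm_mean_le:
  fixes f :: "'i \<Rightarrow> 'c::real_normed_vector"
  assumes "\<And>i. i \<in> I \<Longrightarrow> norm (f i) \<le> K" "card I = k" "0 < k"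
  shows "norm ((1 / real k) *\<^sub>R (\<Sum>i\<in>I. f i)) \<le> K"
proof -
  have "norm (\<Sum>i\<in>I. f i) \<le> real k * K" using sum_norm_bound[of I f K, OF assms(1)] assms(2) by simp
  then show ?thesis using assms(3) by (simp add: field_simps)
qed

lemma norm_grad_node:
  assumes "i \<in> {1..n}" "z \<in> cball xstar R"
  shows "norm (grad_node i z) \<le> grad_bound"
  unfolding gradient_node[OF assms(1)]
  using m_pos[OF assms(1)] norm_gradient_component[OF assms(1) _ assms(2)]
  by (intro norm_mean_le) auto

lemma norm_grad_glob: "z \<in> cball xstar R \<Longrightarrow> norm (grad_glob z) \<le> grad_bound"
  unfolding gradient_global using n_pos norm_grad_node by (intro norm_mean_le) auto

lemma norm_grad_batch:
  assumes "i \<in> {1..n}" "z \<in> cball xstar R" "\<beta> \<subseteq> {1..m i}" "card \<beta> = b i"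
  shows "norm (grad_batch i \<beta> z) \<le> grad_bound"
  unfolding minibatch_grad_def
  using b_pos[OF assms(1)] norm_gradient_component[OF assms(1) _ assms(2)] assms(3,4)
  by (intro norm_mean_le) auto

abbreviation eta :: "nat \<Rightarrow> nat \<Rightarrow> 'w \<Rightarrow> real" where
  "eta t i \<omega> \<equiv> step_size L (H i) (\<theta> t i \<omega>)"

lemma active_in: "\<omega> \<in> space M \<Longrightarrow> i \<in> S t \<omega> \<Longrightarrow> i \<in> {1..n}"
  using active_nonempty[of \<omega> t] by (auto simp: subset_iff)

lemma theta_range:
  assumes "\<omega> \<in> space M" "i \<in> S t \<omega>"
  shows "\<theta>lo \<le> \<theta> t i \<omega>" "0 < \<theta> t i \<omega>" "\<theta> t i \<omega> \<le> 1"
proof -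
  have "\<theta> t i \<omega> \<in> {\<theta>lo..\<theta>hi}"
    using controls[of t] assms unfolding predictable_feasible_def feasible_def by blast
  with theta_bounds show "\<theta>lo \<le> \<theta> t i \<omega>" "0 < \<theta> t i \<omega>" "\<theta> t i \<omega> \<le> 1" by auto
qed

lemma eta_range:
  assumes "\<omega> \<in> space M" "i \<in> S t \<omega>"
  shows "0 < eta t i \<omega>" "eta t i \<omega> \<le> 1 / L" "\<theta>lo / (L * real (H i)) \<le> eta t i \<omega>"
proof -
  have i: "i \<in> {1..n}" by (rule active_in[OF assms])
  have H: "1 \<le> real (H i)" using H_pos[OF i] by simp
  note th = theta_range[OF assms]
  show "0 < eta t i \<omega>" using th H L_pos by (simp add: step_size_def)
  have "\<theta> t i \<omega> \<le> real (H i)" using th H by linarith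
  then show "eta t i \<omega> \<le> 1 / L" using H L_pos by (simp add: step_size_def field_simps)
  show "\<theta>lo / (L * real (H i)) \<le> eta t i \<omega>"
    using th H L_pos by (auto simp: step_size_def intro!: divide_right_mono)
qed

lemma good_event:
  "AE \<omega> in M. x t \<omega> \<in> cball xstar R \<and> (\<forall>i\<in>S t \<omega>. \<forall>l\<le>H i. iterate t i l \<omega> \<in> cball xstar R)"
  using iterates_in_ball AE_space
proof eventually_elim
  case (elim \<omega>)
  then show ?case using iterate_eq_y[of \<omega> _ t] by fastforce
qed

text \<open>The error of the stochastic gradient at local step \<open>l\<close>, as a function of the sequence \<open>\<beta>\<close>
  of minibatches; it is set to zero for inactive nodes.\<close>

definition noise_of :: "nat \<Rightarrow> nat \<Rightarrow> nat \<Rightarrow> (nat \<Rightarrow> nat set) \<Rightarrow> 'w \<Rightarrow> real ^ 'd" where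
  "noise_of t i l \<beta> \<omega> = act t i \<omega> *\<^sub>R
     (grad_batch i (\<beta> l) (local_path t i \<beta> l \<omega>) - grad_node i (local_path t i \<beta> l \<omega>))"

text \<open>The error of the stochastic gradient in the run.\<close>

definition noise :: "nat \<Rightarrow> nat \<Rightarrow> nat \<Rightarrow> 'w \<Rightarrow> real ^ 'd" where
  "noise t i l \<omega> = act t i \<omega> *\<^sub>R
     (grad_batch i (B t i l \<omega>) (iterate t i l \<omega>) - grad_node i (iterate t i l \<omega>))"

lemma noise_eq_noise_of:
  "l < k \<Longrightarrow> noise t i l \<omega> = noise_of t i l (batch_table t i k \<omega>) \<omega>"
  unfolding noise_def noise_of_def iterate_eq_local_path[OF less_imp_le]
  by (simp add: batch_table_def)

lemma noise_of_measurable: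
  assumes "i \<in> {1..n}" "\<beta> \<in> tables i k" "l < k"
  shows "noise_of t i l \<beta> \<in> borel_measurable (past t)"
proof -
  have [measurable]: "local_path t i \<beta> l \<in> borel_measurable (past t)"
    using assms
    by (intro measurable_local_path[where k = k] state_measurable control_measurable) auto
  have [measurable]: "grad_batch i (\<beta> l) \<in> borel_measurable borel"
    using assms borel_measurable_grad_batch tables_subset by blast
  show ?thesis unfolding noise_of_def using assms(1) by measurable
qed

lemma noise_measurable:
  assumes "i \<in> {1..n}" "l < k" "k \<le> H i"
  shows "noise t i l \<in> borel_measurable (loc t i k)"
proof -
  have "(\<lambda>\<omega>. noise_of t i l (batch_table t i k \<omega>) \<omega>) \<in> borel_measurable (loc t i k)"
    by (rule measurable_of_batch_table[where f = "noise_of t i l" and l = k])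
      (use assms in \<open>auto intro: batch_measurable_loc
        measurable_past_loc[OF noise_of_measurable[OF assms(1) _ assms(2)]]\<close>)
  then show ?thesis unfolding noise_eq_noise_of[OF assms(2), symmetric] .
qed

lemma noise_measurable_M:
  assumes "i \<in> {1..n}" "l < H i"
  shows "noise t i l \<in> borel_measurable M"
  using measurable_loc_M[OF noise_measurable[OF assms order_refl]] assms by auto

lemma act_measurable_M [measurable]: "act t i \<in> borel_measurable M"
  by (rule measurable_past_M) (rule act_measurable)

lemma ess_bdd_act: "ess_bdd M (act t i)"
  by (rule ess_bddI[where K = 1]) (auto simp: act_def)

lemma ess_bdd_noise:
  assumes "i \<in> {1..n}" "l < H i"
  shows "ess_bdd M (noise t i l)"
proof (rule ess_bddI[OF noise_measurable_M[OF assms]])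
  show "AE \<omega> in M. norm (noise t i l \<omega>) \<le> grad_bound + grad_bound"
    using good_event[of t] AE_space
  proof eventually_elim
    case (elim \<omega>)
    show ?case
    proof (cases "i \<in> S t \<omega>")
      case True
      then have ball: "iterate t i l \<omega> \<in> cball xstar R"
        using elim assms(2) by auto
      have "norm (grad_batch i (B t i l \<omega>) (iterate t i l \<omega>)) \<le> grad_bound"
        using batch_active[OF elim(2) True assms(2)] by (intro norm_grad_batch assms(1) ball) auto
      then have "norm (grad_batch i (B t i l \<omega>) (iterate t i l \<omega>) - grad_node i (iterate t i l \<omega>))
          \<le> grad_bound + grad_bound"
        by (intro norm_triangle_le_diff add_mono norm_grad_node assms(1) ball)
      then show ?thesis using True by (simp add: noise_def act_def)
    qed (use grad_bound_nonneg in \<open>simp add: noise_def act_def\<close>)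
  qed
qed

text \<open>The direction of the first noise-free local step.\<close>

definition direction :: "nat \<Rightarrow> nat \<Rightarrow> 'w \<Rightarrow> real ^ 'd" where
  "direction t i \<omega> = act t i \<omega> *\<^sub>R (grad_node i (x t \<omega>) - c t i \<omega> + cs t \<omega>)"

lemma direction_measurable [measurable]:
  assumes "i \<in> {1..n}" shows "direction t i \<in> borel_measurable (past t)"
proof -
  note [measurable] = state_measurable(1,2)[of t] state_measurable(3)[OF assms, of t]
    borel_measurable_grad_node[OF assms]
  show ?thesis unfolding direction_def by measurable
qed

text \<open>Controls need not be bounded, but the first local step of an active node stays in the ball,
  and this bounds the control difference that it uses.\<close>

lemma ess_bdd_direction:
  assumes i: "i \<in> {1..n}"
  shows "ess_bdd M (direction t i)"
proof (rule ess_bddI)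
  show "direction t i \<in> borel_measurable M"
    by (rule measurable_past_M[OF direction_measurable[OF i]])
  let ?K = "grad_bound + (2 * R * (L * real (H i) / \<theta>lo) + grad_bound)"
  show "AE \<omega> in M. norm (direction t i \<omega>) \<le> ?K"
    using good_event[of t] AE_space
  proof eventually_elim
    case (elim \<omega>)
    show ?case
    proof (cases "i \<in> S t \<omega>")
      case True
      have H: "0 < H i" using H_pos[OF i] by simp
      note eta = eta_range[OF elim(2) True]
      let ?g = "grad_batch i (B t i 0 \<omega>) (x t \<omega>)"
      have "x t \<omega> - iterate t i (Suc 0) \<omega> = eta t i \<omega> *\<^sub>R (?g - c t i \<omega> + cs t \<omega>)"
        by (simp add: iterate_Suc)
      then have eq: "cs t \<omega> - c t i \<omega> = (1 / eta t i \<omega>) *\<^sub>R (x t \<omega> - iterate t i (Suc 0) \<omega>) - ?g"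
        using eta(1) by simp
      have "dist xstar (x t \<omega>) \<le> R" "dist xstar (iterate t i (Suc 0) \<omega>) \<le> R"
        using elim(1) True H by (auto simp: Suc_le_eq)
      then have "norm (x t \<omega> - iterate t i (Suc 0) \<omega>) \<le> R + R"
        unfolding dist_norm[symmetric] by (intro dist_triangle_le[of _ xstar]) (simp add: dist_commute)
      moreover have "1 / eta t i \<omega> \<le> L * real (H i) / \<theta>lo"
        using eta(1,3) H L_pos theta_bounds by (simp add: field_simps)
      ultimately have "norm ((1 / eta t i \<omega>) *\<^sub>R (x t \<omega> - iterate t i (Suc 0) \<omega>))
          \<le> (L * real (H i) / \<theta>lo) * (R + R)"
        using eta(1) L_pos theta_bounds by (simp only: norm_scaleR) (intro mult_mono, auto)
      moreover have "norm ?g \<le> grad_bound"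
        using elim(1) batch_active[OF elim(2) True H] by (intro norm_grad_batch i) auto
      ultimately have "norm (cs t \<omega> - c t i \<omega>) \<le> 2 * R * (L * real (H i) / \<theta>lo) + grad_bound"
        unfolding eq by (intro norm_triangle_le_diff) (simp add: algebra_simps)
      moreover have "norm (grad_node i (x t \<omega>)) \<le> grad_bound"
        using elim(1) by (intro norm_grad_node i) auto
      ultimately have "norm (grad_node i (x t \<omega>) + (cs t \<omega> - c t i \<omega>)) \<le> ?K"
        by (intro norm_triangle_mono)
      then show ?thesis using True by (simp add: direction_def act_def algebra_simps)
    next
      case False
      then show ?thesis
        using grad_bound_nonneg R_pos L_pos theta_bounds by (simp add: direction_def act_def)
    qed
  qed
qed

text \<open>The local path that follows the full gradients of the node. It starts at the server iterate
  and is known given the past.\<close>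

primrec mean_path :: "nat \<Rightarrow> nat \<Rightarrow> nat \<Rightarrow> 'w \<Rightarrow> real ^ 'd" where
  "mean_path t i 0 \<omega> = x t \<omega>"
| "mean_path t i (Suc l) \<omega> = mean_path t i l \<omega> -
     eta t i \<omega> *\<^sub>R (grad_node i (mean_path t i l \<omega>) - c t i \<omega> + cs t \<omega>)"

lemma mean_path_measurable [measurable]:
  assumes i: "i \<in> {1..n}" shows "mean_path t i l \<in> borel_measurable (past t)"
proof (induction l)
  case 0
  then show ?case using state_measurable(1) by (simp add: mean_path.simps(1)[abs_def])
next
  case (Suc l)
  note [measurable] = Suc state_measurable(1,2)[of t] state_measurable(3)[OF i, of t]
    control_measurable[OF i, of t] borel_measurable_grad_node[OF i]
  show ?case unfolding mean_path.simps(2)[abs_def] step_size_def by measurable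
qed

lemma drift_recursion_step:
  fixes N \<eta> d q :: real
  assumes "N \<le> real l * q ^ l * (\<eta> * d)" "q = 1 + \<eta> * L" "0 \<le> \<eta>" "0 \<le> d"
  shows "N + \<eta> * (L * N + d) \<le> real (Suc l) * q ^ Suc l * (\<eta> * d)"
proof -
  have q1: "1 \<le> q" using assms L_pos by simp
  have "N + \<eta> * (L * N + d) = q * N + 1 * (\<eta> * d)"
    unfolding assms(2) by (simp add: algebra_simps)
  also have "\<dots> \<le> q * (real l * q ^ l * (\<eta> * d)) + q ^ Suc l * (\<eta> * d)"
    using q1 assms(1,3,4)
    by (intro add_mono mult_left_mono mult_right_mono one_le_power mult_nonneg_nonneg) auto
  also have "\<dots> = real (Suc l) * q ^ Suc l * (\<eta> * d)" by (simp add: algebra_simps)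
  finally show ?thesis .
qed

lemma mean_path_drift:
  assumes \<omega>: "\<omega> \<in> space M" "i \<in> S t \<omega>"
  shows "norm (mean_path t i l \<omega> - x t \<omega>)
    \<le> real l * (1 + \<theta> t i \<omega> / real (H i)) ^ l * (eta t i \<omega> * norm (direction t i \<omega>))"
proof (induction l)
  case (Suc l)
  let ?z = "mean_path t i l \<omega>"
  define q where "q = 1 + \<theta> t i \<omega> / real (H i)"
  have i: "i \<in> {1..n}" by (rule active_in[OF \<omega>])
  note eta = eta_range[OF \<omega>]
  have q: "q = 1 + eta t i \<omega> * L" unfolding q_def step_size_def using L_pos by simp
  have eq: "mean_path t i (Suc l) \<omega> - x t \<omega> =
    (?z - x t \<omega>) - eta t i \<omega> *\<^sub>R ((grad_node i ?z - grad_node i (x t \<omega>)) + direction t i \<omega>)"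
    using \<omega> by (simp add: direction_def act_def algebra_simps)
  have "norm (mean_path t i (Suc l) \<omega> - x t \<omega>) \<le> norm (?z - x t \<omega>) +
      eta t i \<omega> * (L * norm (?z - x t \<omega>) + norm (direction t i \<omega>))"
  proof -
    have "norm ((grad_node i ?z - grad_node i (x t \<omega>)) + direction t i \<omega>)
        \<le> L * norm (?z - x t \<omega>) + norm (direction t i \<omega>)"
      by (intro norm_triangle_mono L_smoothD(2)[OF L_smooth_node[OF i]] order_refl)
    then show ?thesis
      using eta(1) unfolding eq
      by (intro order_trans[OF norm_triangle_ineq4] add_left_mono) simp
  qed
  also have "\<dots> \<le> real (Suc l) * q ^ Suc l * (eta t i \<omega> * norm (direction t i \<omega>))"
    by (rule drift_recursion_step[OF Suc.IH[folded q_def] q less_imp_le[OF eta(1)] norm_ge_zero])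
  finally show ?case unfolding q_def .
qed simp

text \<open>The deviation of the local path from the noise-free one; like all vectors attached to a node below,
  it vanishes when the node is inactive.\<close>

definition dev :: "nat \<Rightarrow> nat \<Rightarrow> nat \<Rightarrow> 'w \<Rightarrow> real ^ 'd" where
  "dev t i l \<omega> = act t i \<omega> *\<^sub>R (iterate t i l \<omega> - mean_path t i l \<omega>)"

lemma dev_measurable:
  assumes "i \<in> {1..n}" "l \<le> H i"
  shows "dev t i l \<in> borel_measurable (loc t i l)"
proof -
  note [measurable] = iterate_measurable_loc[OF assms]
    measurable_past_loc[OF mean_path_measurable[OF assms(1)]] measurable_past_loc[OF act_measurable]
  show ?thesis unfolding dev_def by measurable
qed

lemma iterate_measurable_M:
  "i \<in> {1..n} \<Longrightarrow> l \<le> H i \<Longrightarrow> iterate t i l \<in> borel_measurable M"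
  by (rule measurable_loc_M[OF iterate_measurable_loc])

lemma ess_bdd_iterate:
  assumes "i \<in> {1..n}" "l \<le> H i"
  shows "ess_bdd M (\<lambda>\<omega>. act t i \<omega> *\<^sub>R iterate t i l \<omega>)"
proof (rule ess_bddI)
  note [measurable] = iterate_measurable_M[OF assms]
  show "(\<lambda>\<omega>. act t i \<omega> *\<^sub>R iterate t i l \<omega>) \<in> borel_measurable M" by measurable
  show "AE \<omega> in M. norm (act t i \<omega> *\<^sub>R iterate t i l \<omega>) \<le> norm xstar + R"
    using good_event[of t]
  proof eventually_elim
    case (elim \<omega>)
    show ?case
    proof (cases "i \<in> S t \<omega>")
      case True
      then have "norm (iterate t i l \<omega> - xstar) \<le> R"
        using elim assms by (auto simp: dist_norm norm_minus_commute)
      then show ?thesis using True norm_triangle_sub[of "iterate t i l \<omega>" xstar]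
        by (simp add: act_def)
    qed (use R_pos in \<open>simp add: act_def\<close>)
  qed
qed

lemma ess_bdd_x: "ess_bdd M (x t)"
proof (rule ess_bddI)
  show "x t \<in> borel_measurable M" by (rule measurable_past_M[OF state_measurable(1)])
  show "AE \<omega> in M. norm (x t \<omega>) \<le> norm xstar + R"
    using good_event[of t]
  proof eventually_elim
    case (elim \<omega>)
    then have "norm (x t \<omega> - xstar) \<le> R" by (auto simp: dist_norm norm_minus_commute)
    then show ?case using norm_triangle_sub[of "x t \<omega>" xstar] by simp
  qed
qed

lemma ess_bdd_mean_path:
  assumes i: "i \<in> {1..n}"
  shows "ess_bdd M (\<lambda>\<omega>. act t i \<omega> *\<^sub>R (mean_path t i l \<omega> - x t \<omega>))"
proof (rule ess_bdd_dominated)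
  note [measurable] = measurable_past_M[OF mean_path_measurable[OF i]]
    measurable_past_M[OF state_measurable(1)]
  show "(\<lambda>\<omega>. act t i \<omega> *\<^sub>R (mean_path t i l \<omega> - x t \<omega>)) \<in> borel_measurable M" by measurable
  show "ess_bdd M (\<lambda>\<omega>. (real l * 2 ^ l / L) * norm (direction t i \<omega>))"
    using i by (intro ess_bdd_intros ess_bdd_direction)
  show "AE \<omega> in M. norm (act t i \<omega> *\<^sub>R (mean_path t i l \<omega> - x t \<omega>))
      \<le> norm ((real l * 2 ^ l / L) * norm (direction t i \<omega>))"
    using AE_space
  proof eventually_elim
    case (elim \<omega>)
    show ?case
    proof (cases "i \<in> S t \<omega>")
      case True
      note eta = eta_range[OF elim True]
      have q: "\<theta> t i \<omega> / real (H i) \<le> 1" "0 \<le> \<theta> t i \<omega> / real (H i)"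
        using theta_range[OF elim True] H_pos[OF i] by (auto simp: field_simps)
      have "norm (mean_path t i l \<omega> - x t \<omega>)
          \<le> real l * (1 + \<theta> t i \<omega> / real (H i)) ^ l * (eta t i \<omega> * norm (direction t i \<omega>))"
        by (rule mean_path_drift[OF elim True])
      also have "\<dots> \<le> real l * 2 ^ l * (1 / L * norm (direction t i \<omega>))"
        using eta q L_pos by (intro mult_mono power_mono mult_nonneg_nonneg) auto
      finally show ?thesis using True L_pos by (simp add: act_def)
    qed (simp add: act_def)
  qed
qed

lemma ess_bdd_dev:
  assumes "i \<in> {1..n}" "l \<le> H i"
  shows "ess_bdd M (dev t i l)"
proof -
  have "ess_bdd M (\<lambda>\<omega>. act t i \<omega> *\<^sub>R iterate t i l \<omega> - act t i \<omega> *\<^sub>R x t \<omega>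
      - act t i \<omega> *\<^sub>R (mean_path t i l \<omega> - x t \<omega>))"
    by (rule ess_bdd_diff[OF ess_bdd_diff[OF ess_bdd_iterate[OF assms]
        ess_bdd_scaleR[OF ess_bdd_act ess_bdd_x]] ess_bdd_mean_path[OF assms(1)]])
  then show ?thesis by (simp add: dev_def[abs_def] scaleR_diff_right)
qed

lemma dev_Suc:
  "dev t i (Suc l) \<omega> =
     (dev t i l \<omega> - (act t i \<omega> * eta t i \<omega>) *\<^sub>R
        (grad_node i (iterate t i l \<omega>) - grad_node i (mean_path t i l \<omega>)))
     - eta t i \<omega> *\<^sub>R noise t i l \<omega>"
proof -
  have alg: "a *\<^sub>R ((p - e *\<^sub>R (g - u + v)) - (z - e *\<^sub>R (h - u + v)))
      = (a *\<^sub>R (p - z) - (a * e) *\<^sub>R (k - h)) - e *\<^sub>R a *\<^sub>R (g - k)"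
    for a e :: real and p g u v z h k :: "real ^ 'd"
    by (simp add: algebra_simps)
  show ?thesis
    unfolding dev_def noise_def iterate_Suc mean_path.simps(2) by (rule alg)
qed

end

section \<open>Orthogonality of the gradient noise\<close>

context hew_local_sgd
begin

lemma subalgebra_past_prob: "finite_measure_subalgebra M (past t)"
  by unfold_locales (rule subalgebra_past)

lemma subalgebra_loc_prob:
  "i \<in> {1..n} \<Longrightarrow> l \<le> H i \<Longrightarrow> finite_measure_subalgebra M (loc t i l)"
  by unfold_locales (rule subalgebra_loc)

lemma ess_bdd_grad_iterate:
  assumes i: "i \<in> {1..n}" "l \<le> H i"
  shows "ess_bdd M (\<lambda>\<omega>. act t i \<omega> *\<^sub>R grad_node i (iterate t i l \<omega>))"
proof (rule ess_bddI)
  note [measurable] = iterate_measurable_M[OF i, of t] borel_measurable_grad_node[OF i(1)]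
  show "(\<lambda>\<omega>. act t i \<omega> *\<^sub>R grad_node i (iterate t i l \<omega>)) \<in> borel_measurable M" by measurable
  show "AE \<omega> in M. norm (act t i \<omega> *\<^sub>R grad_node i (iterate t i l \<omega>)) \<le> grad_bound"
    using good_event[of t]
  proof eventually_elim
    case (elim \<omega>)
    then show ?case
      using i grad_bound_nonneg norm_grad_node[OF i(1), of "iterate t i l \<omega>"]
      by (cases "i \<in> S t \<omega>") (simp_all add: act_def)
  qed
qed

lemma noise_cond_mean:
  assumes i: "i \<in> {1..n}" and l: "l < H i"
  shows "AE \<omega> in M. real_cond_exp M (loc t i l) (\<lambda>\<omega>. noise t i l \<omega> $ k) \<omega> = 0"
proof -
  interpret G: finite_measure_subalgebra M "loc t i l"
    using i l by (intro subalgebra_loc_prob) auto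
  let ?E = "real_cond_exp M (loc t i l)"
  let ?N = "\<lambda>\<omega>. act t i \<omega> *\<^sub>R grad_node i (iterate t i l \<omega>)"
  let ?g = "\<lambda>\<omega>. noise t i l \<omega> + ?N \<omega>"
  let ?X = "\<lambda>\<omega>. if i \<in> S t \<omega> then grad_batch i (B t i l \<omega>) (y t i l \<omega>) else 0"
  have N_bdd: "ess_bdd M ?N" using i l by (intro ess_bdd_grad_iterate) auto
  have g_bdd: "ess_bdd M ?g" by (rule ess_bdd_add[OF ess_bdd_noise[OF i l] N_bdd])
  have int: "integrable M (\<lambda>\<omega>. ?N \<omega> $ k)" "integrable M (\<lambda>\<omega>. ?g \<omega> $ k)"
    by (rule integrable_ess_bdd[OF ess_bdd_component[OF N_bdd]],
        rule integrable_ess_bdd[OF ess_bdd_component[OF g_bdd]])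
  note [measurable] = iterate_measurable_loc[OF i less_imp_le[OF l], of t]
    borel_measurable_grad_node[OF i] measurable_past_loc[OF act_measurable]
  have N_meas: "(\<lambda>\<omega>. ?N \<omega> $ k) \<in> borel_measurable (loc t i l)"
    by (rule measurable_compose[OF _ borel_measurable_nth]) measurable
  have gX: "?X \<omega> = ?g \<omega>" if "\<omega> \<in> space M" for \<omega>
    using that l by (auto simp: noise_def act_def iterate_eq_y)
  have g_meas: "?g \<in> borel_measurable M" by (rule ess_bdd_measurable[OF g_bdd])
  then have X_meas: "?X \<in> borel_measurable M" using measurable_cong[of M ?X ?g borel] gX by simp
  have gk [measurable]: "(\<lambda>\<omega>. ?g \<omega> $ k) \<in> borel_measurable M"
    "(\<lambda>\<omega>. ?X \<omega> $ k) \<in> borel_measurable M"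
    by (rule measurable_compose[OF g_meas borel_measurable_nth], rule measurable_compose[OF X_meas borel_measurable_nth])
  have 1: "AE \<omega> in M. ?E (\<lambda>\<omega>. ?X \<omega> $ k) \<omega>
      = ?E (\<lambda>\<omega>. ?g \<omega> $ k) \<omega>"
    by (rule G.real_cond_exp_cong[OF _ gk(2,1)]) (use gX in auto)
  have 2: "AE \<omega> in M. i \<in> S t \<omega> \<longrightarrow>
      ?E (\<lambda>\<omega>. ?X \<omega> $ k) \<omega> = grad_node i (y t i l \<omega>) $ k"
    using batch_unbiased[OF i l, of t]
    by eventually_elim (auto simp: vec_cond_exp_def vec_eq_iff)
  \<comment> \<open>The activity indicator belongs to the conditioning field and may be pulled out; this settles
    inactive nodes, about which the assumed unbiasedness says nothing.\<close>
  have g_act: "(\<lambda>\<omega>. act t i \<omega> * (?g \<omega> $ k)) = (\<lambda>\<omega>. ?g \<omega> $ k)"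
    by (auto simp: noise_def act_def)
  have 3: "AE \<omega> in M. ?E (\<lambda>\<omega>. act t i \<omega> * (?g \<omega> $ k)) \<omega>
      = act t i \<omega> * ?E (\<lambda>\<omega>. ?g \<omega> $ k) \<omega>"
    by (rule G.real_cond_exp_mult[OF measurable_past_loc[OF act_measurable] gk(1)])
      (unfold g_act, rule int(2))
  have 4: "AE \<omega> in M. ?E (\<lambda>\<omega>. ?g \<omega> $ k - ?N \<omega> $ k) \<omega>
      = ?E (\<lambda>\<omega>. ?g \<omega> $ k) \<omega> - ?E (\<lambda>\<omega>. ?N \<omega> $ k) \<omega>"
    by (rule G.real_cond_exp_diff[OF int(2,1)])
  have 5: "AE \<omega> in M. ?E (\<lambda>\<omega>. ?N \<omega> $ k) \<omega> = ?N \<omega> $ k"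
    by (rule G.real_cond_exp_F_meas[OF int(1) N_meas])
  have noise: "(\<lambda>\<omega>. ?g \<omega> $ k - ?N \<omega> $ k) = (\<lambda>\<omega>. noise t i l \<omega> $ k)" by auto
  show ?thesis
    using 1 2 3[unfolded g_act] 4[unfolded noise] 5 AE_space
  proof eventually_elim
    case (elim \<omega>)
    then show ?case using l by (cases "i \<in> S t \<omega>") (auto simp: act_def iterate_eq_y)
  qed
qed

lemma integral_inner_vec:
  fixes X Y :: "'w \<Rightarrow> real ^ 'd"
  assumes "ess_bdd M X" "ess_bdd M Y"
  shows "(\<integral>\<omega>. inner (X \<omega>) (Y \<omega>) \<partial>M) = (\<Sum>k\<in>UNIV. \<integral>\<omega>. X \<omega> $ k * Y \<omega> $ k \<partial>M)"
  unfolding inner_vec_def inner_real_def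
  by (intro Bochner_Integration.integral_sum integrable_ess_bdd ess_bdd_mult ess_bdd_component assms)

lemma noise_orthogonal:
  assumes i: "i \<in> {1..n}" and l: "l < H i"
    and V: "V \<in> borel_measurable (loc t i l)" "ess_bdd M V"
  shows "(\<integral>\<omega>. inner (noise t i l \<omega>) (V \<omega>) \<partial>M) = 0"
proof -
  interpret G: finite_measure_subalgebra M "loc t i l"
    using i l by (intro subalgebra_loc_prob) auto
  have "(\<integral>\<omega>. noise t i l \<omega> $ k * V \<omega> $ k \<partial>M) = 0" for k
  proof -
    have int: "integrable M (\<lambda>\<omega>. V \<omega> $ k * noise t i l \<omega> $ k)"
      by (intro integrable_ess_bdd ess_bdd_mult ess_bdd_component V(2) ess_bdd_noise i l)
    have "(\<integral>\<omega>. V \<omega> $ k * noise t i l \<omega> $ k \<partial>M)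
        = (\<integral>\<omega>. V \<omega> $ k * real_cond_exp M (loc t i l) (\<lambda>\<omega>. noise t i l \<omega> $ k) \<omega> \<partial>M)"
      by (rule G.real_cond_exp_intg(2)[OF int measurable_compose[OF V(1) borel_measurable_nth]
          measurable_compose[OF noise_measurable_M[OF i l] borel_measurable_nth], symmetric])
    also have "\<dots> = 0"
      by (rule integral_eq_zero_AE) (use noise_cond_mean[OF i l, of t k] in \<open>eventually_elim; simp\<close>)
    finally show ?thesis by (simp add: mult.commute)
  qed
  then show ?thesis
    by (subst integral_inner_vec[OF ess_bdd_noise[OF i l] V(2)]) simp
qed

text \<open>The bound on the conditional second moment of the noise at a single local step.\<close>

abbreviation noise_level :: "nat \<Rightarrow> real" where
  "noise_level i \<equiv> variance_level m \<phi> xstar R i / real (b i)"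

lemma noise_second_moment:
  assumes i: "i \<in> {1..n}" and l: "l < H i"
    and Z: "Z \<in> borel_measurable (loc t i l)" "ess_bdd M Z" "\<And>\<omega>. \<omega> \<in> space M \<Longrightarrow> 0 \<le> Z \<omega>"
  shows "(\<integral>\<omega>. Z \<omega> * (norm (noise t i l \<omega>))\<^sup>2 \<partial>M) \<le> (\<integral>\<omega>. Z \<omega> * act t i \<omega> * noise_level i \<partial>M)"
proof -
  interpret G: finite_measure_subalgebra M "loc t i l"
    using i l by (intro subalgebra_loc_prob) auto
  let ?N2 = "\<lambda>\<omega>. (norm (noise t i l \<omega>))\<^sup>2"
  let ?E = "real_cond_exp M (loc t i l) ?N2"
  let ?X = "\<lambda>\<omega>. if i \<in> S t \<omega> then (norm (grad_batch i (B t i l \<omega>) (y t i l \<omega>)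
                        - grad_node i (y t i l \<omega>)))\<^sup>2 else 0"
  have bdd: "ess_bdd M ?N2"
    by (intro ess_bdd_power2 ess_bdd_norm ess_bdd_noise i l)
  have noise_meas: "?N2 \<in> borel_measurable M"
    by (rule ess_bdd_measurable[OF bdd])
  have X: "?X \<omega> = ?N2 \<omega>" if "\<omega> \<in> space M" for \<omega>
    using that l by (auto simp: noise_def act_def iterate_eq_y)
  then have "?X \<in> borel_measurable M"
    using noise_meas measurable_cong[of M ?X ?N2 borel] by simp
  then have eq: "AE \<omega> in M. real_cond_exp M (loc t i l) ?X \<omega> = ?E \<omega>"
    using X noise_meas by (intro G.real_cond_exp_cong) auto
  have Zact: "(\<lambda>\<omega>. Z \<omega> * act t i \<omega>) \<in> borel_measurable (loc t i l)"
    by (intro borel_measurable_times Z(1) measurable_past_loc act_measurable)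
  have int: "integrable M (\<lambda>\<omega>. (Z \<omega> * act t i \<omega>) * ?N2 \<omega>)"
    by (intro integrable_ess_bdd ess_bdd_mult Z(2) ess_bdd_act bdd)
  have "(\<integral>\<omega>. Z \<omega> * ?N2 \<omega> \<partial>M)
      = (\<integral>\<omega>. (Z \<omega> * act t i \<omega>) * ?N2 \<omega> \<partial>M)"
    by (intro Bochner_Integration.integral_cong) (auto simp: noise_def act_def)
  also have "\<dots> = (\<integral>\<omega>. (Z \<omega> * act t i \<omega>) * ?E \<omega> \<partial>M)"
    by (rule G.real_cond_exp_intg(2)[OF int Zact noise_meas, symmetric])
  also have "\<dots> \<le> (\<integral>\<omega>. (Z \<omega> * act t i \<omega>) * noise_level i \<partial>M)"
  proof (rule integral_mono_AE)
    show "integrable M (\<lambda>\<omega>. (Z \<omega> * act t i \<omega>) * ?E \<omega>)"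
      by (rule G.real_cond_exp_intg(1)[OF int Zact noise_meas])
    show "integrable M (\<lambda>\<omega>. (Z \<omega> * act t i \<omega>) * noise_level i)"
      by (intro integrable_ess_bdd ess_bdd_mult Z(2) ess_bdd_act ess_bdd_const)
    show "AE \<omega> in M. (Z \<omega> * act t i \<omega>) * ?E \<omega> \<le> (Z \<omega> * act t i \<omega>) * noise_level i"
      using eq batch_variance[OF i l, of t] AE_space
    proof eventually_elim
      case (elim \<omega>)
      then show ?case
        using Z(3)[OF elim(3)] mult_left_mono[of "?E \<omega>" "noise_level i" "Z \<omega>"]
        by (cases "i \<in> S t \<omega>") (simp_all add: act_def)
    qed
  qed
  finally show ?thesis .
qed

text \<open>The minibatch of node \<open>i\<close> at local step \<open>l\<close> and the whole minibatch table of another node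
  are conditionally independent given the information of node \<open>i\<close> before that step.\<close>

lemma batch_cond_indep_table:
  assumes i: "i \<in> {1..n}" "l < H i" and j: "j \<in> {1..n}" "j \<noteq> i" and \<beta>: "\<beta> \<in> tables j (H j)"
  shows "AE \<omega> in M. real_cond_exp M (loc t i l) (\<lambda>\<omega>. indicat_real (B t i l -` {\<alpha>} \<inter> space M) \<omega> *
       indicat_real {\<omega> \<in> space M. batch_table t j (H j) \<omega> = \<beta>} \<omega>) \<omega>
     = real_cond_exp M (loc t i l) (indicat_real (B t i l -` {\<alpha>} \<inter> space M)) \<omega>
       * real_cond_exp M (loc t i l) (indicat_real {\<omega> \<in> space M. batch_table t j (H j) \<omega> = \<beta>}) \<omega>"
proof -
  let ?D = "{\<omega> \<in> space M. batch_table t j (H j) \<omega> = \<beta>}" and ?C = "B t i l -` {\<alpha>} \<inter> space M"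
  let ?E = "real_cond_exp M (loc t i l)"
  let ?X = "\<lambda>(j, k). B t j k"
  define A where "A p = (if p = (i, l) then {\<alpha>} else {\<beta> (snd p)})" for p :: "nat \<times> nat"
  let ?J = "{j} \<times> {..<H j}"
  have ci: "AE \<omega> in M. ?E (indicat_real (\<Inter>p\<in>J. ?X p -` A p \<inter> space M)) \<omega> =
           (\<Prod>p\<in>J. ?E (indicat_real (?X p -` A p \<inter> space M)) \<omega>)"
    if "J \<subseteq> (SIGMA j:{1..n}. {..<H j})" "finite J" "J \<noteq> {}" for J
    using batches_cond_indep[OF i, of t] that unfolding cond_indep_vars_def by auto
  have H: "0 < H j" using H_pos[OF j(1)] by simp
  have notin: "(i, l) \<notin> ?J" using j by auto
  have inter: "(\<Inter>p\<in>?J. ?X p -` A p \<inter> space M) = ?D"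
  proof -
    have "(\<Inter>p\<in>?J. ?X p -` A p \<inter> space M) = {\<omega> \<in> space M. \<forall>k\<in>{..<H j}. B t j k \<omega> = \<beta> k}"
      using H j by (auto simp: A_def)
    then show ?thesis by (simp add: batch_table_eq_iff[OF \<beta>])
  qed
  have Ail: "?X (i, l) -` A (i, l) \<inter> space M = ?C" by (simp add: A_def)
  have J: "?J \<noteq> {}" "finite ?J" "?J \<subseteq> (SIGMA j:{1..n}. {..<H j})"
    using H Sigma_mono[of "{j}" "{1..n}" "\<lambda>_. {..<H j}" "\<lambda>j. {..<H j}"] j by blast+
  have e1: "AE \<omega> in M. ?E (indicat_real ?D) \<omega>
      = (\<Prod>p\<in>?J. ?E (indicat_real (?X p -` A p \<inter> space M)) \<omega>)"
    using ci[OF J(3,2,1)] unfolding inter .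
  have "AE \<omega> in M. ?E (indicat_real (\<Inter>p\<in>insert (i, l) ?J. ?X p -` A p \<inter> space M)) \<omega>
      = (\<Prod>p\<in>insert (i, l) ?J. ?E (indicat_real (?X p -` A p \<inter> space M)) \<omega>)"
    by (rule ci) (use i J in auto)
  moreover have "(\<Inter>p\<in>insert (i, l) ?J. ?X p -` A p \<inter> space M) = ?C \<inter> ?D"
    unfolding INT_insert inter Ail ..
  moreover have "(\<Prod>p\<in>insert (i, l) ?J. ?E (indicat_real (?X p -` A p \<inter> space M)) \<omega>)
      = ?E (indicat_real ?C) \<omega> * (\<Prod>p\<in>?J. ?E (indicat_real (?X p -` A p \<inter> space M)) \<omega>)" for \<omega>
    by (subst prod.insert) (use notin Ail in auto)
  ultimately have e2: "AE \<omega> in M. ?E (indicat_real (?C \<inter> ?D)) \<omega>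
      = ?E (indicat_real ?C) \<omega> * (\<Prod>p\<in>?J. ?E (indicat_real (?X p -` A p \<inter> space M)) \<omega>)"
    by simp
  have "indicat_real (?C \<inter> ?D) = (\<lambda>\<omega>. indicat_real ?C \<omega> * indicat_real ?D \<omega>)"
    by (auto simp: indicator_def)
  then have e3: "?E (\<lambda>\<omega>. indicat_real ?C \<omega> * indicat_real ?D \<omega>) = ?E (indicat_real (?C \<inter> ?D))"
    by (rule arg_cong[OF sym])
  show ?thesis using e1 e2 unfolding e3 by eventually_elim simp
qed

text \<open>Fixing the minibatches of another node leaves the conditional mean of the noise at zero: the noise
  is a finite sum of indicators of values of the minibatch with coefficients known before the step, and each
  indicator is conditionally independent of the fixed table.\<close>

lemma noise_cond_mean_given_table:
  assumes i: "i \<in> {1..n}" and l: "l < H i" and j: "j \<in> {1..n}" "j \<noteq> i"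
    and \<beta>: "\<beta> \<in> tables j (H j)"
  shows "AE \<omega> in M. real_cond_exp M (loc t i l)
    (\<lambda>\<omega>. indicat_real {\<omega> \<in> space M. batch_table t j (H j) \<omega> = \<beta>} \<omega> * noise t i l \<omega> $ k) \<omega> = 0"
proof -
  interpret G: finite_measure_subalgebra M "loc t i l"
    using i l by (intro subalgebra_loc_prob) auto
  let ?D = "{\<omega> \<in> space M. batch_table t j (H j) \<omega> = \<beta>}"
  let ?C = "\<lambda>\<alpha>. B t i l -` {\<alpha>} \<inter> space M" and ?P = "Pow {1..m i}"
  let ?ind = "\<lambda>\<alpha>. indicat_real (?C \<alpha>)"
  let ?E = "real_cond_exp M (loc t i l)"
  define \<kappa> where "\<kappa> \<alpha> \<omega> = (if \<alpha> \<in> ?P then (act t i \<omega> *\<^sub>R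
     (grad_batch i \<alpha> (iterate t i l \<omega>) - grad_node i (iterate t i l \<omega>))) $ k else 0)" for \<alpha> \<omega>
  have \<kappa>_meas: "\<kappa> \<alpha> \<in> borel_measurable (loc t i l)" for \<alpha>
  proof (cases "\<alpha> \<in> ?P")
    case True
    note [measurable] = iterate_measurable_loc[OF i less_imp_le[OF l], of t]
      borel_measurable_grad_node[OF i] measurable_past_loc[OF act_measurable]
    have [measurable]: "grad_batch i \<alpha> \<in> borel_measurable borel"
      using borel_measurable_grad_batch[OF i] True by auto
    have "(\<lambda>\<omega>. (act t i \<omega> *\<^sub>R (grad_batch i \<alpha> (iterate t i l \<omega>)
        - grad_node i (iterate t i l \<omega>))) $ k) \<in> borel_measurable (loc t i l)"
      by (rule measurable_compose[OF _ borel_measurable_nth]) measurable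
    then show ?thesis using True by (simp add: \<kappa>_def[abs_def])
  qed (simp add: \<kappa>_def[abs_def])
  have C: "?C \<alpha> \<in> sets M" for \<alpha> using measurable_sets[OF batch_measurable[OF i l]] by simp
  have D: "?D \<in> sets M" by (rule batch_table_event[OF j(1) \<beta>])
  have \<kappa>_noise: "\<kappa> \<alpha> \<omega> * ?ind \<alpha> \<omega> = ?ind \<alpha> \<omega> * noise t i l \<omega> $ k"
    if "\<omega> \<in> space M" for \<alpha> \<omega>
    using batch_subset[OF that i l, of t] by (auto simp: \<kappa>_def noise_def indicator_def)
  have bdd_ind: "ess_bdd M (indicat_real A)" if "A \<in> sets M" for A
    using that by (intro ess_bddI[where K = 1]) (auto simp: indicator_def)
  \<comment> \<open>The coefficient alone need not be bounded, since it evaluates gradients for minibatches that were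
    not drawn; its product with the indicator is dominated by the noise.\<close>
  have bdd: "ess_bdd M (\<lambda>\<omega>. \<kappa> \<alpha> \<omega> * (?ind \<alpha> \<omega> * V \<omega>))" if "ess_bdd M V" for \<alpha> V
  proof (rule ess_bdd_dominated)
    have [measurable]: "\<kappa> \<alpha> \<in> borel_measurable M"
      by (rule measurable_loc_M[OF \<kappa>_meas]) (use i l in auto)
    note [measurable] = ess_bdd_measurable[OF that] C
    show "(\<lambda>\<omega>. \<kappa> \<alpha> \<omega> * (?ind \<alpha> \<omega> * V \<omega>)) \<in> borel_measurable M" by measurable
    show "ess_bdd M (\<lambda>\<omega>. ?ind \<alpha> \<omega> * noise t i l \<omega> $ k * V \<omega>)"
      by (intro ess_bdd_mult ess_bdd_component ess_bdd_noise i l that bdd_ind C)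
    show "AE \<omega> in M. norm (\<kappa> \<alpha> \<omega> * (?ind \<alpha> \<omega> * V \<omega>))
        \<le> norm (?ind \<alpha> \<omega> * noise t i l \<omega> $ k * V \<omega>)"
      using AE_space
    proof eventually_elim
      case (elim \<omega>)
      show ?case unfolding \<kappa>_noise[OF elim, symmetric] by (simp add: mult.assoc)
    qed
  qed
  have decomp: "(\<Sum>\<alpha>\<in>?P. \<kappa> \<alpha> \<omega> * (?ind \<alpha> \<omega> * v)) = v * noise t i l \<omega> $ k"
    if "\<omega> \<in> space M" for \<omega> v
  proof -
    have "(\<Sum>\<alpha>\<in>?P. \<kappa> \<alpha> \<omega> * (?ind \<alpha> \<omega> * v))
        = (\<Sum>\<alpha>\<in>?P. if \<alpha> = B t i l \<omega> then v * noise t i l \<omega> $ k else 0)"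
      using that by (intro sum.cong) (auto simp: \<kappa>_def noise_def indicator_def)
    also have "\<dots> = v * noise t i l \<omega> $ k" using batch_subset[OF that i l, of t] by simp
    finally show ?thesis .
  qed
  have expand: "AE \<omega> in M. ?E (\<lambda>\<omega>. V \<omega> * noise t i l \<omega> $ k) \<omega>
      = (\<Sum>\<alpha>\<in>?P. \<kappa> \<alpha> \<omega> * ?E (\<lambda>\<omega>. ?ind \<alpha> \<omega> * V \<omega>) \<omega>)" if V: "ess_bdd M V" for V
  proof -
    note [measurable] = ess_bdd_measurable[OF V] C noise_measurable_M[OF i l]
      measurable_loc_M[OF \<kappa>_meas i less_imp_le[OF l]]
    have int: "integrable M (\<lambda>\<omega>. \<kappa> \<alpha> \<omega> * (?ind \<alpha> \<omega> * V \<omega>))" for \<alpha>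
      by (rule integrable_ess_bdd[OF bdd[OF V]])
    have "AE \<omega> in M. ?E (\<lambda>\<omega>. \<Sum>\<alpha>\<in>?P. \<kappa> \<alpha> \<omega> * (?ind \<alpha> \<omega> * V \<omega>)) \<omega>
        = ?E (\<lambda>\<omega>. V \<omega> * noise t i l \<omega> $ k) \<omega>"
    proof (rule G.real_cond_exp_cong)
      show "(\<lambda>\<omega>. V \<omega> * noise t i l \<omega> $ k) \<in> borel_measurable M"
        by (intro ess_bdd_measurable ess_bdd_mult ess_bdd_component ess_bdd_noise i l V)
      show "(\<lambda>\<omega>. \<Sum>\<alpha>\<in>?P. \<kappa> \<alpha> \<omega> * (?ind \<alpha> \<omega> * V \<omega>)) \<in> borel_measurable M"
        by (intro borel_measurable_sum borel_measurable_integrable[OF int])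
    qed (use decomp in auto)
    moreover have "AE \<omega> in M. ?E (\<lambda>\<omega>. \<Sum>\<alpha>\<in>?P. \<kappa> \<alpha> \<omega> * (?ind \<alpha> \<omega> * V \<omega>)) \<omega>
        = (\<Sum>\<alpha>\<in>?P. ?E (\<lambda>\<omega>. \<kappa> \<alpha> \<omega> * (?ind \<alpha> \<omega> * V \<omega>)) \<omega>)"
      by (rule G.real_cond_exp_sum[OF int])
    moreover have "AE \<omega> in M. \<forall>\<alpha>\<in>?P. ?E (\<lambda>\<omega>. \<kappa> \<alpha> \<omega> * (?ind \<alpha> \<omega> * V \<omega>)) \<omega>
        = \<kappa> \<alpha> \<omega> * ?E (\<lambda>\<omega>. ?ind \<alpha> \<omega> * V \<omega>) \<omega>"
    proof (rule AE_finite_allI)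
      fix \<alpha>
      have "(\<lambda>\<omega>. ?ind \<alpha> \<omega> * V \<omega>) \<in> borel_measurable M" by measurable
      then show "AE \<omega> in M. ?E (\<lambda>\<omega>. \<kappa> \<alpha> \<omega> * (?ind \<alpha> \<omega> * V \<omega>)) \<omega>
        = \<kappa> \<alpha> \<omega> * ?E (\<lambda>\<omega>. ?ind \<alpha> \<omega> * V \<omega>) \<omega>"
        by (rule G.real_cond_exp_mult[OF \<kappa>_meas _ int])
    qed simp
    ultimately show ?thesis by eventually_elim simp
  qed
  have one: "AE \<omega> in M. ?E (\<lambda>\<omega>. 1 * noise t i l \<omega> $ k) \<omega>
      = (\<Sum>\<alpha>\<in>?P. \<kappa> \<alpha> \<omega> * ?E (\<lambda>\<omega>. ?ind \<alpha> \<omega> * 1) \<omega>)"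
    by (rule expand[OF ess_bdd_const])
  have indep: "AE \<omega> in M. \<forall>\<alpha>\<in>?P. ?E (\<lambda>\<omega>. ?ind \<alpha> \<omega> * indicat_real ?D \<omega>) \<omega>
      = ?E (?ind \<alpha>) \<omega> * ?E (indicat_real ?D) \<omega>"
    by (intro AE_finite_allI batch_cond_indep_table[OF i l j \<beta>]) simp
  show ?thesis
    using expand[OF bdd_ind[OF D]] one indep noise_cond_mean[OF i l, of t k]
  proof eventually_elim
    case (elim \<omega>)
    have "?E (\<lambda>\<omega>. indicat_real ?D \<omega> * noise t i l \<omega> $ k) \<omega>
        = (\<Sum>\<alpha>\<in>?P. \<kappa> \<alpha> \<omega> * (?E (?ind \<alpha>) \<omega> * ?E (indicat_real ?D) \<omega>))"
      unfolding elim(1) using elim(3) by (intro sum.cong) auto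
    also have "\<dots> = (\<Sum>\<alpha>\<in>?P. \<kappa> \<alpha> \<omega> * ?E (?ind \<alpha>) \<omega>) * ?E (indicat_real ?D) \<omega>"
      by (simp add: sum_distrib_right mult.assoc)
    also have "(\<Sum>\<alpha>\<in>?P. \<kappa> \<alpha> \<omega> * ?E (?ind \<alpha>) \<omega>) = 0"
      using elim(2,4) by simp
    finally show ?case by simp
  qed
qed

text \<open>The noise is therefore orthogonal to every function of the past and of the minibatches of
  another node, in particular to the displacement of that node.\<close>

lemma noise_orthogonal_other:
  assumes i: "i \<in> {1..n}" and l: "l < H i" and j: "j \<in> {1..n}" "j \<noteq> i"
    and meas: "\<And>\<beta>. \<beta> \<in> tables j (H j) \<Longrightarrow> \<Psi> \<beta> \<in> borel_measurable (past t)"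
    and bdd: "ess_bdd M (\<lambda>\<omega>. \<Psi> (batch_table t j (H j) \<omega>) \<omega>)"
  shows "(\<integral>\<omega>. inner (noise t i l \<omega>) (\<Psi> (batch_table t j (H j) \<omega>) \<omega>) \<partial>M) = 0"
proof -
  interpret G: finite_measure_subalgebra M "loc t i l"
    using i l by (intro subalgebra_loc_prob) auto
  let ?T = "tables j (H j)" and ?D = "\<lambda>\<beta>. {\<omega> \<in> space M. batch_table t j (H j) \<omega> = \<beta>}"
  let ?\<Psi> = "\<lambda>\<omega>. \<Psi> (batch_table t j (H j) \<omega>) \<omega>"
  have D: "?D \<beta> \<in> sets M" if "\<beta> \<in> ?T" for \<beta> by (rule batch_table_event[OF j(1) that])
  have "(\<integral>\<omega>. noise t i l \<omega> $ k * ?\<Psi> \<omega> $ k \<partial>M) = 0" for k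
  proof -
    let ?f = "\<lambda>\<beta> \<omega>. \<Psi> \<beta> \<omega> $ k * (indicat_real (?D \<beta>) \<omega> * noise t i l \<omega> $ k)"
    have prod: "ess_bdd M (\<lambda>\<omega>. noise t i l \<omega> $ k * ?\<Psi> \<omega> $ k)"
      by (intro ess_bdd_mult ess_bdd_component bdd ess_bdd_noise i l)
    have fm: "(\<lambda>\<omega>. indicat_real (?D \<beta>) \<omega> * noise t i l \<omega> $ k) \<in> borel_measurable M"
      "(\<lambda>\<omega>. \<Psi> \<beta> \<omega> $ k) \<in> borel_measurable (loc t i l)"
      "(\<lambda>\<omega>. \<Psi> \<beta> \<omega> $ k) \<in> borel_measurable M" if "\<beta> \<in> ?T" for \<beta>
      using measurable_compose[OF measurable_past_loc[OF meas[OF that]] borel_measurable_nth]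
        measurable_compose[OF measurable_past_M[OF meas[OF that]] borel_measurable_nth]
        measurable_compose[OF noise_measurable_M[OF i l] borel_measurable_nth] D[OF that] by auto
    have int: "integrable M (?f \<beta>)" if "\<beta> \<in> ?T" for \<beta>
    proof (rule integrable_ess_bdd[OF ess_bdd_dominated[OF _ prod]])
      show "?f \<beta> \<in> borel_measurable M" by (intro borel_measurable_times fm that)
    qed (auto simp: indicator_def abs_mult)
    have zero: "(\<integral>\<omega>. ?f \<beta> \<omega> \<partial>M) = 0" if "\<beta> \<in> ?T" for \<beta>
    proof -
      have "(\<integral>\<omega>. ?f \<beta> \<omega> \<partial>M) = (\<integral>\<omega>. \<Psi> \<beta> \<omega> $ k * real_cond_exp M (loc t i l)
          (\<lambda>\<omega>. indicat_real (?D \<beta>) \<omega> * noise t i l \<omega> $ k) \<omega> \<partial>M)"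
        by (rule G.real_cond_exp_intg(2)[OF int fm(2,1), symmetric]) (rule that)+
      also have "\<dots> = 0"
        by (rule integral_eq_zero_AE)
          (use noise_cond_mean_given_table[OF i l j that, of t k] in \<open>eventually_elim; simp\<close>)
      finally show ?thesis .
    qed
    have "(\<integral>\<omega>. noise t i l \<omega> $ k * ?\<Psi> \<omega> $ k \<partial>M) = (\<integral>\<omega>. (\<Sum>\<beta>\<in>?T. ?f \<beta> \<omega>) \<partial>M)"
    proof (rule Bochner_Integration.integral_cong)
      fix \<omega> assume \<omega>: "\<omega> \<in> space M"
      have "(\<Sum>\<beta>\<in>?T. ?f \<beta> \<omega>) = (\<Sum>\<beta>\<in>?T. if \<beta> = batch_table t j (H j) \<omega>
          then noise t i l \<omega> $ k * ?\<Psi> \<omega> $ k else 0)"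
        using \<omega> by (intro sum.cong) (auto simp: indicator_def)
      also have "\<dots> = noise t i l \<omega> $ k * ?\<Psi> \<omega> $ k"
        using batch_table_in_tables[OF \<omega> j(1) order_refl] finite_tables by simp
      finally show "noise t i l \<omega> $ k * ?\<Psi> \<omega> $ k = (\<Sum>\<beta>\<in>?T. ?f \<beta> \<omega>)" ..
    qed simp
    also have "\<dots> = (\<Sum>\<beta>\<in>?T. \<integral>\<omega>. ?f \<beta> \<omega> \<partial>M)"
      by (rule Bochner_Integration.integral_sum[OF int])
    also have "\<dots> = 0" using zero by simp
    finally show ?thesis .
  qed
  then show ?thesis
    by (subst integral_inner_vec[OF ess_bdd_noise[OF i l] bdd]) simp
qed

end

section \<open>Drift of the local iterates\<close>

lemma norm_add_squared_le:
  fixes u v :: "'a::real_inner"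
  shows "(norm (u + v))\<^sup>2 \<le> 2 * (norm u)\<^sup>2 + 2 * (norm v)\<^sup>2"
proof -
  have "0 \<le> (norm (u - v))\<^sup>2" by simp
  then show ?thesis by (simp add: power2_norm_eq_inner inner_diff inner_add inner_commute)
qed

lemma norm_sum_squared_le:
  fixes f :: "'i \<Rightarrow> 'a::real_inner"
  shows "(norm (\<Sum>i\<in>I. f i))\<^sup>2 \<le> real (card I) * (\<Sum>i\<in>I. (norm (f i))\<^sup>2)"
proof (cases "finite I")
  case True
  have "(norm (\<Sum>i\<in>I. f i))\<^sup>2 \<le> (\<Sum>i\<in>I. norm (f i))\<^sup>2"
    by (intro power_mono norm_sum norm_ge_zero)
  also have "\<dots> \<le> (\<Sum>i\<in>I. (norm (f i))\<^sup>2) * real (card I)"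
    by (rule sum_squared_le_sum_of_squares)
  finally show ?thesis by (simp add: mult.commute)
qed simp

lemma drift_variance_step:
  fixes q z e A v :: real
  assumes "1 \<le> q" "0 \<le> z * e\<^sup>2 * A * v"
  shows "(z * q\<^sup>2) * (A * (q ^ (2 * l) * real l * e\<^sup>2 * v)) + (z * e\<^sup>2) * A * v
    \<le> z * (A * (q ^ (2 * Suc l) * real (Suc l) * e\<^sup>2 * v))"
proof -
  have "z * e\<^sup>2 * A * v * 1 \<le> z * e\<^sup>2 * A * v * q ^ (2 * Suc l)"
    using assms by (intro mult_left_mono one_le_power)
  then show ?thesis by (simp add: algebra_simps power2_eq_square)
qed

lemma drift_noise_le:
  fixes q E k h A L v :: real
  assumes "q \<le> E" "0 \<le> E" "0 \<le> k" "k \<le> h" "0 < h" "0 \<le> v"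
  shows "q * (k * ((A / (L * h))\<^sup>2 * v)) \<le> E * (A\<^sup>2 / L\<^sup>2 * (v / h))"
proof -
  have "q * (k * ((A / (L * h))\<^sup>2 * v)) \<le> E * (h * ((A / (L * h))\<^sup>2 * v))"
    using assms by (intro mult_mono order_refl mult_right_mono mult_nonneg_nonneg) auto
  also have "h * ((A / (L * h))\<^sup>2 * v) = A\<^sup>2 / L\<^sup>2 * (v / h)"
    using assms by (simp add: power_divide power_mult_distrib power2_eq_square)
  finally show ?thesis .
qed

lemma integral_add_diff_null:
  fixes f g h :: "'w \<Rightarrow> real"
  assumes "integrable M f" "integrable M g" "integrable M h" "(\<integral>\<omega>. h \<omega> \<partial>M) = 0"
  shows "(\<integral>\<omega>. f \<omega> + g \<omega> - 2 * h \<omega> \<partial>M) = (\<integral>\<omega>. f \<omega> \<partial>M) + (\<integral>\<omega>. g \<omega> \<partial>M)"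
  using assms by simp

context hew_local_sgd
begin

lemma variance_level_nonneg:
  assumes i: "i \<in> {1..n}"
  shows "0 \<le> variance_level m \<phi> xstar R i"
proof -
  let ?f = "\<lambda>z. (1 / real (m i)) * (\<Sum>j\<in>{1..m i}. (norm (gradient (\<phi> i j) z - grad_node i z))\<^sup>2)"
  have "continuous_on (cball xstar R) ?f"
    using L_smooth_continuous(2)[OF component_smooth[OF i]] L_smooth_continuous(2)[OF L_smooth_node[OF i]]
    by (intro continuous_intros) (auto intro: continuous_on_subset)
  then have "compact (?f ` cball xstar R)" by (intro compact_continuous_image) auto
  then have "bdd_above (?f ` cball xstar R)" by (intro bounded_imp_bdd_above compact_imp_bounded)
  then have "?f xstar \<le> (SUP z\<in>cball xstar R. ?f z)"
    using R_pos by (intro cSUP_upper) auto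
  moreover have "0 \<le> ?f xstar" by (intro mult_nonneg_nonneg sum_nonneg) auto
  ultimately show ?thesis unfolding variance_level_def by linarith
qed

text \<open>The amplitude of an active node, and zero for an inactive one.\<close>

definition amp :: "nat \<Rightarrow> nat \<Rightarrow> 'w \<Rightarrow> real" where
  "amp t i \<omega> = act t i \<omega> * \<theta> t i \<omega>"

lemma amp_range:
  assumes "\<omega> \<in> space M" shows "0 \<le> amp t i \<omega>" "amp t i \<omega> \<le> 1"
  using theta_range[OF assms, of i t] by (auto simp: amp_def act_def)

lemma amp_measurable [measurable]: "i \<in> {1..n} \<Longrightarrow> amp t i \<in> borel_measurable (past t)"
  unfolding amp_def[abs_def] by (intro borel_measurable_times act_measurable control_measurable)

lemma ess_bdd_past:
  assumes "X \<in> borel_measurable (past t)" "\<And>\<omega>. \<omega> \<in> space M \<Longrightarrow> norm (X \<omega>) \<le> K"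
  shows "ess_bdd M X"
  using measurable_past_M[OF assms(1)] assms(2) by (intro ess_bddI AE_I2)

lemma ess_bdd_amp: "i \<in> {1..n} \<Longrightarrow> ess_bdd M (amp t i)"
  by (rule ess_bdd_past[OF amp_measurable, where K = 1]) (use amp_range in auto)

lemma act_eta: "act t i \<omega> * eta t i \<omega> = amp t i \<omega> / (L * real (H i))"
  by (simp add: amp_def step_size_def)

text \<open>The noise of different steps of one node is uncorrelated, so the second moment of the sum grows
  linearly.\<close>

lemma noise_energy:
  assumes i: "i \<in> {1..n}" and k: "k \<le> H i"
    and Z: "Z \<in> borel_measurable (past t)" "ess_bdd M Z" "\<And>\<omega>. \<omega> \<in> space M \<Longrightarrow> 0 \<le> Z \<omega>"
  shows "(\<integral>\<omega>. Z \<omega> * (norm (\<Sum>l<k. noise t i l \<omega>))\<^sup>2 \<partial>M)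
    \<le> (\<integral>\<omega>. Z \<omega> * act t i \<omega> * (real k * noise_level i) \<partial>M)"
  using k
proof (induction k)
  case (Suc k)
  let ?a = "\<lambda>\<omega>. \<Sum>l<k. noise t i l \<omega>" and ?b = "noise t i k"
  have k: "k < H i" "k \<le> H i" using Suc.prems by auto
  have a_bdd: "ess_bdd M ?a" using k by (intro ess_bdd_sum ess_bdd_noise i) auto
  have b_bdd: "ess_bdd M ?b" by (rule ess_bdd_noise[OF i k(1)])
  have Za: "(\<lambda>\<omega>. Z \<omega> *\<^sub>R ?a \<omega>) \<in> borel_measurable (loc t i k)"
    using k
    by (intro borel_measurable_scaleR measurable_past_loc[OF Z(1)] borel_measurable_sum
        noise_measurable i) auto
  have orth: "(\<integral>\<omega>. inner (?b \<omega>) (Z \<omega> *\<^sub>R ?a \<omega>) \<partial>M) = 0"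
    by (rule noise_orthogonal[OF i k(1) Za ess_bdd_scaleR[OF Z(2) a_bdd]])
  have int: "integrable M (\<lambda>\<omega>. Z \<omega> * (norm (?a \<omega>))\<^sup>2)" "integrable M (\<lambda>\<omega>. Z \<omega> * (norm (?b \<omega>))\<^sup>2)"
    "integrable M (\<lambda>\<omega>. inner (?b \<omega>) (Z \<omega> *\<^sub>R ?a \<omega>))"
    by (intro integrable_ess_bdd ess_bdd_intros Z a_bdd b_bdd)+
  have int': "integrable M (\<lambda>\<omega>. Z \<omega> * act t i \<omega> * r)" for r
    by (intro integrable_ess_bdd ess_bdd_mult ess_bdd_const Z ess_bdd_act)
  have "(\<integral>\<omega>. Z \<omega> * (norm (\<Sum>l<Suc k. noise t i l \<omega>))\<^sup>2 \<partial>M)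
      = (\<integral>\<omega>. Z \<omega> * (norm (?a \<omega>))\<^sup>2 + Z \<omega> * (norm (?b \<omega>))\<^sup>2 + 2 * inner (?b \<omega>) (Z \<omega> *\<^sub>R ?a \<omega>) \<partial>M)"
    by (intro Bochner_Integration.integral_cong refl)
      (simp add: power2_norm_eq_inner inner_add inner_commute algebra_simps)
  also have "\<dots> = (\<integral>\<omega>. Z \<omega> * (norm (?a \<omega>))\<^sup>2 \<partial>M) + (\<integral>\<omega>. Z \<omega> * (norm (?b \<omega>))\<^sup>2 \<partial>M)"
    using int orth by simp
  also have "\<dots> \<le> (\<integral>\<omega>. Z \<omega> * act t i \<omega> * (real k * noise_level i) \<partial>M)
      + (\<integral>\<omega>. Z \<omega> * act t i \<omega> * noise_level i \<partial>M)"
    using Suc.IH k(2)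
    by (intro add_mono noise_second_moment i k(1) Z measurable_past_loc[OF Z(1)]) auto
  also have "\<dots> = (\<integral>\<omega>. Z \<omega> * act t i \<omega> * (real k * noise_level i) + Z \<omega> * act t i \<omega> * noise_level i \<partial>M)"
    by (rule Bochner_Integration.integral_add[OF int' int', symmetric])
  also have "\<dots> = (\<integral>\<omega>. Z \<omega> * act t i \<omega> * (real (Suc k) * noise_level i) \<partial>M)"
    by (rule arg_cong[where f = "integral\<^sup>L M"])
      (simp only: of_nat_Suc distrib_left distrib_right mult_1_left add.commute)
  finally show ?case .
qed simp

lemma ess_bdd_step: "i \<in> {1..n} \<Longrightarrow> ess_bdd M (\<lambda>\<omega>. amp t i \<omega> / (L * real (H i)))"
  unfolding divide_inverse by (intro ess_bdd_mult ess_bdd_const ess_bdd_amp)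

lemma ess_bdd_growth: "i \<in> {1..n} \<Longrightarrow> ess_bdd M (\<lambda>\<omega>. 1 + amp t i \<omega> / real (H i))"
  unfolding divide_inverse by (intro ess_bdd_add ess_bdd_mult ess_bdd_const ess_bdd_amp)

text \<open>The bound on the conditional mean square of the deviation at local step \<open>l\<close>.\<close>

definition dev_level :: "nat \<Rightarrow> nat \<Rightarrow> nat \<Rightarrow> 'w \<Rightarrow> real" where
  "dev_level t i l \<omega> = act t i \<omega> * ((1 + amp t i \<omega> / real (H i)) ^ (2 * l) * real l
     * (amp t i \<omega> / (L * real (H i)))\<^sup>2 * noise_level i)"

lemma ess_bdd_dev_level:
  assumes i: "i \<in> {1..n}" shows "ess_bdd M (dev_level t i l)"
proof -
  have "ess_bdd M (\<lambda>\<omega>. (1 + amp t i \<omega> / real (H i)) ^ k)" for k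
  proof (induction k)
    case (Suc k)
    then show ?case unfolding power_Suc by (rule ess_bdd_mult[OF ess_bdd_growth[OF i]])
  qed (simp add: ess_bdd_const)
  then show ?thesis
    unfolding dev_level_def[abs_def]
    by (intro ess_bdd_mult ess_bdd_act ess_bdd_power2 ess_bdd_const ess_bdd_step i)
qed

text \<open>By induction on the step: a gradient step expands the deviation by at most \<open>1 + \<theta> / H\<close>, and the new noise
  is orthogonal to it. The multiplier \<open>Z\<close> varies in the induction because it absorbs the random
  expansion factor.\<close>

lemma dev_second_moment:
  assumes i: "i \<in> {1..n}" and l: "l \<le> H i"
    and Z: "Z \<in> borel_measurable (past t)" "ess_bdd M Z" "\<And>\<omega>. \<omega> \<in> space M \<Longrightarrow> 0 \<le> Z \<omega>"
  shows "(\<integral>\<omega>. Z \<omega> * (norm (dev t i l \<omega>))\<^sup>2 \<partial>M)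
    \<le> (\<integral>\<omega>. Z \<omega> * dev_level t i l \<omega> \<partial>M)"
  using l Z
proof (induction l arbitrary: Z)
  case 0
  then show ?case by (simp add: dev_def dev_level_def)
next
  case (Suc l)
  let ?e = "\<lambda>\<omega>. amp t i \<omega> / (L * real (H i))" and ?q = "\<lambda>\<omega>. 1 + amp t i \<omega> / real (H i)"
  let ?b = "noise t i l"
  let ?P = "\<lambda>\<omega>. dev t i l \<omega> - ?e \<omega> *\<^sub>R (grad_node i (iterate t i l \<omega>) - grad_node i (mean_path t i l \<omega>))"
  have l: "l < H i" "l \<le> H i" using Suc.prems by auto
  note Z = Suc.prems(2-4)
  note e_bdd = ess_bdd_step[OF i, of t] and q_bdd = ess_bdd_growth[OF i, of t]
  have q_meas [measurable]: "?q \<in> borel_measurable (past t)"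
    and e_meas [measurable]: "?e \<in> borel_measurable (past t)"
    using amp_measurable[OF i, of t] by measurable
  have b_bdd: "ess_bdd M ?b" by (rule ess_bdd_noise[OF i l(1)])
  have step: "dev t i (Suc l) \<omega> = ?P \<omega> - ?e \<omega> *\<^sub>R ?b \<omega>" for \<omega>
  proof -
    have "eta t i \<omega> *\<^sub>R noise t i l \<omega> = (act t i \<omega> * eta t i \<omega>) *\<^sub>R noise t i l \<omega>"
      by (simp add: noise_def act_def)
    then show ?thesis unfolding dev_Suc by (simp only: act_eta)
  qed
  have "?P = (\<lambda>\<omega>. dev t i (Suc l) \<omega> + ?e \<omega> *\<^sub>R ?b \<omega>)" unfolding step by simp
  then have P_bdd: "ess_bdd M ?P"
    using ess_bdd_add[OF ess_bdd_dev[OF i Suc.prems(1)] ess_bdd_scaleR[OF e_bdd b_bdd], of t] by simp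
  have P_meas: "?P \<in> borel_measurable (loc t i l)"
  proof -
    note [measurable] = dev_measurable[OF i l(2), of t] iterate_measurable_loc[OF i l(2), of t]
      measurable_past_loc[OF mean_path_measurable[OF i]] borel_measurable_grad_node[OF i]
      measurable_past_loc[OF e_meas]
    show ?thesis by measurable
  qed
  have P_le: "(norm (?P \<omega>))\<^sup>2 \<le> (?q \<omega>)\<^sup>2 * (norm (dev t i l \<omega>))\<^sup>2" if \<omega>: "\<omega> \<in> space M" for \<omega>
  proof (cases "i \<in> S t \<omega>")
    case True
    have e0: "0 \<le> ?e \<omega>" using amp_range[OF \<omega>, of t i] L_pos by simp
    have "norm (?P \<omega>) \<le> norm (dev t i l \<omega>) + ?e \<omega> * (L * norm (dev t i l \<omega>))"
    proof (intro order_trans[OF norm_triangle_ineq4] add_left_mono)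
      have "dev t i l \<omega> = iterate t i l \<omega> - mean_path t i l \<omega>" using True by (simp add: dev_def act_def)
      then show "norm (?e \<omega> *\<^sub>R (grad_node i (iterate t i l \<omega>) - grad_node i (mean_path t i l \<omega>)))
          \<le> ?e \<omega> * (L * norm (dev t i l \<omega>))"
        unfolding norm_scaleR abs_of_nonneg[OF e0]
        using mult_left_mono[OF L_smoothD(2)[OF L_smooth_node[OF i]] e0] by simp
    qed
    also have "\<dots> = ?q \<omega> * norm (dev t i l \<omega>)" using L_pos by (simp add: algebra_simps)
    finally have "(norm (?P \<omega>))\<^sup>2 \<le> (?q \<omega> * norm (dev t i l \<omega>))\<^sup>2" by (intro power_mono) auto
    then show ?thesis by (simp add: power_mult_distrib)
  next
    case False
    then show ?thesis by (simp add: dev_def amp_def act_def)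
  qed
  have orth: "(\<integral>\<omega>. inner (?b \<omega>) ((Z \<omega> * ?e \<omega>) *\<^sub>R ?P \<omega>) \<partial>M) = 0"
  proof (rule noise_orthogonal[OF i l(1)])
    show "(\<lambda>\<omega>. (Z \<omega> * ?e \<omega>) *\<^sub>R ?P \<omega>) \<in> borel_measurable (loc t i l)"
      by (intro borel_measurable_scaleR borel_measurable_times measurable_past_loc[OF Z(1)]
          measurable_past_loc[OF e_meas] P_meas)
    show "ess_bdd M (\<lambda>\<omega>. (Z \<omega> * ?e \<omega>) *\<^sub>R ?P \<omega>)"
      by (intro ess_bdd_scaleR ess_bdd_mult Z e_bdd P_bdd)
  qed
  have Zq: "(\<lambda>\<omega>. Z \<omega> * (?q \<omega>)\<^sup>2) \<in> borel_measurable (past t)" "ess_bdd M (\<lambda>\<omega>. Z \<omega> * (?q \<omega>)\<^sup>2)"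
    "\<And>\<omega>. \<omega> \<in> space M \<Longrightarrow> 0 \<le> Z \<omega> * (?q \<omega>)\<^sup>2"
    by (intro borel_measurable_times borel_measurable_power Z q_meas)
       (intro ess_bdd_intros Z q_bdd, use Z(3) in simp)
  have Ze: "(\<lambda>\<omega>. Z \<omega> * (?e \<omega>)\<^sup>2) \<in> borel_measurable (loc t i l)" "ess_bdd M (\<lambda>\<omega>. Z \<omega> * (?e \<omega>)\<^sup>2)"
    "\<And>\<omega>. \<omega> \<in> space M \<Longrightarrow> 0 \<le> Z \<omega> * (?e \<omega>)\<^sup>2"
    by (intro borel_measurable_times borel_measurable_power measurable_past_loc[OF Z(1)]
        measurable_past_loc[OF e_meas])
       (intro ess_bdd_intros Z e_bdd, use Z(3) in simp)
  have int: "integrable M (\<lambda>\<omega>. Z \<omega> * (norm (?P \<omega>))\<^sup>2)"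
    "integrable M (\<lambda>\<omega>. (Z \<omega> * (?e \<omega>)\<^sup>2) * (norm (?b \<omega>))\<^sup>2)"
    "integrable M (\<lambda>\<omega>. inner (?b \<omega>) ((Z \<omega> * ?e \<omega>) *\<^sub>R ?P \<omega>))"
    "integrable M (\<lambda>\<omega>. (Z \<omega> * (?q \<omega>)\<^sup>2) * (norm (dev t i l \<omega>))\<^sup>2)"
    by (intro integrable_ess_bdd ess_bdd_mult ess_bdd_inner ess_bdd_scaleR ess_bdd_power2
        ess_bdd_norm ess_bdd_dev[OF i l(2)] Z P_bdd e_bdd b_bdd q_bdd)+
  have "(\<integral>\<omega>. Z \<omega> * (norm (dev t i (Suc l) \<omega>))\<^sup>2 \<partial>M)
      = (\<integral>\<omega>. Z \<omega> * (norm (?P \<omega>))\<^sup>2 + (Z \<omega> * (?e \<omega>)\<^sup>2) * (norm (?b \<omega>))\<^sup>2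
          - 2 * inner (?b \<omega>) ((Z \<omega> * ?e \<omega>) *\<^sub>R ?P \<omega>) \<partial>M)"
  proof (intro Bochner_Integration.integral_cong refl)
    fix \<omega>
    have alg: "z * (norm (p - e *\<^sub>R v))\<^sup>2
      = z * (norm p)\<^sup>2 + (z * e\<^sup>2) * (norm v)\<^sup>2 - 2 * inner v ((z * e) *\<^sub>R p)"
      for z e :: real and p v :: "real ^ 'd"
      unfolding power2_norm_eq_inner
      by (simp add: inner_diff inner_commute algebra_simps power2_eq_square)
    show "Z \<omega> * (norm (dev t i (Suc l) \<omega>))\<^sup>2
        = Z \<omega> * (norm (?P \<omega>))\<^sup>2 + (Z \<omega> * (?e \<omega>)\<^sup>2) * (norm (?b \<omega>))\<^sup>2
          - 2 * inner (?b \<omega>) ((Z \<omega> * ?e \<omega>) *\<^sub>R ?P \<omega>)"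
      unfolding step by (rule alg)
  qed
  also have "\<dots> = (\<integral>\<omega>. Z \<omega> * (norm (?P \<omega>))\<^sup>2 \<partial>M) + (\<integral>\<omega>. (Z \<omega> * (?e \<omega>)\<^sup>2) * (norm (?b \<omega>))\<^sup>2 \<partial>M)"
    by (rule integral_add_diff_null[OF int(1-3) orth])
  also have "\<dots> \<le> (\<integral>\<omega>. (Z \<omega> * (?q \<omega>)\<^sup>2) * (norm (dev t i l \<omega>))\<^sup>2 \<partial>M)
      + (\<integral>\<omega>. (Z \<omega> * (?e \<omega>)\<^sup>2) * act t i \<omega> * noise_level i \<partial>M)"
  proof (intro add_mono noise_second_moment[OF i l(1) Ze])
    show "(\<integral>\<omega>. Z \<omega> * (norm (?P \<omega>))\<^sup>2 \<partial>M) \<le> (\<integral>\<omega>. (Z \<omega> * (?q \<omega>)\<^sup>2) * (norm (dev t i l \<omega>))\<^sup>2 \<partial>M)"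
    proof (rule integral_mono[OF int(1) int(4)])
      fix \<omega> assume \<omega>: "\<omega> \<in> space M"
      show "Z \<omega> * (norm (?P \<omega>))\<^sup>2 \<le> (Z \<omega> * (?q \<omega>)\<^sup>2) * (norm (dev t i l \<omega>))\<^sup>2"
        using mult_left_mono[OF P_le[OF \<omega>] Z(3)[OF \<omega>]] by (simp add: mult.assoc)
    qed
  qed
  also have "\<dots> \<le> (\<integral>\<omega>. (Z \<omega> * (?q \<omega>)\<^sup>2) * dev_level t i l \<omega> \<partial>M)
      + (\<integral>\<omega>. (Z \<omega> * (?e \<omega>)\<^sup>2) * act t i \<omega> * noise_level i \<partial>M)"
    by (intro add_right_mono Suc.IH[OF l(2) Zq])
  also have "\<dots> = (\<integral>\<omega>. (Z \<omega> * (?q \<omega>)\<^sup>2) * dev_level t i l \<omega>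
      + (Z \<omega> * (?e \<omega>)\<^sup>2) * act t i \<omega> * noise_level i \<partial>M)"
    by (intro Bochner_Integration.integral_add[symmetric] integrable_ess_bdd ess_bdd_mult ess_bdd_power2
        ess_bdd_const ess_bdd_act Z e_bdd q_bdd ess_bdd_dev_level i)
  also have "\<dots> \<le> (\<integral>\<omega>. Z \<omega> * dev_level t i (Suc l) \<omega> \<partial>M)"
  proof (rule integral_mono)
    show "integrable M (\<lambda>\<omega>. (Z \<omega> * (?q \<omega>)\<^sup>2) * dev_level t i l \<omega>
      + (Z \<omega> * (?e \<omega>)\<^sup>2) * act t i \<omega> * noise_level i)"
      by (intro integrable_ess_bdd ess_bdd_add ess_bdd_mult ess_bdd_power2
        ess_bdd_const ess_bdd_act Z e_bdd q_bdd ess_bdd_dev_level i)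
    show "integrable M (\<lambda>\<omega>. Z \<omega> * dev_level t i (Suc l) \<omega>)"
      by (intro integrable_ess_bdd ess_bdd_mult Z ess_bdd_dev_level i)
    fix \<omega> assume \<omega>: "\<omega> \<in> space M"
    have q1: "1 \<le> ?q \<omega>" using amp_range[OF \<omega>, of t i] by simp
    have "0 \<le> Z \<omega> * (?e \<omega>)\<^sup>2 * act t i \<omega> * noise_level i"
      using Z(3)[OF \<omega>] variance_level_nonneg[OF i] by (simp add: act_def)
    then show "(Z \<omega> * (?q \<omega>)\<^sup>2) * dev_level t i l \<omega>
      + (Z \<omega> * (?e \<omega>)\<^sup>2) * act t i \<omega> * noise_level i
      \<le> Z \<omega> * dev_level t i (Suc l) \<omega>"
      unfolding dev_level_def by (rule drift_variance_step[OF q1])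
  qed
  finally show ?case .
qed

text \<open>The displacement of the local path from the server iterate.\<close>

definition disp :: "nat \<Rightarrow> nat \<Rightarrow> nat \<Rightarrow> 'w \<Rightarrow> real ^ 'd" where
  "disp t i l \<omega> = act t i \<omega> *\<^sub>R (iterate t i l \<omega> - x t \<omega>)"

text \<open>The bound on the conditional mean square of the local displacement.\<close>

definition drift_level :: "nat \<Rightarrow> nat \<Rightarrow> 'w \<Rightarrow> real" where
  "drift_level t i \<omega> = exp (2 * amp t i \<omega>) * ((amp t i \<omega>)\<^sup>2 / L\<^sup>2) *
     (2 * (norm (direction t i \<omega>))\<^sup>2 + 2 * (noise_level i / real (H i)))"

lemma ess_bdd_exp_amp:
  assumes i: "i \<in> {1..n}" shows "ess_bdd M (\<lambda>\<omega>. exp (2 * amp t i \<omega>))"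
proof (rule ess_bdd_past)
  show "(\<lambda>\<omega>. exp (2 * amp t i \<omega>)) \<in> borel_measurable (past t)"
    using amp_measurable[OF i, of t] by measurable
  show "norm (exp (2 * amp t i \<omega>)) \<le> exp 2" if "\<omega> \<in> space M" for \<omega>
    using amp_range[OF that] by simp
qed

lemma ess_bdd_drift_level: "i \<in> {1..n} \<Longrightarrow> ess_bdd M (drift_level t i)"
  unfolding drift_level_def[abs_def] divide_inverse
  by (intro ess_bdd_mult ess_bdd_add ess_bdd_power2 ess_bdd_norm ess_bdd_const ess_bdd_amp
      ess_bdd_direction ess_bdd_exp_amp)

lemma growth_factor_le_exp:
  assumes \<omega>: "\<omega> \<in> space M" and i: "i \<in> {1..n}" and l: "l \<le> H i"
  shows "(1 + amp t i \<omega> / real (H i)) ^ (2 * l) \<le> exp (2 * amp t i \<omega>)"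
proof -
  let ?q = "1 + amp t i \<omega> / real (H i)"
  have q: "1 \<le> ?q" using amp_range[OF \<omega>, of t i] by simp
  have "?q ^ l \<le> ?q ^ H i" using l q by (rule power_increasing)
  also have "\<dots> \<le> exp (amp t i \<omega>)"
    using amp_range[OF \<omega>, of t i] H_pos[OF i] by (intro exp_ge_one_plus_x_over_n_power_n) auto
  finally have "(?q ^ l)\<^sup>2 \<le> (exp (amp t i \<omega>))\<^sup>2" using q by (intro power_mono) auto
  then show ?thesis by (simp add: power_mult[symmetric] mult.commute[of l] exp_double)
qed

lemma disp_second_moment:
  assumes i: "i \<in> {1..n}" and l: "l \<le> H i"
    and Z: "Z \<in> borel_measurable (past t)" "ess_bdd M Z" "\<And>\<omega>. \<omega> \<in> space M \<Longrightarrow> 0 \<le> Z \<omega>"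
  shows "(\<integral>\<omega>. Z \<omega> * (norm (disp t i l \<omega>))\<^sup>2 \<partial>M) \<le> (\<integral>\<omega>. Z \<omega> * drift_level t i \<omega> \<partial>M)"
proof -
  let ?mp = "\<lambda>\<omega>. act t i \<omega> *\<^sub>R (mean_path t i l \<omega> - x t \<omega>)"
  let ?e = "\<lambda>\<omega>. amp t i \<omega> / (L * real (H i))" and ?q = "\<lambda>\<omega>. 1 + amp t i \<omega> / real (H i)"
  let ?a = "\<lambda>\<omega>. exp (2 * amp t i \<omega>) * ((amp t i \<omega>)\<^sup>2 / L\<^sup>2)"
  let ?A = "\<lambda>\<omega>. ?a \<omega> * (2 * (norm (direction t i \<omega>))\<^sup>2)"
  let ?C = "\<lambda>\<omega>. ?a \<omega> * (2 * (noise_level i / real (H i)))"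
  have H: "0 < real (H i)" using H_pos[OF i] by simp
  have disp: "disp t i l = (\<lambda>\<omega>. ?mp \<omega> + dev t i l \<omega>)"
    by (auto simp: disp_def dev_def scaleR_add_right[symmetric])
  have mp_bdd: "ess_bdd M ?mp" by (rule ess_bdd_mean_path[OF i])
  have dev_bdd: "ess_bdd M (dev t i l)" by (rule ess_bdd_dev[OF i l])
  have a_bdd: "ess_bdd M ?a" unfolding divide_inverse
    by (intro ess_bdd_mult ess_bdd_const ess_bdd_power2 ess_bdd_amp ess_bdd_exp_amp i)
  have mp: "2 * (norm (?mp \<omega>))\<^sup>2 \<le> ?A \<omega>" if \<omega>: "\<omega> \<in> space M" for \<omega>
  proof (cases "i \<in> S t \<omega>")
    case True
    let ?d = "norm (direction t i \<omega>)"
    have th: "\<theta> t i \<omega> = amp t i \<omega>" "step_size L (H i) (amp t i \<omega>) = ?e \<omega>"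
      using True by (simp_all add: amp_def act_def step_size_def)
    have q0: "0 \<le> ?q \<omega>" "0 \<le> ?e \<omega>" using amp_range[OF \<omega>, of t i] L_pos by auto
    have "norm (?mp \<omega>) \<le> real l * ?q \<omega> ^ l * (?e \<omega> * ?d)"
      using mean_path_drift[OF \<omega> True, of l] True unfolding th by (simp add: act_def)
    also have "\<dots> \<le> real (H i) * ?q \<omega> ^ l * (?e \<omega> * ?d)"
      using l q0 by (intro mult_right_mono mult_nonneg_nonneg) auto
    also have "\<dots> = ?q \<omega> ^ l * (amp t i \<omega> / L * ?d)" using H by simp
    finally have "(norm (?mp \<omega>))\<^sup>2 \<le> (?q \<omega> ^ l * (amp t i \<omega> / L * ?d))\<^sup>2"
      by (intro power_mono) auto
    also have "\<dots> = ?q \<omega> ^ (2 * l) * ((amp t i \<omega>)\<^sup>2 / L\<^sup>2 * ?d\<^sup>2)"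
      by (simp add: power_mult_distrib power_divide power_mult[symmetric] mult.commute[of l])
    also have "\<dots> \<le> exp (2 * amp t i \<omega>) * ((amp t i \<omega>)\<^sup>2 / L\<^sup>2 * ?d\<^sup>2)"
      by (intro mult_right_mono growth_factor_le_exp \<omega> i l) auto
    finally have "2 * (norm (?mp \<omega>))\<^sup>2
        \<le> 2 * (exp (2 * amp t i \<omega>) * ((amp t i \<omega>)\<^sup>2 / L\<^sup>2 * ?d\<^sup>2))" by simp
    then show ?thesis by (simp only: mult_ac)
  qed (simp add: act_def)
  have B: "2 * dev_level t i l \<omega> \<le> ?C \<omega>" if \<omega>: "\<omega> \<in> space M" for \<omega>
  proof (cases "i \<in> S t \<omega>")
    case True
    have nl: "0 \<le> noise_level i" using variance_level_nonneg[OF i] by simp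
    have "dev_level t i l \<omega> = ?q \<omega> ^ (2 * l) * (real l * ((?e \<omega>)\<^sup>2 * noise_level i))"
      using True by (simp add: act_def dev_level_def)
    also have "\<dots> \<le> exp (2 * amp t i \<omega>) * ((amp t i \<omega>)\<^sup>2 / L\<^sup>2 * (noise_level i / real (H i)))"
      using l H by (intro drift_noise_le growth_factor_le_exp \<omega> i l nl) auto
    finally have "2 * dev_level t i l \<omega> \<le> 2 * (exp (2 * amp t i \<omega>)
        * ((amp t i \<omega>)\<^sup>2 / L\<^sup>2 * (noise_level i / real (H i))))"
      by (rule mult_left_mono) simp
    then show ?thesis by (simp only: mult_ac)
  next
    case False
    then show ?thesis using variance_level_nonneg[OF i] by (simp add: act_def dev_level_def)
  qed
  have int: "integrable M (\<lambda>\<omega>. Z \<omega> * (norm (disp t i l \<omega>))\<^sup>2)"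
    "integrable M (\<lambda>\<omega>. Z \<omega> * ?A \<omega>)" "integrable M (\<lambda>\<omega>. (2 * Z \<omega>) * (norm (dev t i l \<omega>))\<^sup>2)"
    "integrable M (\<lambda>\<omega>. Z \<omega> * ?C \<omega>)" "integrable M (\<lambda>\<omega>. (2 * Z \<omega>) * dev_level t i l \<omega>)"
    unfolding disp
    by (intro integrable_ess_bdd ess_bdd_mult ess_bdd_power2 ess_bdd_norm ess_bdd_add ess_bdd_const
        Z(2) mp_bdd dev_bdd a_bdd ess_bdd_direction ess_bdd_dev_level i)+
  have "(\<integral>\<omega>. Z \<omega> * (norm (disp t i l \<omega>))\<^sup>2 \<partial>M) \<le> (\<integral>\<omega>. Z \<omega> * ?A \<omega> + (2 * Z \<omega>) * (norm (dev t i l \<omega>))\<^sup>2 \<partial>M)"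
  proof (rule integral_mono[OF int(1) Bochner_Integration.integrable_add[OF int(2,3)]])
    fix \<omega> assume \<omega>: "\<omega> \<in> space M"
    have "(norm (disp t i l \<omega>))\<^sup>2 \<le> ?A \<omega> + 2 * (norm (dev t i l \<omega>))\<^sup>2"
      unfolding disp using norm_add_squared_le[of "?mp \<omega>" "dev t i l \<omega>"] mp[OF \<omega>] by linarith
    from mult_left_mono[OF this Z(3)[OF \<omega>]]
    show "Z \<omega> * (norm (disp t i l \<omega>))\<^sup>2 \<le> Z \<omega> * ?A \<omega> + (2 * Z \<omega>) * (norm (dev t i l \<omega>))\<^sup>2"
      by (simp add: distrib_left mult_ac)
  qed
  also have "\<dots> = (\<integral>\<omega>. Z \<omega> * ?A \<omega> \<partial>M) + (\<integral>\<omega>. (2 * Z \<omega>) * (norm (dev t i l \<omega>))\<^sup>2 \<partial>M)"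
    by (rule Bochner_Integration.integral_add[OF int(2,3)])
  also have "\<dots> \<le> (\<integral>\<omega>. Z \<omega> * ?A \<omega> \<partial>M) + (\<integral>\<omega>. (2 * Z \<omega>) * dev_level t i l \<omega> \<partial>M)"
    using Z by (intro add_left_mono dev_second_moment i l ess_bdd_mult ess_bdd_const) auto
  also have "\<dots> \<le> (\<integral>\<omega>. Z \<omega> * ?A \<omega> \<partial>M) + (\<integral>\<omega>. Z \<omega> * ?C \<omega> \<partial>M)"
  proof (intro add_left_mono integral_mono[OF int(5) int(4)])
    fix \<omega> assume \<omega>: "\<omega> \<in> space M"
    show "(2 * Z \<omega>) * dev_level t i l \<omega> \<le> Z \<omega> * ?C \<omega>"
      using mult_left_mono[OF B[OF \<omega>] Z(3)[OF \<omega>]] by (simp only: mult_ac)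
  qed
  also have "\<dots> = (\<integral>\<omega>. Z \<omega> * ?A \<omega> + Z \<omega> * ?C \<omega> \<partial>M)"
    by (rule Bochner_Integration.integral_add[OF int(2,4), symmetric])
  also have "\<dots> = (\<integral>\<omega>. Z \<omega> * drift_level t i \<omega> \<partial>M)"
    unfolding drift_level_def by (simp only: distrib_left)
  finally show ?thesis .
qed

end

section \<open>One round in terms of drift and noise\<close>

lemma norm_weighted_sum_squared_le:
  fixes p :: "'i \<Rightarrow> 'a::real_inner"
  assumes "\<And>i. i \<in> I \<Longrightarrow> 0 \<le> a i" "(\<Sum>i\<in>I. a i) = 1"
  shows "(norm (\<Sum>i\<in>I. a i *\<^sub>R p i))\<^sup>2 \<le> (\<Sum>i\<in>I. a i * (norm (p i))\<^sup>2)"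
proof -
  define c where "c = (\<Sum>i\<in>I. a i *\<^sub>R p i)"
  have "0 \<le> (\<Sum>i\<in>I. a i * (norm (p i - c))\<^sup>2)"
    using assms(1) by (intro sum_nonneg mult_nonneg_nonneg) auto
  also have "\<dots> = (\<Sum>i\<in>I. a i * (norm (p i))\<^sup>2 - 2 * inner c (a i *\<^sub>R p i) + a i * (norm c)\<^sup>2)"
    by (intro sum.cong refl) (simp add: power2_norm_eq_inner inner_diff inner_commute algebra_simps)
  also have "\<dots> = (\<Sum>i\<in>I. a i * (norm (p i))\<^sup>2) - 2 * inner c c + (\<Sum>i\<in>I. a i) * (norm c)\<^sup>2"
    by (simp only: sum.distrib sum_subtractf sum_distrib_left[symmetric] inner_sum_right[symmetric]
        c_def[symmetric] sum_distrib_right)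
  also have "\<dots> = (\<Sum>i\<in>I. a i * (norm (p i))\<^sup>2) - (norm c)\<^sup>2"
    by (simp add: assms(2) power2_norm_eq_inner)
  finally show ?thesis by (simp add: c_def)
qed

text \<open>A step of length \<open>\<tau> / L\<close> along \<open>v\<close> instead of the gradient \<open>g\<close> decreases the quadratic model
  by \<open>\<tau> / (2 L) |g|^2\<close>, up to the squared error of \<open>v\<close>.\<close>

lemma short_step_le:
  fixes g v :: "'a::real_inner"
  assumes "0 \<le> \<tau>" "\<tau> \<le> 1" "0 < L"
  shows "inner g (- (\<tau> / L) *\<^sub>R v) + L / 2 * (norm (- (\<tau> / L) *\<^sub>R v))\<^sup>2
    \<le> \<tau> / (2 * L) * ((norm (v - g))\<^sup>2 - (norm g)\<^sup>2)"
proof -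
  have "\<tau>\<^sup>2 * (norm v)\<^sup>2 \<le> \<tau> * (norm v)\<^sup>2"
    using assms by (intro mult_right_mono) (auto simp: power2_eq_square mult_left_le)
  then have "\<tau>\<^sup>2 * (norm v)\<^sup>2 / (2 * L) \<le> \<tau> * (norm v)\<^sup>2 / (2 * L)"
    using assms by (intro divide_right_mono) auto
  moreover have "L / 2 * (norm (- (\<tau> / L) *\<^sub>R v))\<^sup>2 = \<tau>\<^sup>2 * (norm v)\<^sup>2 / (2 * L)"
    using assms by (simp add: power_mult_distrib power_divide power2_eq_square)
  moreover have "inner g (- (\<tau> / L) *\<^sub>R v) = - 2 * (\<tau> * inner g v) / (2 * L)"
    by simp
  moreover have "\<tau> / (2 * L) * ((norm (v - g))\<^sup>2 - (norm g)\<^sup>2)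
      = \<tau> * (norm v)\<^sup>2 / (2 * L) + - 2 * (\<tau> * inner g v) / (2 * L)"
    by (simp add: power2_norm_eq_inner inner_diff inner_commute diff_divide_distrib algebra_simps)
  ultimately show ?thesis by linarith
qed

text \<open>The descent bound for a weighted step. The last two sums are the terms with zero mean when
  \<open>N\<close> is noise that is orthogonal to the past and to the other nodes.\<close>

lemma weighted_step_le:
  fixes g :: "'a::real_inner" and d G N :: "'i \<Rightarrow> 'a"
  assumes I: "finite I" and a: "\<And>i. i \<in> I \<Longrightarrow> 0 \<le> a i" "(\<Sum>i\<in>I. a i) = 1"
    and \<tau>: "\<And>i. i \<in> I \<Longrightarrow> 0 \<le> \<tau> i" "\<And>i. i \<in> I \<Longrightarrow> \<tau> i \<le> 1" and L: "0 < L"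
    and D: "D = (\<Sum>i\<in>I. a i *\<^sub>R (- (\<tau> i / L) *\<^sub>R (d i + G i + N i)))"
  shows "inner g D + L / 2 * (norm D)\<^sup>2 \<le>
    (\<Sum>i\<in>I. a i * \<tau> i / (2 * L) * ((norm (d i + G i - g))\<^sup>2 - (norm g)\<^sup>2)
         + (a i * \<tau> i)\<^sup>2 / (2 * L) * (2 * (norm (N i))\<^sup>2 + (norm (G i))\<^sup>2))
    + (\<Sum>i\<in>I. inner (N i) (- (a i * \<tau> i / L) *\<^sub>R g + ((a i * \<tau> i)\<^sup>2 / L) *\<^sub>R d i))
    + (\<Sum>i\<in>I. \<Sum>j\<in>I - {i}. inner (N i)
         ((a i * \<tau> i * (a j * \<tau> j) / (2 * L)) *\<^sub>R (N j + 2 *\<^sub>R (d j + G j))))"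
proof -
  define P where "P = (\<Sum>i\<in>I. a i *\<^sub>R (- (\<tau> i / L) *\<^sub>R (d i + G i)))"
  define u where "u i = a i * \<tau> i" for i
  define S where "S = (\<Sum>i\<in>I. u i *\<^sub>R N i)"
  define V where "V = (\<Sum>i\<in>I. u i *\<^sub>R (d i + G i))"
  have P: "P = - (1 / L) *\<^sub>R V"
    by (simp add: P_def V_def u_def scaleR_sum_right mult_ac sum_negf)
  have D: "D = P - (1 / L) *\<^sub>R S"
    unfolding D P_def S_def u_def
    by (simp add: scaleR_sum_right sum_subtractf[symmetric] algebra_simps sum.distrib[symmetric] sum_negf[symmetric])
  have main: "inner g P + L / 2 * (norm P)\<^sup>2
      \<le> (\<Sum>i\<in>I. a i * \<tau> i / (2 * L) * ((norm (d i + G i - g))\<^sup>2 - (norm g)\<^sup>2))"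
  proof -
    let ?p = "\<lambda>i. - (\<tau> i / L) *\<^sub>R (d i + G i)"
    have "inner g P + L / 2 * (norm P)\<^sup>2
        \<le> (\<Sum>i\<in>I. a i * inner g (?p i)) + L / 2 * (\<Sum>i\<in>I. a i * (norm (?p i))\<^sup>2)"
    proof (intro add_mono mult_left_mono)
      show "inner g P \<le> (\<Sum>i\<in>I. a i * inner g (?p i))"
        unfolding P_def by (simp only: inner_sum_right inner_scaleR_right)
      show "(norm P)\<^sup>2 \<le> (\<Sum>i\<in>I. a i * (norm (?p i))\<^sup>2)"
        unfolding P_def by (rule norm_weighted_sum_squared_le[OF a])
    qed (use L in simp)
    also have "\<dots> = (\<Sum>i\<in>I. a i * (inner g (?p i) + L / 2 * (norm (?p i))\<^sup>2))"
      by (simp only: sum_distrib_left sum.distrib[symmetric] distrib_left mult.left_commute)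
    also have "\<dots> \<le> (\<Sum>i\<in>I. a i * (\<tau> i / (2 * L) * ((norm (d i + G i - g))\<^sup>2 - (norm g)\<^sup>2)))"
      by (intro sum_mono mult_left_mono short_step_le a \<tau> L)
    finally show ?thesis by (simp only: mult.assoc[symmetric] times_divide_eq_right)
  qed
  have split: "(\<Sum>i\<in>I. \<Sum>j\<in>I. f i j) = (\<Sum>i\<in>I. f i i) + (\<Sum>i\<in>I. \<Sum>j\<in>I - {i}. f i j)"
    for f :: "'i \<Rightarrow> 'i \<Rightarrow> real"
    by (simp add: sum.remove[OF I] sum.distrib[symmetric])
  define diag where "diag = (\<Sum>i\<in>I. inner (N i) ((u i * u i) *\<^sub>R (N i + 2 *\<^sub>R (d i + G i))))"
  define off where
    "off = (\<Sum>i\<in>I. \<Sum>j\<in>I - {i}. inner (N i) ((u i * u j) *\<^sub>R (N j + 2 *\<^sub>R (d j + G j))))"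
  have expand: "inner g D + L / 2 * (norm D)\<^sup>2
      = (inner g P + L / 2 * (norm P)\<^sup>2) - (1 / L) * inner S g
        + (1 / (2 * L)) * (inner S S + 2 * inner S V)"
  proof -
    have "(norm D)\<^sup>2 = (norm P)\<^sup>2 + (1 / L) * ((1 / L) * (inner S S + 2 * inner S V))"
      unfolding D P power2_norm_eq_inner
      by (simp add: inner_diff inner_commute algebra_simps)
    moreover have "inner g D = inner g P - (1 / L) * inner S g"
      unfolding D by (simp add: inner_diff_right inner_commute)
    moreover have "L / 2 * ((1 / L) * ((1 / L) * r)) = (1 / (2 * L)) * r" for r
      using L by simp
    ultimately show ?thesis by (simp only: distrib_left[of "L / 2"])
  qed
  have cross: "inner S S + 2 * inner S V = diag + off"
  proof -
    have "inner S S + 2 * inner S V = inner S (\<Sum>j\<in>I. u j *\<^sub>R (N j + 2 *\<^sub>R (d j + G j)))"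
      unfolding V_def S_def
      by (simp only: scaleR_add_right sum.distrib inner_add_right scaleR_left_commute[of _ 2]
          scaleR_sum_right[symmetric] inner_scaleR_right distrib_left)
    also have "\<dots> = (\<Sum>i\<in>I. \<Sum>j\<in>I. inner (N i) ((u i * u j) *\<^sub>R (N j + 2 *\<^sub>R (d j + G j))))"
      unfolding S_def inner_sum_left
      by (intro sum.cong refl)
        (simp only: inner_sum_right inner_scaleR_left inner_scaleR_right sum_distrib_left mult_ac)
    also have "\<dots> = diag + off" unfolding diag_def off_def by (rule split)
    finally show ?thesis .
  qed
  have diag: "diag \<le> (\<Sum>i\<in>I. (u i)\<^sup>2 * (2 * (norm (N i))\<^sup>2 + (norm (G i))\<^sup>2)
      + 2 * ((u i)\<^sup>2 * inner (N i) (d i)))"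
    unfolding diag_def
  proof (rule sum_mono)
    fix i
    \<comment> \<open>Young's inequality for the correlated pair \<open>N i\<close>, \<open>G i\<close>.\<close>
    have "0 \<le> (norm (N i - G i))\<^sup>2" by simp
    then have "inner (N i) (N i + 2 *\<^sub>R (d i + G i))
        \<le> (2 * (norm (N i))\<^sup>2 + (norm (G i))\<^sup>2) + 2 * inner (N i) (d i)"
      by (simp add: power2_norm_eq_inner inner_diff inner_add inner_commute)
    from mult_left_mono[OF this zero_le_power2[of "u i"]]
    show "inner (N i) ((u i * u i) *\<^sub>R (N i + 2 *\<^sub>R (d i + G i)))
        \<le> (u i)\<^sup>2 * (2 * (norm (N i))\<^sup>2 + (norm (G i))\<^sup>2) + 2 * ((u i)\<^sup>2 * inner (N i) (d i))"
      unfolding inner_scaleR_right power2_eq_square[of "u i"] distrib_left[of "u i * u i" "_ + _"]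
      by (simp only: mult.left_commute)
  qed
  have e1: "(1 / L) * inner S g = (\<Sum>i\<in>I. u i / L * inner (N i) g)"
    unfolding S_def by (simp add: inner_sum_left sum_distrib_left)
  have e2: "(1 / (2 * L)) * diag
      \<le> (\<Sum>i\<in>I. (u i)\<^sup>2 / (2 * L) * (2 * (norm (N i))\<^sup>2 + (norm (G i))\<^sup>2))
        + (\<Sum>i\<in>I. (u i)\<^sup>2 / L * inner (N i) (d i))"
  proof -
    have "(1 / (2 * L)) * diag \<le> (1 / (2 * L)) * (\<Sum>i\<in>I. (u i)\<^sup>2 * (2 * (norm (N i))\<^sup>2 + (norm (G i))\<^sup>2)
      + 2 * ((u i)\<^sup>2 * inner (N i) (d i)))"
      using L by (intro mult_left_mono diag) simp
    also have "\<dots> = (\<Sum>i\<in>I. (u i)\<^sup>2 / (2 * L) * (2 * (norm (N i))\<^sup>2 + (norm (G i))\<^sup>2)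
        + (u i)\<^sup>2 / L * inner (N i) (d i))"
      unfolding sum_distrib_left distrib_left[of "1 / (2 * L)"]
      by (intro sum.cong refl arg_cong2[where f = "(+)"]) simp_all
    finally show ?thesis by (simp only: sum.distrib)
  qed
  have e3: "(1 / (2 * L)) * off = (\<Sum>i\<in>I. \<Sum>j\<in>I - {i}. inner (N i)
       ((u i * u j / (2 * L)) *\<^sub>R (N j + 2 *\<^sub>R (d j + G j))))"
    unfolding off_def sum_distrib_left inner_scaleR_right by (intro sum.cong refl) simp
  have e4: "(\<Sum>i\<in>I. inner (N i) (- (u i / L) *\<^sub>R g + ((u i)\<^sup>2 / L) *\<^sub>R d i))
      = (\<Sum>i\<in>I. (u i)\<^sup>2 / L * inner (N i) (d i)) - (\<Sum>i\<in>I. u i / L * inner (N i) g)"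
    by (simp add: inner_add_right inner_diff_right sum_subtractf[symmetric])
  have "inner g D + L / 2 * (norm D)\<^sup>2 \<le>
    (\<Sum>i\<in>I. a i * \<tau> i / (2 * L) * ((norm (d i + G i - g))\<^sup>2 - (norm g)\<^sup>2)
         + (u i)\<^sup>2 / (2 * L) * (2 * (norm (N i))\<^sup>2 + (norm (G i))\<^sup>2))
    + (\<Sum>i\<in>I. inner (N i) (- (u i / L) *\<^sub>R g + ((u i)\<^sup>2 / L) *\<^sub>R d i))
    + (\<Sum>i\<in>I. \<Sum>j\<in>I - {i}. inner (N i)
         ((u i * u j / (2 * L)) *\<^sub>R (N j + 2 *\<^sub>R (d j + G j))))"
    using main e2 unfolding expand cross e1 e4 e3[symmetric] sum.distrib distrib_left[of "1 / (2 * L)"]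
    by linarith
  then show ?thesis by (simp only: u_def)
qed

context hew_local_sgd
begin

text \<open>Averages over the local steps of a node: of the noise, and of the change of its gradient
  along the local path.\<close>

definition mean_noise_of :: "nat \<Rightarrow> nat \<Rightarrow> (nat \<Rightarrow> nat set) \<Rightarrow> 'w \<Rightarrow> real ^ 'd" where
  "mean_noise_of t i \<beta> \<omega> = (1 / real (H i)) *\<^sub>R (\<Sum>l<H i. noise_of t i l \<beta> \<omega>)"

definition mean_noise :: "nat \<Rightarrow> nat \<Rightarrow> 'w \<Rightarrow> real ^ 'd" where
  "mean_noise t i \<omega> = (1 / real (H i)) *\<^sub>R (\<Sum>l<H i. noise t i l \<omega>)"

definition grad_gap_of :: "nat \<Rightarrow> nat \<Rightarrow> (nat \<Rightarrow> nat set) \<Rightarrow> 'w \<Rightarrow> real ^ 'd" where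
  "grad_gap_of t i \<beta> \<omega> = (1 / real (H i)) *\<^sub>R
     (\<Sum>l<H i. act t i \<omega> *\<^sub>R (grad_node i (local_path t i \<beta> l \<omega>) - grad_node i (x t \<omega>)))"

definition grad_gap :: "nat \<Rightarrow> nat \<Rightarrow> 'w \<Rightarrow> real ^ 'd" where
  "grad_gap t i \<omega> = (1 / real (H i)) *\<^sub>R
     (\<Sum>l<H i. act t i \<omega> *\<^sub>R (grad_node i (iterate t i l \<omega>) - grad_node i (x t \<omega>)))"

lemma mean_noise_eq: "mean_noise t i \<omega> = mean_noise_of t i (batch_table t i (H i) \<omega>) \<omega>"
  unfolding mean_noise_def mean_noise_of_def using noise_eq_noise_of[of _ "H i" t i \<omega>] by simp

lemma grad_gap_eq: "grad_gap t i \<omega> = grad_gap_of t i (batch_table t i (H i) \<omega>) \<omega>"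
  unfolding grad_gap_def grad_gap_of_def
  using iterate_eq_local_path[OF less_imp_le, of _ "H i" t i \<omega>] by simp

lemma mean_noise_of_measurable:
  assumes "i \<in> {1..n}" "\<beta> \<in> tables i (H i)"
  shows "mean_noise_of t i \<beta> \<in> borel_measurable (past t)"
  unfolding mean_noise_of_def[abs_def]
  by (intro borel_measurable_scaleR borel_measurable_const borel_measurable_sum
      noise_of_measurable[OF assms]) auto

lemma grad_gap_of_measurable:
  assumes i: "i \<in> {1..n}" and \<beta>: "\<beta> \<in> tables i (H i)"
  shows "grad_gap_of t i \<beta> \<in> borel_measurable (past t)"
proof -
  have [measurable]: "local_path t i \<beta> l \<in> borel_measurable (past t)" if "l \<in> {..<H i}" for l
    using i \<beta> that
    by (intro measurable_local_path[where k = "H i"] state_measurable control_measurable) auto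
  note [measurable] = state_measurable(1)[of t] borel_measurable_grad_node[OF i]
  show ?thesis unfolding grad_gap_of_def[abs_def] by measurable
qed

lemma ess_bdd_mean_noise: "i \<in> {1..n} \<Longrightarrow> ess_bdd M (mean_noise t i)"
  unfolding mean_noise_def[abs_def]
  by (intro ess_bdd_scaleR ess_bdd_const ess_bdd_sum ess_bdd_noise) auto

lemma ess_bdd_grad_gap: "i \<in> {1..n} \<Longrightarrow> ess_bdd M (grad_gap t i)"
  unfolding grad_gap_def[abs_def] scaleR_diff_right
  using ess_bdd_grad_iterate[of i 0 t]
  by (intro ess_bdd_scaleR[OF ess_bdd_const] ess_bdd_sum ess_bdd_diff ess_bdd_grad_iterate) auto

lemma local_displacement:
  assumes i: "i \<in> {1..n}"
  shows "act t i \<omega> *\<^sub>R (iterate t i (H i) \<omega> - x t \<omega>)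
    = - (amp t i \<omega> / L) *\<^sub>R (direction t i \<omega> + grad_gap t i \<omega> + mean_noise t i \<omega>)"
proof -
  let ?e = "amp t i \<omega> / (L * real (H i))"
  let ?\<gamma> = "\<lambda>l. act t i \<omega> *\<^sub>R (grad_node i (iterate t i l \<omega>) - grad_node i (x t \<omega>))"
  have H: "real (H i) \<noteq> 0" using H_pos[OF i] by simp
  have "act t i \<omega> *\<^sub>R (iterate t i k \<omega> - x t \<omega>)
      = - ?e *\<^sub>R (\<Sum>l<k. direction t i \<omega> + ?\<gamma> l + noise t i l \<omega>)" for k
  proof (induction k)
    case (Suc k)
    have dir: "direction t i \<omega> + ?\<gamma> k + noise t i k \<omega>
        = act t i \<omega> *\<^sub>R (grad_batch i (B t i k \<omega>) (iterate t i k \<omega>) - c t i \<omega> + cs t \<omega>)"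
      unfolding direction_def noise_def scaleR_add_right[symmetric]
      by (rule arg_cong[where f = "(*\<^sub>R) (act t i \<omega>)"]) simp
    have act: "(act t i \<omega> * eta t i \<omega>) *\<^sub>R v = ?e *\<^sub>R act t i \<omega> *\<^sub>R v" for v :: "real ^ 'd"
      unfolding act_eta by (auto simp: amp_def act_def)
    have step: "act t i \<omega> *\<^sub>R (iterate t i (Suc k) \<omega> - x t \<omega>) = act t i \<omega> *\<^sub>R (iterate t i k \<omega> - x t \<omega>)
        - (act t i \<omega> * eta t i \<omega>) *\<^sub>R (grad_batch i (B t i k \<omega>) (iterate t i k \<omega>) - c t i \<omega> + cs t \<omega>)"
      unfolding iterate_Suc scaleR_scaleR[symmetric] scaleR_diff_right[symmetric] by simp
    have alg: "- e *\<^sub>R u - e *\<^sub>R v = - e *\<^sub>R (u + v)" for e :: real and u v :: "real ^ 'd"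
      by (simp add: scaleR_add_right)
    show ?case unfolding step act Suc dir[symmetric] sum.lessThan_Suc by (rule alg)
  qed simp
  from this[of "H i"] have "act t i \<omega> *\<^sub>R (iterate t i (H i) \<omega> - x t \<omega>)
      = - ?e *\<^sub>R (real (H i) *\<^sub>R direction t i \<omega> + (\<Sum>l<H i. ?\<gamma> l) + (\<Sum>l<H i. noise t i l \<omega>))"
    by (simp only: sum.distrib sum_constant_scaleR card_lessThan)
  also have "\<dots> = - (amp t i \<omega> / L) *\<^sub>R (direction t i \<omega> + grad_gap t i \<omega> + mean_noise t i \<omega>)"
    unfolding grad_gap_def mean_noise_def using H L_pos by (simp add: scaleR_add_right)
  finally show ?thesis .
qed

lemma mean_noise_second_moment:
  assumes i: "i \<in> {1..n}"
    and Z: "Z \<in> borel_measurable (past t)" "ess_bdd M Z" "\<And>\<omega>. \<omega> \<in> space M \<Longrightarrow> 0 \<le> Z \<omega>"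
  shows "(\<integral>\<omega>. Z \<omega> * (norm (mean_noise t i \<omega>))\<^sup>2 \<partial>M) \<le> (\<integral>\<omega>. Z \<omega> * (noise_level i / real (H i)) \<partial>M)"
proof -
  let ?h = "1 / (real (H i))\<^sup>2"
  have H: "0 < real (H i)" using H_pos[OF i] by simp
  have "(\<integral>\<omega>. Z \<omega> * (norm (mean_noise t i \<omega>))\<^sup>2 \<partial>M)
      = (\<integral>\<omega>. (?h * Z \<omega>) * (norm (\<Sum>l<H i. noise t i l \<omega>))\<^sup>2 \<partial>M)"
    by (rule arg_cong[where f = "integral\<^sup>L M"])
      (auto simp: mean_noise_def power_divide)
  also have "\<dots> \<le> (\<integral>\<omega>. (?h * Z \<omega>) * act t i \<omega> * (real (H i) * noise_level i) \<partial>M)"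
    using Z by (intro noise_energy i order_refl ess_bdd_mult ess_bdd_const) auto
  also have "\<dots> \<le> (\<integral>\<omega>. Z \<omega> * (noise_level i / real (H i)) \<partial>M)"
  proof (rule integral_mono)
    fix \<omega> assume "\<omega> \<in> space M"
    then have "0 \<le> Z \<omega> * (noise_level i / real (H i))"
      using Z(3) variance_level_nonneg[OF i] by (intro mult_nonneg_nonneg divide_nonneg_nonneg) auto
    moreover have "(?h * Z \<omega>) * act t i \<omega> * (real (H i) * noise_level i)
        = act t i \<omega> * (Z \<omega> * (noise_level i / real (H i)))"
      using H by (simp add: power2_eq_square mult_ac)
    ultimately show "(?h * Z \<omega>) * act t i \<omega> * (real (H i) * noise_level i) \<le> Z \<omega> * (noise_level i / real (H i))"
      by (simp only: act_def) auto
  qed (intro integrable_ess_bdd ess_bdd_mult ess_bdd_const ess_bdd_act Z)+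
  finally show ?thesis .
qed

lemma grad_gap_second_moment:
  assumes i: "i \<in> {1..n}"
    and Z: "Z \<in> borel_measurable (past t)" "ess_bdd M Z" "\<And>\<omega>. \<omega> \<in> space M \<Longrightarrow> 0 \<le> Z \<omega>"
  shows "(\<integral>\<omega>. Z \<omega> * (norm (grad_gap t i \<omega>))\<^sup>2 \<partial>M) \<le> (\<integral>\<omega>. Z \<omega> * (L\<^sup>2 * drift_level t i \<omega>) \<partial>M)"
proof -
  have H: "0 < real (H i)" using H_pos[OF i] by simp
  have disp_bdd: "ess_bdd M (disp t i l)" if "l \<le> H i" for l
    unfolding disp_def[abs_def] scaleR_diff_right
    by (intro ess_bdd_diff ess_bdd_iterate i that ess_bdd_scaleR ess_bdd_act ess_bdd_x)
  have gap_le: "(norm (grad_gap t i \<omega>))\<^sup>2 \<le> (L\<^sup>2 / real (H i)) * (\<Sum>l<H i. (norm (disp t i l \<omega>))\<^sup>2)" for \<omega>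
  proof -
    let ?\<gamma> = "\<lambda>l. act t i \<omega> *\<^sub>R (grad_node i (iterate t i l \<omega>) - grad_node i (x t \<omega>))"
    have \<gamma>: "(norm (?\<gamma> l))\<^sup>2 \<le> L\<^sup>2 * (norm (disp t i l \<omega>))\<^sup>2" for l
    proof -
      have "norm (?\<gamma> l) \<le> L * norm (disp t i l \<omega>)"
        using L_smoothD(2)[OF L_smooth_node[OF i]] L_pos by (auto simp: disp_def act_def)
      then have "(norm (?\<gamma> l))\<^sup>2 \<le> (L * norm (disp t i l \<omega>))\<^sup>2" by (intro power_mono) auto
      then show ?thesis by (simp add: power_mult_distrib)
    qed
    have "(norm (grad_gap t i \<omega>))\<^sup>2 = (norm (\<Sum>l<H i. ?\<gamma> l))\<^sup>2 / (real (H i))\<^sup>2"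
      by (simp add: grad_gap_def power_divide)
    also have "\<dots> \<le> (real (H i) * (\<Sum>l<H i. L\<^sup>2 * (norm (disp t i l \<omega>))\<^sup>2)) / (real (H i))\<^sup>2"
    proof (intro divide_right_mono)
      have "(norm (\<Sum>l<H i. ?\<gamma> l))\<^sup>2 \<le> real (H i) * (\<Sum>l<H i. (norm (?\<gamma> l))\<^sup>2)"
        using norm_sum_squared_le[of ?\<gamma> "{..<H i}"] by (simp only: card_lessThan)
      also have "\<dots> \<le> real (H i) * (\<Sum>l<H i. L\<^sup>2 * (norm (disp t i l \<omega>))\<^sup>2)"
        by (intro mult_left_mono sum_mono \<gamma>) simp
      finally show "(norm (\<Sum>l<H i. ?\<gamma> l))\<^sup>2 \<le> real (H i) * (\<Sum>l<H i. L\<^sup>2 * (norm (disp t i l \<omega>))\<^sup>2)" .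
    qed simp
    also have "\<dots> = (L\<^sup>2 / real (H i)) * (\<Sum>l<H i. (norm (disp t i l \<omega>))\<^sup>2)"
      using H by (simp add: power2_eq_square sum_distrib_left[symmetric])
    finally show ?thesis .
  qed
  have int: "integrable M (\<lambda>\<omega>. ((L\<^sup>2 / real (H i)) * Z \<omega>) * (norm (disp t i l \<omega>))\<^sup>2)" if "l < H i" for l
    using that by (intro integrable_ess_bdd ess_bdd_mult ess_bdd_const ess_bdd_power2 ess_bdd_norm Z disp_bdd) auto
  have "(\<integral>\<omega>. Z \<omega> * (norm (grad_gap t i \<omega>))\<^sup>2 \<partial>M)
      \<le> (\<integral>\<omega>. (\<Sum>l<H i. ((L\<^sup>2 / real (H i)) * Z \<omega>) * (norm (disp t i l \<omega>))\<^sup>2) \<partial>M)"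
  proof (rule integral_mono)
    show "integrable M (\<lambda>\<omega>. Z \<omega> * (norm (grad_gap t i \<omega>))\<^sup>2)"
      by (intro integrable_ess_bdd ess_bdd_mult ess_bdd_power2 ess_bdd_norm Z ess_bdd_grad_gap i)
    show "integrable M (\<lambda>\<omega>. \<Sum>l<H i. ((L\<^sup>2 / real (H i)) * Z \<omega>) * (norm (disp t i l \<omega>))\<^sup>2)"
      by (intro Bochner_Integration.integrable_sum int) simp
    fix \<omega> assume "\<omega> \<in> space M"
    from mult_left_mono[OF gap_le[of \<omega>] Z(3)[OF this]]
    show "Z \<omega> * (norm (grad_gap t i \<omega>))\<^sup>2
        \<le> (\<Sum>l<H i. ((L\<^sup>2 / real (H i)) * Z \<omega>) * (norm (disp t i l \<omega>))\<^sup>2)"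
      by (simp only: sum_distrib_left[symmetric] mult_ac)
  qed
  also have "\<dots> = (\<Sum>l<H i. \<integral>\<omega>. ((L\<^sup>2 / real (H i)) * Z \<omega>) * (norm (disp t i l \<omega>))\<^sup>2 \<partial>M)"
    by (intro Bochner_Integration.integral_sum int) simp
  also have "\<dots> \<le> (\<Sum>l<H i. \<integral>\<omega>. ((L\<^sup>2 / real (H i)) * Z \<omega>) * drift_level t i \<omega> \<partial>M)"
    using Z L_pos by (intro sum_mono disp_second_moment i ess_bdd_mult ess_bdd_const) auto
  also have "\<dots> = real (H i) * (\<integral>\<omega>. (1 / real (H i)) * (Z \<omega> * (L\<^sup>2 * drift_level t i \<omega>)) \<partial>M)"
    by (simp add: mult_ac)
  also have "\<dots> = (\<integral>\<omega>. Z \<omega> * (L\<^sup>2 * drift_level t i \<omega>) \<partial>M)"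
    using H by (subst integral_mult_right_zero) simp
  finally show ?thesis .
qed

lemma integral_inner_mean_noise:
  assumes i: "i \<in> {1..n}" and V: "ess_bdd M V"
    and orth: "\<And>l. l < H i \<Longrightarrow> (\<integral>\<omega>. inner (noise t i l \<omega>) (V \<omega>) \<partial>M) = 0"
  shows "(\<integral>\<omega>. inner (mean_noise t i \<omega>) (V \<omega>) \<partial>M) = 0"
proof -
  have int: "integrable M (\<lambda>\<omega>. inner (noise t i l \<omega>) (V \<omega>))" if "l \<in> {..<H i}" for l
    using that by (intro integrable_ess_bdd ess_bdd_inner ess_bdd_noise V i) auto
  have "(\<integral>\<omega>. inner (mean_noise t i \<omega>) (V \<omega>) \<partial>M)
      = (\<integral>\<omega>. (1 / real (H i)) * (\<Sum>l<H i. inner (noise t i l \<omega>) (V \<omega>)) \<partial>M)"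
    by (simp add: mean_noise_def inner_sum_left)
  also have "\<dots> = (1 / real (H i)) * (\<Sum>l<H i. \<integral>\<omega>. inner (noise t i l \<omega>) (V \<omega>) \<partial>M)"
    using int by (subst integral_mult_right_zero, subst Bochner_Integration.integral_sum) auto
  finally show ?thesis using orth by simp
qed

lemma mean_noise_orthogonal:
  assumes i: "i \<in> {1..n}" and V: "V \<in> borel_measurable (past t)" "ess_bdd M V"
  shows "(\<integral>\<omega>. inner (mean_noise t i \<omega>) (V \<omega>) \<partial>M) = 0"
  by (rule integral_inner_mean_noise[OF i V(2) noise_orthogonal[OF i _ measurable_past_loc[OF V(1)] V(2)]])

lemma mean_noise_orthogonal_other:
  assumes i: "i \<in> {1..n}" and j: "j \<in> {1..n}" "j \<noteq> i"
    and meas: "\<And>\<beta>. \<beta> \<in> tables j (H j) \<Longrightarrow> \<Psi> \<beta> \<in> borel_measurable (past t)"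
    and bdd: "ess_bdd M (\<lambda>\<omega>. \<Psi> (batch_table t j (H j) \<omega>) \<omega>)"
  shows "(\<integral>\<omega>. inner (mean_noise t i \<omega>) (\<Psi> (batch_table t j (H j) \<omega>) \<omega>) \<partial>M) = 0"
  by (rule integral_inner_mean_noise[OF i bdd noise_orthogonal_other[OF i _ j meas bdd]])

end

section \<open>The cost function\<close>

lemma T_map_mono:
  fixes a u v :: real
  assumes "0 \<le> a" "0 \<le> u" "u \<le> v"
  shows "T_map a u \<le> T_map a v"
proof -
  have "u * (1 + a * v) \<le> v * (1 + a * u)" using assms by (simp add: algebra_simps)
  moreover have "0 < 1 + a * u" "0 < 1 + a * v"
    using assms by (auto intro!: add_pos_nonneg)
  ultimately show ?thesis by (simp add: T_map_def divide_simps mult.commute)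
qed

lemma quadratic_decrease_le_T_map:
  fixes a u :: real
  assumes "0 \<le> a" "0 \<le> u"
  shows "u - a * u\<^sup>2 \<le> T_map a u"
proof -
  have pos: "0 < 1 + a * u" using assms by (auto intro!: add_pos_nonneg)
  have "(u - a * u\<^sup>2) * (1 + a * u) = u - a\<^sup>2 * u ^ 3"
    by (simp add: algebra_simps power2_eq_square power3_eq_cube)
  also have "\<dots> \<le> u" using assms by simp
  finally show ?thesis using pos by (simp add: T_map_def pos_le_divide_eq)
qed

lemma rho_loss_mono:
  assumes "0 < L" "0 \<le> \<theta>" "V \<le> V'"
  shows "rho_loss L V h k \<theta> U Q \<le> rho_loss L V' h k \<theta> U Q"
  unfolding rho_loss_def using assms
  by (intro add_left_mono mult_left_mono divide_right_mono) auto

lemma kappa_var_mono: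
  assumes "0 < L" "0 \<le> \<theta>" "V \<le> V'"
  shows "kappa_var L V h k \<theta> U Q \<le> kappa_var L V' h k \<theta> U Q"
  unfolding kappa_var_def using assms
  by (intro add_left_mono mult_left_mono divide_right_mono add_nonneg_nonneg) auto

lemma J_cost_mono_variance:
  assumes "0 < L" "\<And>i. i \<in> A \<Longrightarrow> 0 \<le> w i" "\<And>i. i \<in> A \<Longrightarrow> 0 \<le> \<theta> i"
    "\<And>i. i \<in> A \<Longrightarrow> V i \<le> V' i"
  shows "J_cost L R H b V A U Q w \<theta> \<le> J_cost L R H b V' A U Q w \<theta>"
proof -
  have "(\<Sum>i\<in>A. w i * mu_gain L R (V' i) (H i) (b i) (\<theta> i) U Q)
      \<le> (\<Sum>i\<in>A. w i * mu_gain L R (V i) (H i) (b i) (\<theta> i) U Q)"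
    unfolding mu_gain_def using assms
    by (intro sum_mono mult_left_mono diff_left_mono rho_loss_mono) auto
  moreover have "L / 2 * (\<Sum>i\<in>A. (w i)\<^sup>2 * kappa_var L (V i) (H i) (b i) (\<theta> i) U Q)
      \<le> L / 2 * (\<Sum>i\<in>A. (w i)\<^sup>2 * kappa_var L (V' i) (H i) (b i) (\<theta> i) U Q)"
    using assms by (intro sum_mono mult_left_mono kappa_var_mono) auto
  ultimately show ?thesis unfolding J_cost_def by linarith
qed

text \<open>The constants of the cost absorb the losses of a node. Here \<open>E\<close> is the squared error of its
  direction, \<open>G\<close> and \<open>d\<close> are the squared norms of the full gradient and of the direction, and \<open>D\<close> is its
  drift level. There is room to spare: a factor \<open>4\<close> in \<open>\<rho>\<close>, and a factor \<open>2\<close> in the drift part of \<open>\<kappa>\<close>.\<close>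

lemma node_losses_le:
  fixes L \<theta> V U Q E d G :: real and h k :: nat
  assumes L: "0 < L" and \<theta>: "0 \<le> \<theta>" and V: "0 \<le> V" and U: "0 \<le> U" and Q: "0 \<le> Q"
    and E: "E \<le> 4 * Q" and G: "G \<le> 2 * L * U" and d: "d \<le> 2 * G + 2 * E"
    and D: "D = exp (2 * \<theta>) * (\<theta>\<^sup>2 / L\<^sup>2) * (2 * d + 2 * (V / real k / real h))"
  shows "\<theta> / (2 * L) * (2 * E + 2 * (L\<^sup>2 * D)) \<le> rho_loss L V h k \<theta> U Q"
    and "\<theta>\<^sup>2 / (2 * L) * (2 * (V / real k / real h) + L\<^sup>2 * D) \<le> L / 2 * kappa_var L V h k \<theta> U Q"
proof -
  define v where "v = V / real k / real h"
  define e where "e = exp (2 * \<theta>)"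
  define D' where "D' = e * (\<theta>\<^sup>2 / L\<^sup>2) * (8 * L * U + 16 * Q + 2 * v)"
  have v: "0 \<le> v" using V by (simp add: v_def)
  have e: "0 \<le> e" by (simp add: e_def)
  have "2 * d \<le> 8 * L * U + 16 * Q" using E G d by linarith
  then have DD': "D \<le> D'"
    unfolding D D'_def e_def[symmetric] v_def[symmetric] using e by (intro mult_left_mono) auto
  have L2: "L\<^sup>2 * D \<le> L\<^sup>2 * D'" by (intro mult_left_mono DD') simp
  have D': "0 \<le> D'" unfolding D'_def using e v U Q L by (intro mult_nonneg_nonneg add_nonneg_nonneg) auto
  have Vv: "V / (L * real h * real k) = v / L" "V / (L\<^sup>2 * real h * real k) = v / L\<^sup>2"
    by (simp_all add: v_def mult_ac)
  let ?r = "\<theta> / (2 * L) * (8 * Q + 2 * (L\<^sup>2 * D'))"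
  have le4: "r \<le> 4 * r" if "0 \<le> r" for r :: real using that by simp
  have r: "0 \<le> ?r" using \<theta> L Q D' by simp
  have "\<theta> / (2 * L) * (2 * E + 2 * (L\<^sup>2 * D)) \<le> ?r"
  proof (rule mult_left_mono)
    show "2 * E + 2 * (L\<^sup>2 * D) \<le> 8 * Q + 2 * (L\<^sup>2 * D')" using E L2 by linarith
  qed (use \<theta> L in simp)
  also have "\<dots> \<le> 4 * ?r" by (rule le4[OF r])
  also have "4 * ?r = rho_loss L V h k \<theta> U Q"
  proof -
    have Vv3: "\<theta> ^ 3 * V / (L * real h * real k) = \<theta> ^ 3 * (v / L)"
      unfolding Vv(1)[symmetric] by simp
    show ?thesis
      unfolding rho_loss_def Vv3 D'_def e_def[symmetric] using L
      by (simp add: field_simps power2_eq_square power3_eq_cube)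
  qed
  finally show "\<theta> / (2 * L) * (2 * E + 2 * (L\<^sup>2 * D)) \<le> rho_loss L V h k \<theta> U Q" .
  have kappa: "kappa_var L V h k \<theta> U Q = 2 * \<theta>\<^sup>2 * v / L\<^sup>2 + 2 * (\<theta>\<^sup>2 * D')"
    unfolding kappa_var_def D'_def Vv e_def[symmetric] using L
    by (simp add: field_simps power2_eq_square power4_eq_xxxx)
  have "\<theta>\<^sup>2 / (2 * L) * (2 * v + L\<^sup>2 * D) \<le> \<theta>\<^sup>2 / (2 * L) * (2 * v + L\<^sup>2 * D')"
    using L L2 by (intro mult_left_mono add_left_mono) auto
  also have "\<dots> = L / 2 * (2 * \<theta>\<^sup>2 * v / L\<^sup>2 + \<theta>\<^sup>2 * D')"
    using L by (simp add: field_simps power2_eq_square)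
  also have "\<dots> \<le> L / 2 * kappa_var L V h k \<theta> U Q"
    unfolding kappa using L D' by (intro mult_left_mono add_left_mono) auto
  finally show "\<theta>\<^sup>2 / (2 * L) * (2 * (V / real k / real h) + L\<^sup>2 * D) \<le> L / 2 * kappa_var L V h k \<theta> U Q"
    unfolding v_def .
qed

section \<open>The one-round bound\<close>

context hew_local_sgd
begin

text \<open>The weight of an active node, and zero for an inactive one.\<close>

definition weight :: "nat \<Rightarrow> nat \<Rightarrow> 'w \<Rightarrow> real" where
  "weight t i \<omega> = act t i \<omega> * w t i \<omega>"

lemma weight_props:
  assumes "\<omega> \<in> space M"
  shows "0 \<le> weight t i \<omega>" "(\<Sum>i\<in>{1..n}. weight t i \<omega>) = 1"
proof -
  have feas: "feasible \<theta>lo \<theta>hi (S t \<omega>) (\<lambda>i. w t i \<omega>) (\<lambda>i. \<theta> t i \<omega>)"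
    using controls[of t] assms unfolding predictable_feasible_def by blast
  show "0 \<le> weight t i \<omega>" using feas by (auto simp: feasible_def weight_def act_def)
  show "(\<Sum>i\<in>{1..n}. weight t i \<omega>) = 1"
    using feas sum_active[OF assms, of "\<lambda>i. w t i \<omega>" t] by (simp add: feasible_def weight_def)
qed

lemma weight_measurable: "i \<in> {1..n} \<Longrightarrow> weight t i \<in> borel_measurable (past t)"
  unfolding weight_def[abs_def] by (intro borel_measurable_times act_measurable control_measurable)

lemma ess_bdd_weight:
  assumes i: "i \<in> {1..n}" shows "ess_bdd M (weight t i)"
proof (rule ess_bdd_past[OF weight_measurable[OF i], where K = 1])
  fix \<omega> assume \<omega>: "\<omega> \<in> space M"
  have "weight t i \<omega> \<le> (\<Sum>i\<in>{1..n}. weight t i \<omega>)"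
    using i by (intro member_le_sum weight_props[OF \<omega>]) auto
  then show "norm (weight t i \<omega>) \<le> 1" using weight_props[OF \<omega>, of t] by simp
qed

text \<open>The objective gap at the server iterate.\<close>

definition obj_gap :: "nat \<Rightarrow> 'w \<Rightarrow> real" where
  "obj_gap t \<omega> = global_obj n m \<phi> (x t \<omega>) - global_obj n m \<phi> xstar"

lemma minimizer_le: "global_obj n m \<phi> xstar \<le> global_obj n m \<phi> z"
  using minimizer unfolding is_arg_min_def by (meson linorder_not_le)

lemma gap_le:
  assumes "z \<in> cball xstar R"
  shows "global_obj n m \<phi> z - global_obj n m \<phi> xstar \<le> L * R\<^sup>2 / 2"
proof -
  have "global_obj n m \<phi> (xstar + (z - xstar)) \<le> global_obj n m \<phi> xstar
      + inner (grad_glob xstar) (z - xstar) + L / 2 * (norm (z - xstar))\<^sup>2"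
    by (rule L_smooth_descent[OF L_smooth_global])
  moreover have "grad_glob xstar = 0"
    by (rule gradient_at_minimum[OF L_smooth_global minimizer_le])
  moreover have "L / 2 * (norm (z - xstar))\<^sup>2 \<le> L / 2 * R\<^sup>2"
    using assms L_pos by (intro mult_left_mono power_mono) (auto simp: dist_norm norm_minus_commute)
  ultimately show ?thesis by simp
qed

text \<open>Convexity bounds the gap by the gradient norm, smoothness bounds the gradient norm by the gap.\<close>

lemma gap_sq_le_gradient:
  assumes "z \<in> cball xstar R"
  shows "(global_obj n m \<phi> z - global_obj n m \<phi> xstar)\<^sup>2 \<le> R\<^sup>2 * (norm (grad_glob z))\<^sup>2"
proof -
  have "convex_on UNIV (node_obj m \<phi> i)" if "i \<in> {1..n}" for i
    unfolding node_obj_def[abs_def]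
    by (intro convex_on_mean component_convex that) auto
  then have "convex_on UNIV (global_obj n m \<phi>)"
    unfolding global_obj_def[abs_def] by (intro convex_on_mean) auto
  from convex_above_gradient[OF this L_smoothD(1)[OF L_smooth_global], of z xstar]
  have "global_obj n m \<phi> z - global_obj n m \<phi> xstar \<le> inner (grad_glob z) (z - xstar)"
    by (simp add: inner_diff_right)
  also have "\<dots> \<le> norm (grad_glob z) * norm (z - xstar)" by (rule norm_cauchy_schwarz)
  also have "\<dots> \<le> norm (grad_glob z) * R"
    using assms by (intro mult_left_mono) (auto simp: dist_norm norm_minus_commute)
  finally have "(global_obj n m \<phi> z - global_obj n m \<phi> xstar)\<^sup>2 \<le> (norm (grad_glob z) * R)\<^sup>2"
    using minimizer_le[of z] by (intro power_mono) auto
  then show ?thesis by (simp add: power_mult_distrib mult.commute)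
qed

lemma gradient_sq_le_gap:
  "(norm (grad_glob z))\<^sup>2 \<le> 2 * L * (global_obj n m \<phi> z - global_obj n m \<phi> xstar)"
proof -
  have "global_obj n m \<phi> xstar \<le> global_obj n m \<phi> (z + (- (1 / L)) *\<^sub>R grad_glob z)"
    by (rule minimizer_le)
  also have "\<dots> \<le> global_obj n m \<phi> z + inner (grad_glob z) ((- (1 / L)) *\<^sub>R grad_glob z)
      + L / 2 * (norm ((- (1 / L)) *\<^sub>R grad_glob z))\<^sup>2"
    by (rule L_smooth_descent[OF L_smooth_global])
  also have "\<dots> = global_obj n m \<phi> z - (norm (grad_glob z))\<^sup>2 / (2 * L)"
    using L_pos by (simp add: power_mult_distrib power_divide power2_norm_eq_inner[symmetric])
      (simp add: field_simps power2_eq_square)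
  finally show ?thesis using L_pos by (simp add: field_simps)
qed

lemma ess_bdd_obj_gap: "ess_bdd M (obj_gap t)"
proof (rule ess_bddI)
  note [measurable] = measurable_past_M[OF state_measurable(1)[of t]]
  show "obj_gap t \<in> borel_measurable M" unfolding obj_gap_def by measurable
  show "AE \<omega> in M. norm (obj_gap t \<omega>) \<le> L * R\<^sup>2 / 2"
    using good_event[of t]
  proof eventually_elim
    case (elim \<omega>)
    then show ?case using gap_le[of "x t \<omega>"] minimizer_le[of "x t \<omega>"] by (simp add: obj_gap_def)
  qed
qed

lemma ess_bdd_grad_glob: "ess_bdd M (\<lambda>\<omega>. grad_glob (x t \<omega>))"
proof (rule ess_bddI)
  note [measurable] = measurable_past_M[OF state_measurable(1)[of t]]
  show "(\<lambda>\<omega>. grad_glob (x t \<omega>)) \<in> borel_measurable M" by measurable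
  show "AE \<omega> in M. norm (grad_glob (x t \<omega>)) \<le> grad_bound"
    using good_event[of t] by eventually_elim (auto intro: norm_grad_glob)
qed

text \<open>The bound on the conditional expectation of the next gap before it is expressed in the
  upper state.\<close>

definition node_level :: "nat \<Rightarrow> nat \<Rightarrow> 'w \<Rightarrow> real" where
  "node_level t i \<omega> = weight t i \<omega> * amp t i \<omega> / (2 * L) *
       (2 * (norm (direction t i \<omega> - grad_glob (x t \<omega>)))\<^sup>2 - (norm (grad_glob (x t \<omega>)))\<^sup>2
        + 2 * (L\<^sup>2 * drift_level t i \<omega>))
     + (weight t i \<omega> * amp t i \<omega>)\<^sup>2 / (2 * L) *
       (2 * (noise_level i / real (H i)) + L\<^sup>2 * drift_level t i \<omega>)"

lemma ess_bdd_node_level: "i \<in> {1..n} \<Longrightarrow> ess_bdd M (node_level t i)"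
  unfolding node_level_def[abs_def] divide_inverse
  by (intro ess_bdd_add ess_bdd_diff ess_bdd_mult ess_bdd_power2 ess_bdd_norm ess_bdd_const
      ess_bdd_weight ess_bdd_amp ess_bdd_direction ess_bdd_grad_glob ess_bdd_drift_level)

lemma node_level_measurable:
  assumes i: "i \<in> {1..n}" shows "node_level t i \<in> borel_measurable (past t)"
proof -
  note [measurable] = weight_measurable[OF i, of t] amp_measurable[OF i, of t]
    direction_measurable[OF i, of t] state_measurable(1)[of t]
  have [measurable]: "drift_level t i \<in> borel_measurable (past t)"
    unfolding drift_level_def[abs_def] by measurable
  show ?thesis unfolding node_level_def[abs_def] by measurable
qed

lemma next_gap_le:
  fixes t :: nat
  assumes \<omega>: "\<omega> \<in> space M"
  defines "g \<equiv> grad_glob (x t \<omega>)" and "u \<equiv> (\<lambda>i. weight t i \<omega> * amp t i \<omega>)"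
  shows "obj_gap (Suc t) \<omega> \<le> obj_gap t \<omega> +
    ((\<Sum>i\<in>{1..n}. u i / (2 * L) * ((norm (direction t i \<omega> + grad_gap t i \<omega> - g))\<^sup>2 - (norm g)\<^sup>2)
         + (u i)\<^sup>2 / (2 * L) * (2 * (norm (mean_noise t i \<omega>))\<^sup>2 + (norm (grad_gap t i \<omega>))\<^sup>2))
    + (\<Sum>i\<in>{1..n}. inner (mean_noise t i \<omega>) (- (u i / L) *\<^sub>R g + ((u i)\<^sup>2 / L) *\<^sub>R direction t i \<omega>))
    + (\<Sum>i\<in>{1..n}. \<Sum>j\<in>{1..n} - {i}. inner (mean_noise t i \<omega>)
         ((u i * u j / (2 * L)) *\<^sub>R (mean_noise t j \<omega> + 2 *\<^sub>R (direction t j \<omega> + grad_gap t j \<omega>)))))"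
proof -
  define D where "D = (\<Sum>i\<in>{1..n}. weight t i \<omega> *\<^sub>R (- (amp t i \<omega> / L) *\<^sub>R
    (direction t i \<omega> + grad_gap t i \<omega> + mean_noise t i \<omega>)))"
  have "(\<Sum>i\<in>S t \<omega>. w t i \<omega> *\<^sub>R (y t i (H i) \<omega> - x t \<omega>))
      = (\<Sum>i\<in>S t \<omega>. w t i \<omega> *\<^sub>R (iterate t i (H i) \<omega> - x t \<omega>))"
    using iterate_eq_y[OF \<omega>] by simp
  also have "\<dots> = (\<Sum>i\<in>{1..n}. act t i \<omega> *\<^sub>R w t i \<omega> *\<^sub>R (iterate t i (H i) \<omega> - x t \<omega>))"
    by (rule sum_active[OF \<omega>])
  also have "\<dots> = (\<Sum>i\<in>{1..n}. weight t i \<omega> *\<^sub>R (act t i \<omega> *\<^sub>R (iterate t i (H i) \<omega> - x t \<omega>)))"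
    by (intro sum.cong) (auto simp: weight_def act_def)
  also have "\<dots> = D" unfolding D_def by (intro sum.cong refl) (simp only: local_displacement)
  finally have x: "x (Suc t) \<omega> = x t \<omega> + D" using server_step[OF \<omega>] by simp
  have "global_obj n m \<phi> (x (Suc t) \<omega>) \<le> global_obj n m \<phi> (x t \<omega>) + (inner g D + L / 2 * (norm D)\<^sup>2)"
    using L_smooth_descent[OF L_smooth_global, of "x t \<omega>" D] unfolding x g_def by simp
  moreover note weighted_step_le[OF finite_atLeastAtMost weight_props[OF \<omega>] amp_range[OF \<omega>] L_pos D_def, of g]
  ultimately show ?thesis unfolding obj_gap_def u_def by linarith
qed

text \<open>The zero-mean terms of the pathwise bound vanish after integration over an event of the past, and
  the second moments of noise and gradient change are replaced by their bounds.\<close>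

lemma next_gap_integral_le:
  assumes C: "C \<in> sets (past t)"
  shows "(\<integral>\<omega>. indicator C \<omega> * obj_gap (Suc t) \<omega> \<partial>M)
    \<le> (\<integral>\<omega>. indicator C \<omega> * (obj_gap t \<omega> + (\<Sum>i\<in>{1..n}. node_level t i \<omega>)) \<partial>M)"
proof -
  let ?I = "{1..n}"
  let ?g = "\<lambda>\<omega>. grad_glob (x t \<omega>)" and ?o = "\<lambda>\<omega>. indicat_real C \<omega>"
  let ?u = "\<lambda>i \<omega>. weight t i \<omega> * amp t i \<omega>"
  define main where "main i \<omega> = ?u i \<omega> / (2 * L) *
      ((norm (direction t i \<omega> + grad_gap t i \<omega> - ?g \<omega>))\<^sup>2 - (norm (?g \<omega>))\<^sup>2)
    + (?u i \<omega>)\<^sup>2 / (2 * L) * (2 * (norm (mean_noise t i \<omega>))\<^sup>2 + (norm (grad_gap t i \<omega>))\<^sup>2)" for i \<omega>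
  define V where "V i \<omega> = ?o \<omega> *\<^sub>R (- (?u i \<omega> / L) *\<^sub>R ?g \<omega> + ((?u i \<omega>)\<^sup>2 / L) *\<^sub>R direction t i \<omega>)" for i \<omega>
  define \<Psi> where "\<Psi> i j \<beta> \<omega> = (?o \<omega> * (?u i \<omega> * ?u j \<omega> / (2 * L))) *\<^sub>R
      (mean_noise_of t j \<beta> \<omega> + 2 *\<^sub>R (direction t j \<omega> + grad_gap_of t j \<beta> \<omega>))" for i j \<beta> \<omega>
  have C_meas: "?o \<in> borel_measurable (past t)" using C by simp
  have C_bdd: "ess_bdd M ?o" by (rule ess_bdd_past[OF C_meas, where K = 1]) (simp add: indicator_def)
  have u_meas: "?u i \<in> borel_measurable (past t)" if "i \<in> ?I" for i
    by (intro borel_measurable_times weight_measurable amp_measurable that)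
  have u_bdd: "ess_bdd M (?u i)" if "i \<in> ?I" for i
    by (intro ess_bdd_mult ess_bdd_weight ess_bdd_amp that)
  have u_div: "ess_bdd M (\<lambda>\<omega>. ?u i \<omega> / r)" "ess_bdd M (\<lambda>\<omega>. (?u i \<omega>)\<^sup>2 / r)" if "i \<in> ?I" for i r
    unfolding divide_inverse by (intro ess_bdd_mult[OF _ ess_bdd_const] ess_bdd_power2 u_bdd that)+
  have u_nonneg: "0 \<le> ?u i \<omega>" if "\<omega> \<in> space M" for i \<omega>
    using weight_props(1)[OF that] amp_range(1)[OF that] by simp
  have g_meas: "?g \<in> borel_measurable (past t)"
    using measurable_compose[OF state_measurable(1) borel_measurable_grad_glob] .
  have main_bdd: "ess_bdd M (main i)" if "i \<in> ?I" for i
    unfolding main_def[abs_def]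
    by (intro ess_bdd_add ess_bdd_mult[OF u_div(1)] ess_bdd_mult[OF u_div(2)] ess_bdd_mult[OF ess_bdd_const]
        ess_bdd_diff ess_bdd_power2 ess_bdd_norm ess_bdd_direction
        ess_bdd_grad_gap ess_bdd_grad_glob ess_bdd_mean_noise that)
  have V_meas: "V i \<in> borel_measurable (past t)" if i: "i \<in> ?I" for i
  proof -
    note [measurable] = C_meas u_meas[OF i] g_meas direction_measurable[OF i, of t]
    show ?thesis unfolding V_def[abs_def] by measurable
  qed
  have V_bdd: "ess_bdd M (V i)" if i: "i \<in> ?I" for i
  proof -
    have "V i = (\<lambda>\<omega>. ?o \<omega> *\<^sub>R ((?u i \<omega>)\<^sup>2 / L) *\<^sub>R direction t i \<omega> - ?o \<omega> *\<^sub>R (?u i \<omega> / L) *\<^sub>R ?g \<omega>)"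
      by (auto simp: V_def scaleR_diff_right)
    then show ?thesis
      by (simp only:) (intro ess_bdd_diff ess_bdd_scaleR[OF C_bdd] ess_bdd_scaleR[OF u_div(1)[OF i]]
        ess_bdd_scaleR[OF u_div(2)[OF i]] ess_bdd_direction[OF i] ess_bdd_grad_glob)
  qed
  have V0: "(\<integral>\<omega>. inner (mean_noise t i \<omega>) (V i \<omega>) \<partial>M) = 0" if "i \<in> ?I" for i
    by (rule mean_noise_orthogonal[OF that V_meas[OF that] V_bdd[OF that]])
  let ?\<Psi> = "\<lambda>i j \<omega>. \<Psi> i j (batch_table t j (H j) \<omega>) \<omega>"
  have \<Psi>_eq: "?\<Psi> i j \<omega> = ?o \<omega> *\<^sub>R ((?u i \<omega> * ?u j \<omega> / (2 * L)) *\<^sub>R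
      (mean_noise t j \<omega> + 2 *\<^sub>R (direction t j \<omega> + grad_gap t j \<omega>)))" for i j \<omega>
    by (simp add: \<Psi>_def mean_noise_eq grad_gap_eq)
  have \<Psi>_meas: "\<Psi> i j \<beta> \<in> borel_measurable (past t)"
    if i: "i \<in> ?I" and j: "j \<in> ?I" and \<beta>: "\<beta> \<in> tables j (H j)" for i j \<beta>
  proof -
    note [measurable] = C_meas u_meas[OF i] u_meas[OF j] direction_measurable[OF j, of t]
      mean_noise_of_measurable[OF j \<beta>, of t] grad_gap_of_measurable[OF j \<beta>, of t]
    show ?thesis unfolding \<Psi>_def[abs_def] by measurable
  qed
  have \<Psi>_bdd: "ess_bdd M (\<lambda>\<omega>. ?\<Psi> i j \<omega>)" if i: "i \<in> ?I" and j: "j \<in> ?I" for i j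
  proof -
    have "ess_bdd M (\<lambda>\<omega>. ?u i \<omega> * ?u j \<omega> / (2 * L))"
      unfolding divide_inverse by (intro ess_bdd_mult[OF _ ess_bdd_const] ess_bdd_mult[OF u_bdd[OF i] u_bdd[OF j]])
    then show ?thesis
      unfolding \<Psi>_eq
      by (intro ess_bdd_scaleR[OF C_bdd] ess_bdd_scaleR[OF ess_bdd_const] ess_bdd_scaleR ess_bdd_add
          ess_bdd_mean_noise ess_bdd_direction ess_bdd_grad_gap j)
  qed
  have \<Psi>0: "(\<integral>\<omega>. inner (mean_noise t i \<omega>) (?\<Psi> i j \<omega>) \<partial>M) = 0"
    if "i \<in> ?I" "j \<in> ?I - {i}" for i j
    using that by (intro mean_noise_orthogonal_other \<Psi>_meas \<Psi>_bdd) auto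
  have main_le: "(\<integral>\<omega>. ?o \<omega> * main i \<omega> \<partial>M) \<le> (\<integral>\<omega>. ?o \<omega> * node_level t i \<omega> \<partial>M)" if i: "i \<in> ?I" for i
  proof -
    let ?G2 = "\<lambda>\<omega>. (norm (grad_gap t i \<omega>))\<^sup>2" and ?N2 = "\<lambda>\<omega>. (norm (mean_noise t i \<omega>))\<^sup>2"
    let ?d2 = "\<lambda>\<omega>. (norm (direction t i \<omega> - ?g \<omega>))\<^sup>2" and ?g2 = "\<lambda>\<omega>. (norm (?g \<omega>))\<^sup>2"
    let ?D = "\<lambda>\<omega>. L\<^sup>2 * drift_level t i \<omega>" and ?n = "noise_level i / real (H i)"
    let ?v = "\<lambda>\<omega>. (?u i \<omega>)\<^sup>2 / (2 * L)" and ?u' = "\<lambda>\<omega>. ?u i \<omega> / (2 * L)"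
    let ?A = "\<lambda>\<omega>. (?o \<omega> * ?u' \<omega>) * (2 * ?d2 \<omega> - ?g2 \<omega>)"
    let ?ZG = "\<lambda>\<omega>. ?o \<omega> * (2 * ?u' \<omega> + ?v \<omega>)" and ?ZN = "\<lambda>\<omega>. ?o \<omega> * (2 * ?v \<omega>)"
    have ZG: "?ZG \<in> borel_measurable (past t)" "ess_bdd M ?ZG" "\<And>\<omega>. \<omega> \<in> space M \<Longrightarrow> 0 \<le> ?ZG \<omega>"
      and ZN: "?ZN \<in> borel_measurable (past t)" "ess_bdd M ?ZN" "\<And>\<omega>. \<omega> \<in> space M \<Longrightarrow> 0 \<le> ?ZN \<omega>"
    proof -
      note [measurable] = C_meas u_meas[OF i]
      show "?ZG \<in> borel_measurable (past t)" "?ZN \<in> borel_measurable (past t)" by measurable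
      show "ess_bdd M ?ZG" "ess_bdd M ?ZN"
        by (intro ess_bdd_mult[OF C_bdd] ess_bdd_mult[OF ess_bdd_const] ess_bdd_add u_div i)+
      show "0 \<le> ?ZG \<omega>" "0 \<le> ?ZN \<omega>" if "\<omega> \<in> space M" for \<omega>
      proof -
        have u': "0 \<le> ?u' \<omega>" and v: "0 \<le> ?v \<omega>" using u_nonneg[OF that, of i] L_pos by simp_all
        show "0 \<le> ?ZG \<omega>"
          by (rule mult_nonneg_nonneg[OF _ add_nonneg_nonneg[OF mult_nonneg_nonneg[OF _ u'] v]]) simp_all
        show "0 \<le> ?ZN \<omega>"
          by (rule mult_nonneg_nonneg[OF _ mult_nonneg_nonneg[OF _ v]]) simp_all
      qed
    qed
    have intA: "integrable M ?A"
      by (intro integrable_ess_bdd ess_bdd_mult[OF ess_bdd_mult[OF C_bdd u_div(1)[OF i]]] ess_bdd_diff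
          ess_bdd_mult[OF ess_bdd_const] ess_bdd_power2 ess_bdd_norm ess_bdd_direction[OF i] ess_bdd_grad_glob)
    have intG: "integrable M (\<lambda>\<omega>. ?ZG \<omega> * ?G2 \<omega>)"
      by (intro integrable_ess_bdd ess_bdd_mult[OF ZG(2)] ess_bdd_power2 ess_bdd_norm ess_bdd_grad_gap i)
    have intN: "integrable M (\<lambda>\<omega>. ?ZN \<omega> * ?N2 \<omega>)"
      by (intro integrable_ess_bdd ess_bdd_mult[OF ZN(2)] ess_bdd_power2 ess_bdd_norm ess_bdd_mean_noise i)
    have intG': "integrable M (\<lambda>\<omega>. ?ZG \<omega> * ?D \<omega>)"
      by (intro integrable_ess_bdd ess_bdd_mult[OF ZG(2)] ess_bdd_mult[OF ess_bdd_const] ess_bdd_drift_level i)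
    have intN': "integrable M (\<lambda>\<omega>. ?ZN \<omega> * ?n)"
      by (intro integrable_ess_bdd ess_bdd_mult[OF ZN(2)] ess_bdd_const)
    have "(\<integral>\<omega>. ?o \<omega> * main i \<omega> \<partial>M)
        \<le> (\<integral>\<omega>. ?A \<omega> + ?ZG \<omega> * ?G2 \<omega> + ?ZN \<omega> * ?N2 \<omega> \<partial>M)"
    proof (rule integral_mono)
      show "integrable M (\<lambda>\<omega>. ?o \<omega> * main i \<omega>)"
        by (intro integrable_ess_bdd ess_bdd_mult C_bdd main_bdd i)
      show "integrable M (\<lambda>\<omega>. ?A \<omega> + ?ZG \<omega> * ?G2 \<omega> + ?ZN \<omega> * ?N2 \<omega>)"
        by (intro Bochner_Integration.integrable_add intA intG intN)
      fix \<omega> assume \<omega>: "\<omega> \<in> space M"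
      have alg: "o1 * (p * q + r * s + u * v) = (o1 * p) * q + (o1 * r) * s + (o1 * u) * v"
        for o1 p q r s u v :: real by (simp add: distrib_left)
      have eq: "direction t i \<omega> + grad_gap t i \<omega> - ?g \<omega> = (direction t i \<omega> - ?g \<omega>) + grad_gap t i \<omega>" by simp
      have "main i \<omega> \<le> ?u' \<omega> * ((2 * ?d2 \<omega>
            + 2 * ?G2 \<omega>) - ?g2 \<omega>)
          + ?v \<omega> * (2 * ?N2 \<omega> + ?G2 \<omega>)"
        unfolding main_def eq using u_nonneg[OF \<omega>, of i] L_pos
        by (intro add_right_mono mult_left_mono diff_right_mono norm_add_squared_le) simp
      also have "\<dots> = ?u' \<omega> * (2 * ?d2 \<omega> - ?g2 \<omega>)
          + (2 * ?u' \<omega> + ?v \<omega>) * ?G2 \<omega> + (2 * ?v \<omega>) * ?N2 \<omega>"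
        by (simp only: distrib_left distrib_right left_diff_distrib right_diff_distrib mult_ac)
      finally have "?o \<omega> * main i \<omega> \<le> ?o \<omega> * (?u' \<omega> * (2 * ?d2 \<omega> - ?g2 \<omega>)
          + (2 * ?u' \<omega> + ?v \<omega>) * ?G2 \<omega> + (2 * ?v \<omega>) * ?N2 \<omega>)"
        by (intro mult_left_mono) auto
      then show "?o \<omega> * main i \<omega> \<le> ?A \<omega> + ?ZG \<omega> * ?G2 \<omega> + ?ZN \<omega> * ?N2 \<omega>"
        by (rule ord_le_eq_trans[OF _ alg])
    qed
    also have "\<dots> = (\<integral>\<omega>. ?A \<omega> \<partial>M) + (\<integral>\<omega>. ?ZG \<omega> * ?G2 \<omega> \<partial>M)
        + (\<integral>\<omega>. ?ZN \<omega> * ?N2 \<omega> \<partial>M)"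
      by (simp only: Bochner_Integration.integral_add[OF Bochner_Integration.integrable_add[OF intA intG] intN]
          Bochner_Integration.integral_add[OF intA intG])
    also have "\<dots> \<le> (\<integral>\<omega>. ?A \<omega> \<partial>M) + (\<integral>\<omega>. ?ZG \<omega> * ?D \<omega> \<partial>M)
        + (\<integral>\<omega>. ?ZN \<omega> * ?n \<partial>M)"
      by (intro add_mono order_refl grad_gap_second_moment[OF i ZG] mean_noise_second_moment[OF i ZN])
    also have "\<dots> = (\<integral>\<omega>. ?A \<omega> + ?ZG \<omega> * ?D \<omega> + ?ZN \<omega> * ?n \<partial>M)"
      by (simp only: Bochner_Integration.integral_add[OF Bochner_Integration.integrable_add[OF intA intG'] intN']
          Bochner_Integration.integral_add[OF intA intG'])
    also have "\<dots> = (\<integral>\<omega>. ?o \<omega> * node_level t i \<omega> \<partial>M)"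
    proof (intro Bochner_Integration.integral_cong refl)
      fix \<omega>
      have alg: "(o1 * u') * (a - g2) + (o1 * (2 * u' + v)) * r + (o1 * (2 * v)) * s
        = o1 * (u' * (a - g2 + 2 * r) + v * (2 * s + r))" for o1 u' v a g2 r s :: real
        by (simp add: algebra_simps)
      show "?A \<omega> + ?ZG \<omega> * ?D \<omega> + ?ZN \<omega> * ?n
          = ?o \<omega> * node_level t i \<omega>"
        unfolding node_level_def by (rule alg)
    qed
    finally show ?thesis .
  qed
  have int_main: "integrable M (\<lambda>\<omega>. ?o \<omega> * main i \<omega>)" if "i \<in> ?I" for i
    by (intro integrable_ess_bdd ess_bdd_mult C_bdd main_bdd that)
  have int_level: "integrable M (\<lambda>\<omega>. ?o \<omega> * node_level t i \<omega>)" if "i \<in> ?I" for i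
    by (intro integrable_ess_bdd ess_bdd_mult C_bdd ess_bdd_node_level that)
  have int_gap: "integrable M (\<lambda>\<omega>. ?o \<omega> * obj_gap s \<omega>)" for s
    by (intro integrable_ess_bdd ess_bdd_mult C_bdd ess_bdd_obj_gap)
  have int_V: "integrable M (\<lambda>\<omega>. inner (mean_noise t i \<omega>) (V i \<omega>))" if "i \<in> ?I" for i
    by (intro integrable_ess_bdd ess_bdd_inner ess_bdd_mean_noise V_bdd that)
  have int_\<Psi>: "integrable M (\<lambda>\<omega>. inner (mean_noise t i \<omega>) (?\<Psi> i j \<omega>))"
    if "i \<in> ?I" "j \<in> ?I - {i}" for i j
    using that by (intro integrable_ess_bdd ess_bdd_inner ess_bdd_mean_noise \<Psi>_bdd) auto
  let ?a = "\<lambda>\<omega>. \<Sum>i\<in>?I. ?o \<omega> * main i \<omega>" and ?b = "\<lambda>\<omega>. \<Sum>i\<in>?I. inner (mean_noise t i \<omega>) (V i \<omega>)"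
  let ?c = "\<lambda>\<omega>. \<Sum>i\<in>?I. \<Sum>j\<in>?I - {i}. inner (mean_noise t i \<omega>) (?\<Psi> i j \<omega>)"
  have ints: "integrable M ?a" "integrable M ?b" "integrable M ?c"
    by (intro Bochner_Integration.integrable_sum int_main int_V int_\<Psi>; assumption)+
  have b0: "(\<integral>\<omega>. ?b \<omega> \<partial>M) = 0"
    by (subst Bochner_Integration.integral_sum[OF int_V]) (simp_all only: V0 sum.neutral_const cong: sum.cong)
  have c0: "(\<integral>\<omega>. ?c \<omega> \<partial>M) = 0"
  proof -
    have "(\<integral>\<omega>. ?c \<omega> \<partial>M) = (\<Sum>i\<in>?I. \<integral>\<omega>. (\<Sum>j\<in>?I - {i}. inner (mean_noise t i \<omega>) (?\<Psi> i j \<omega>)) \<partial>M)"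
      by (intro Bochner_Integration.integral_sum Bochner_Integration.integrable_sum int_\<Psi>)
    also have "\<dots> = (\<Sum>i\<in>?I. \<Sum>j\<in>?I - {i}. \<integral>\<omega>. inner (mean_noise t i \<omega>) (?\<Psi> i j \<omega>) \<partial>M)"
      by (intro sum.cong refl Bochner_Integration.integral_sum int_\<Psi>)
    also have "\<dots> = 0" by (intro sum.neutral ballI \<Psi>0)
    finally show ?thesis .
  qed
  have "(\<integral>\<omega>. ?o \<omega> * obj_gap (Suc t) \<omega> \<partial>M) \<le> (\<integral>\<omega>. ?o \<omega> * obj_gap t \<omega> + (?a \<omega> + ?b \<omega> + ?c \<omega>) \<partial>M)"
  proof (rule integral_mono)
    show "integrable M (\<lambda>\<omega>. ?o \<omega> * obj_gap t \<omega> + (?a \<omega> + ?b \<omega> + ?c \<omega>))"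
      by (intro Bochner_Integration.integrable_add int_gap ints)
    fix \<omega> assume "\<omega> \<in> space M"
    from mult_left_mono[OF next_gap_le[OF this, of t], of "?o \<omega>"]
    show "?o \<omega> * obj_gap (Suc t) \<omega> \<le> ?o \<omega> * obj_gap t \<omega> + (?a \<omega> + ?b \<omega> + ?c \<omega>)"
      unfolding main_def V_def \<Psi>_eq inner_scaleR_right[of _ "?o \<omega>"] distrib_left[of "?o \<omega>"] sum_distrib_left[of "?o \<omega>"]
      by simp
  qed (rule int_gap)
  also have "\<dots> = (\<integral>\<omega>. ?o \<omega> * obj_gap t \<omega> \<partial>M) + (\<integral>\<omega>. ?a \<omega> \<partial>M)"
    using int_gap ints b0 c0 by simp
  also have "(\<integral>\<omega>. ?a \<omega> \<partial>M) = (\<Sum>i\<in>?I. \<integral>\<omega>. ?o \<omega> * main i \<omega> \<partial>M)"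
    by (rule Bochner_Integration.integral_sum[OF int_main])
  also have "(\<Sum>i\<in>?I. \<integral>\<omega>. ?o \<omega> * main i \<omega> \<partial>M) \<le> (\<Sum>i\<in>?I. \<integral>\<omega>. ?o \<omega> * node_level t i \<omega> \<partial>M)"
    by (intro sum_mono main_le)
  also have "(\<integral>\<omega>. ?o \<omega> * obj_gap t \<omega> \<partial>M) + (\<Sum>i\<in>?I. \<integral>\<omega>. ?o \<omega> * node_level t i \<omega> \<partial>M)
      = (\<integral>\<omega>. ?o \<omega> * (obj_gap t \<omega> + (\<Sum>i\<in>?I. node_level t i \<omega>)) \<partial>M)"
    unfolding distrib_left sum_distrib_left
    by (subst Bochner_Integration.integral_add[OF int_gap Bochner_Integration.integrable_sum[OF int_level]],
        assumption, subst Bochner_Integration.integral_sum[OF int_level], assumption, rule refl)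
  finally show ?thesis by simp
qed

lemma next_gap_cond_exp_le:
  "AE \<omega> in M. real_cond_exp M (past t) (obj_gap (Suc t)) \<omega>
     \<le> obj_gap t \<omega> + (\<Sum>i\<in>{1..n}. node_level t i \<omega>)"
proof -
  interpret F: finite_measure_subalgebra M "past t" by (rule subalgebra_past_prob)
  note [measurable] = state_measurable(1)[of t] node_level_measurable[of _ t]
  show ?thesis
  proof (rule F.real_cond_exp_le_if_integrals_le)
    show "integrable M (obj_gap (Suc t))" by (rule integrable_ess_bdd[OF ess_bdd_obj_gap])
    show "integrable M (\<lambda>\<omega>. obj_gap t \<omega> + (\<Sum>i\<in>{1..n}. node_level t i \<omega>))"
      by (intro integrable_ess_bdd ess_bdd_add ess_bdd_sum ess_bdd_obj_gap ess_bdd_node_level)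
    show "(\<lambda>\<omega>. obj_gap t \<omega> + (\<Sum>i\<in>{1..n}. node_level t i \<omega>)) \<in> borel_measurable (past t)"
      unfolding obj_gap_def by measurable
  qed (rule next_gap_integral_le)
qed

text \<open>The direction of an active node misses the full gradient by the difference of two control
  errors.\<close>

lemma direction_error:
  assumes \<omega>: "\<omega> \<in> space M" and i: "i \<in> S t \<omega>"
    and q: "\<And>j. j \<in> {1..n} \<Longrightarrow> (norm (c t j \<omega> - grad_node j (x t \<omega>)))\<^sup>2 \<le> q"
  shows "(norm (direction t i \<omega> - grad_glob (x t \<omega>)))\<^sup>2 \<le> 4 * q"
proof -
  let ?a = "\<lambda>j. c t j \<omega> - grad_node j (x t \<omega>)"
  have i': "i \<in> {1..n}" by (rule active_in[OF \<omega> i])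
  have a: "norm (?a j) \<le> sqrt q" if "j \<in> {1..n}" for j
    using q[OF that] by (simp add: real_le_rsqrt)
  have "cs t \<omega> - grad_glob (x t \<omega>) = (1 / real n) *\<^sub>R (\<Sum>j\<in>{1..n}. ?a j)"
    unfolding server_control_eq_mean[OF \<omega>] gradient_global by (simp add: sum_subtractf scaleR_diff_right)
  moreover have "norm ((1 / real n) *\<^sub>R (\<Sum>j\<in>{1..n}. ?a j)) \<le> sqrt q"
    using n_pos by (intro norm_mean_le a) auto
  moreover have "direction t i \<omega> - grad_glob (x t \<omega>) = (cs t \<omega> - grad_glob (x t \<omega>)) - ?a i"
    using i by (simp add: direction_def act_def)
  ultimately have "norm (direction t i \<omega> - grad_glob (x t \<omega>)) \<le> sqrt q + sqrt q"
    using a[OF i'] by (simp only:) (rule order_trans[OF norm_triangle_ineq4 add_mono])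
  then have "(norm (direction t i \<omega> - grad_glob (x t \<omega>)))\<^sup>2 \<le> (sqrt q + sqrt q)\<^sup>2"
    by (intro power_mono) auto
  also have "\<dots> = 4 * q"
    using order_trans[OF zero_le_power2 q[OF i']] by (simp add: power2_eq_square)
  finally show ?thesis .
qed

text \<open>On a single outcome, the bound obtained from the actual gap and control errors is at most the cost
  of any upper state that dominates them.\<close>

lemma level_le_J_cost:
  assumes \<omega>: "\<omega> \<in> space M" and ball: "x t \<omega> \<in> cball xstar R"
    and U: "obj_gap t \<omega> \<le> U"
    and Q: "\<And>j. j \<in> {1..n} \<Longrightarrow> (norm (c t j \<omega> - grad_node j (x t \<omega>)))\<^sup>2 \<le> Q"
  shows "obj_gap t \<omega> + (\<Sum>i\<in>{1..n}. node_level t i \<omega>)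
    \<le> J_cost L R H b (variance_level m \<phi> xstar R) (S t \<omega>) U Q (\<lambda>i. w t i \<omega>) (\<lambda>i. \<theta> t i \<omega>)"
proof -
  let ?f = "obj_gap t \<omega>" and ?g = "grad_glob (x t \<omega>)" and ?V = "variance_level m \<phi> xstar R"
  let ?w = "\<lambda>i. w t i \<omega>" and ?\<theta> = "\<lambda>i. \<theta> t i \<omega>"
  let ?\<rho> = "\<lambda>i. rho_loss L (?V i) (H i) (b i) (?\<theta> i) U Q" and ?\<kappa> = "\<lambda>i. kappa_var L (?V i) (H i) (b i) (?\<theta> i) U Q"
  let ?T = "\<lambda>i. T_map (A_coef L R (?\<theta> i)) (U_sharp L R U)"
  have f: "0 \<le> ?f" "?f \<le> U_sharp L R U"
    using minimizer_le U gap_le[OF ball] by (auto simp: obj_gap_def U_sharp_def)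
  have feas: "(\<Sum>i\<in>S t \<omega>. ?w i) = 1" "\<And>i. i \<in> S t \<omega> \<Longrightarrow> 0 \<le> ?w i"
    using controls[of t] \<omega> unfolding predictable_feasible_def feasible_def by auto
  have sum_S: "(\<Sum>i\<in>{1..n}. node_level t i \<omega>) = (\<Sum>i\<in>S t \<omega>. node_level t i \<omega>)"
    using active_nonempty[OF \<omega>, of t]
    by (intro sum.mono_neutral_right) (auto simp: node_level_def weight_def act_def)
  have node: "?w i * ?f + node_level t i \<omega> \<le> ?w i * (?T i + ?\<rho> i) + L / 2 * ((?w i)\<^sup>2 * ?\<kappa> i)"
    if i: "i \<in> S t \<omega>" for i
  proof -
    let ?A = "A_coef L R (?\<theta> i)"
    have i': "i \<in> {1..n}" by (rule active_in[OF \<omega> i])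
    note \<theta> = theta_range[OF \<omega> i]
    have act: "weight t i \<omega> = ?w i" "amp t i \<omega> = ?\<theta> i"
      using i by (simp_all add: weight_def amp_def act_def)
    let ?E = "(norm (direction t i \<omega> - ?g))\<^sup>2" and ?G = "(norm ?g)\<^sup>2"
    have E: "?E \<le> 4 * Q" by (rule direction_error[OF \<omega> i Q])
    have G: "?G \<le> 2 * L * U"
      using gradient_sq_le_gap[of "x t \<omega>"] U L_pos
      by (intro order_trans[OF gradient_sq_le_gap mult_left_mono]) (auto simp: obj_gap_def)
    have d: "(norm (direction t i \<omega>))\<^sup>2 \<le> 2 * ?G + 2 * ?E"
      using norm_add_squared_le[of ?g "direction t i \<omega> - ?g"] by simp
    have Q0: "0 \<le> Q" using order_trans[OF zero_le_power2 Q[OF i']] .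
    have D: "drift_level t i \<omega> = exp (2 * ?\<theta> i) * ((?\<theta> i)\<^sup>2 / L\<^sup>2)
        * (2 * (norm (direction t i \<omega>))\<^sup>2 + 2 * (?V i / real (b i) / real (H i)))"
      unfolding drift_level_def act ..
    note loss = node_losses_le[OF L_pos less_imp_le[OF \<theta>(2)] variance_level_nonneg[OF i'] order_trans[OF f(1) U] Q0 E G d D]
    have gain: "?A * ?f\<^sup>2 \<le> ?\<theta> i / (2 * L) * ?G"
    proof -
      have "?A * ?f\<^sup>2 \<le> ?A * (R\<^sup>2 * ?G)"
        using gap_sq_le_gradient[OF ball] \<theta> L_pos unfolding obj_gap_def A_coef_def
        by (intro mult_left_mono) auto
      then show ?thesis using R_pos by (simp add: A_coef_def)
    qed
    have A0: "0 \<le> ?A" using \<theta> L_pos by (simp add: A_coef_def)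
    have "?f - ?A * ?f\<^sup>2 \<le> ?T i"
      using quadratic_decrease_le_T_map[OF A0 f(1)] T_map_mono[OF A0 f] by linarith
    with gain loss(1) have lin: "?f + ?\<theta> i / (2 * L) * (2 * ?E - ?G + 2 * (L\<^sup>2 * drift_level t i \<omega>)) \<le> ?T i + ?\<rho> i"
      by (simp only: distrib_left right_diff_distrib)
    have "?w i * ?f + node_level t i \<omega>
        = ?w i * (?f + ?\<theta> i / (2 * L) * (2 * ?E - ?G + 2 * (L\<^sup>2 * drift_level t i \<omega>)))
          + (?w i)\<^sup>2 * ((?\<theta> i)\<^sup>2 / (2 * L) * (2 * (?V i / real (b i) / real (H i)) + L\<^sup>2 * drift_level t i \<omega>))"
      unfolding node_level_def act by (simp add: distrib_left power_mult_distrib mult.assoc)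
    also have "\<dots> \<le> ?w i * (?T i + ?\<rho> i) + (?w i)\<^sup>2 * (L / 2 * ?\<kappa> i)"
      by (intro add_mono mult_left_mono lin loss(2) feas(2) i zero_le_power2)
    finally show ?thesis by (simp only: mult.left_commute)
  qed
  have "?f + (\<Sum>i\<in>{1..n}. node_level t i \<omega>) = (\<Sum>i\<in>S t \<omega>. ?w i * ?f + node_level t i \<omega>)"
    unfolding sum_S sum.distrib sum_distrib_right[symmetric] feas(1) by simp
  also have "\<dots> \<le> (\<Sum>i\<in>S t \<omega>. ?w i * (?T i + ?\<rho> i) + L / 2 * ((?w i)\<^sup>2 * ?\<kappa> i))"
    by (intro sum_mono node)
  also have "\<dots> = J_cost L R H b ?V (S t \<omega>) U Q ?w ?\<theta>"
  proof -
    have "U_sharp L R U = (\<Sum>i\<in>S t \<omega>. ?w i * U_sharp L R U)"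
      unfolding sum_distrib_right[symmetric] feas(1) by simp
    then have "U_sharp L R U - (\<Sum>i\<in>S t \<omega>. ?w i * mu_gain L R (?V i) (H i) (b i) (?\<theta> i) U Q)
        = (\<Sum>i\<in>S t \<omega>. ?w i * U_sharp L R U - ?w i * mu_gain L R (?V i) (H i) (b i) (?\<theta> i) U Q)"
      by (simp only: sum_subtractf)
    also have "\<dots> = (\<Sum>i\<in>S t \<omega>. ?w i * (?T i + ?\<rho> i))"
      by (intro sum.cong refl) (simp add: mu_gain_def s_gain_def algebra_simps)
    finally show ?thesis
      unfolding J_cost_def by (simp only: sum.distrib sum_distrib_left)
  qed
  finally show ?thesis .
qed

end

theorem theorem3p1:
  fixes M :: "'w measure"
    and n :: nat and m :: "nat \<Rightarrow> nat"
    and \<phi> :: "nat \<Rightarrow> nat \<Rightarrow> real ^ 'd \<Rightarrow> real"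
    and L R :: real and xstar :: "real ^ 'd"
    and H b :: "nat \<Rightarrow> nat" and \<theta>lo \<theta>hi :: real
    and S :: "nat \<Rightarrow> 'w \<Rightarrow> nat set"
    and B :: "nat \<Rightarrow> nat \<Rightarrow> nat \<Rightarrow> 'w \<Rightarrow> nat set"
    and ws \<theta>s :: "nat \<Rightarrow> nat \<Rightarrow> 'w \<Rightarrow> real"
    and x :: "nat \<Rightarrow> 'w \<Rightarrow> real ^ 'd"
    and y :: "nat \<Rightarrow> nat \<Rightarrow> nat \<Rightarrow> 'w \<Rightarrow> real ^ 'd"
    and c :: "nat \<Rightarrow> nat \<Rightarrow> 'w \<Rightarrow> real ^ 'd"
    and cs :: "nat \<Rightarrow> 'w \<Rightarrow> real ^ 'd"
    and t :: nat
    and U Q :: "'w \<Rightarrow> real"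
    and w \<theta> :: "nat \<Rightarrow> 'w \<Rightarrow> real"
  assumes upper_state:
      "one_step_admissible M n m \<phi> xstar (past_field M n H (x 0) (c 0) B t) (x t) (c t) U Q"
    and controls:
      "predictable_feasible M n \<theta>lo \<theta>hi (past_field M n H (x 0) (c 0) B t) (S t) w \<theta>"
    and run:
      "hew_local_sgd M n m \<phi> L R xstar H b \<theta>lo \<theta>hi S B (ws(t := w)) (\<theta>s(t := \<theta>)) x y c cs"
  shows "(AE \<omega> in M.
            real_cond_exp M
              (control_field M n (past_field M n H (x 0) (c 0) B t) w \<theta>)
              (\<lambda>\<omega>'. global_obj n m \<phi> (x (Suc t) \<omega>') - global_obj n m \<phi> xstar) \<omega>
            \<le> J_cost L R H b (variance_level m \<phi> xstar R) (S t \<omega>) (U \<omega>) (Q \<omega>)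
                 (\<lambda>i. w i \<omega>) (\<lambda>i. \<theta> i \<omega>)) \<and>
         (\<forall>vhat :: nat \<Rightarrow> 'w \<Rightarrow> real.
            (\<forall>\<omega>\<in>space M. \<forall>i\<in>{1..n}. variance_level m \<phi> xstar R i \<le> (vhat i \<omega>)\<^sup>2) \<longrightarrow>
            (\<forall>\<omega>\<in>space M. \<forall>w' \<theta>' :: nat \<Rightarrow> real.
               feasible \<theta>lo \<theta>hi (S t \<omega>) w' \<theta>' \<longrightarrow>
               J_cost L R H b (variance_level m \<phi> xstar R) (S t \<omega>) (U \<omega>) (Q \<omega>) w' \<theta>'
               \<le> J_cost L R H b (\<lambda>i. (vhat i \<omega>)\<^sup>2) (S t \<omega>) (U \<omega>) (Q \<omega>) w' \<theta>'))"
proof -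
  \<comment> \<open>Named before the interpretation, whose own fact \<open>controls\<close> hides the assumption.\<close>
  note feasible_controls = controls
  interpret hew_local_sgd M n m \<phi> L R xstar H b \<theta>lo \<theta>hi S B "ws(t := w)" "\<theta>s(t := \<theta>)" x y c cs
    by (rule run)
  have field: "control_field M n (past t) w \<theta> = past t"
    using feasible_controls unfolding predictable_feasible_def
    by (intro control_field_eq_past[OF past_field_def]) auto
  have bound: "AE \<omega> in M. real_cond_exp M (past t) (obj_gap (Suc t)) \<omega>
      \<le> J_cost L R H b (variance_level m \<phi> xstar R) (S t \<omega>) (U \<omega>) (Q \<omega>) (\<lambda>i. w i \<omega>) (\<lambda>i. \<theta> i \<omega>)"
  proof -
    have "AE \<omega> in M. obj_gap t \<omega> \<le> U \<omega>"
      and "AE \<omega> in M. (MAX i\<in>{1..n}. (norm (c t i \<omega> - grad_node i (x t \<omega>)))\<^sup>2) \<le> Q \<omega>"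
      using upper_state unfolding one_step_admissible_def obj_gap_def by auto
    with next_gap_cond_exp_le[of t] good_event[of t] AE_space show ?thesis
    proof eventually_elim
      case (elim \<omega>)
      have "(norm (c t j \<omega> - grad_node j (x t \<omega>)))\<^sup>2 \<le> Q \<omega>" if "j \<in> {1..n}" for j
        using elim(5) that by (intro order_trans[OF Max_ge elim(5)]) auto
      then have "obj_gap t \<omega> + (\<Sum>i\<in>{1..n}. node_level t i \<omega>)
          \<le> J_cost L R H b (variance_level m \<phi> xstar R) (S t \<omega>) (U \<omega>) (Q \<omega>)
              (\<lambda>i. (ws(t := w)) t i \<omega>) (\<lambda>i. (\<theta>s(t := \<theta>)) t i \<omega>)"
        using elim by (intro level_le_J_cost) auto
      with elim(1) show ?case by simp
    qed
  qed
  have proxy: "J_cost L R H b (variance_level m \<phi> xstar R) (S t \<omega>) (U \<omega>) (Q \<omega>) w' \<theta>'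
      \<le> J_cost L R H b (\<lambda>i. (vhat i \<omega>)\<^sup>2) (S t \<omega>) (U \<omega>) (Q \<omega>) w' \<theta>'"
    if "\<forall>\<omega>\<in>space M. \<forall>i\<in>{1..n}. variance_level m \<phi> xstar R i \<le> (vhat i \<omega>)\<^sup>2" "\<omega> \<in> space M"
      "feasible \<theta>lo \<theta>hi (S t \<omega>) w' \<theta>'" for vhat :: "nat \<Rightarrow> 'w \<Rightarrow> real" and \<omega> w' \<theta>'
  proof (rule J_cost_mono_variance[OF L_pos])
    fix i assume i: "i \<in> S t \<omega>"
    show "0 \<le> w' i" using that(3) i by (simp add: feasible_def)
    have "\<theta>' i \<in> {\<theta>lo..\<theta>hi}" using that(3) i by (simp add: feasible_def)
    then show "0 \<le> \<theta>' i" using theta_bounds(1) by simp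
    show "variance_level m \<phi> xstar R i \<le> (vhat i \<omega>)\<^sup>2" using that(1,2) active_in[OF that(2) i] by blast
  qed
  show ?thesis
    unfolding field using bound proxy unfolding obj_gap_def[abs_def] by blast
qed

end
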